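(* Let $b_1,\dots,b_6$ be complex numbers with $b_1\cdots b_6=q$, such that $b_i/b_j\notin q^{\mathbb Z}$ for $1\le i<j\le 6$ and $b_ib_j\notin q^{\mathbb Z}$ for $1\le i\le j\le 6$. Let $V$ and Rahman's functional $\mathbf J$ on $V$ be as defined in the context. Let $\lambda_1,\dots,\lambda_6$ be generic parameters subject to $\lambda_1\cdots\lambda_6=q$. Then, for $f\in V$, $$\mathbf J(f)=\frac{1}{C}\oint f\left(\frac{z+z^{-1}}2\right)\frac{z-z^{-1}}{z^2}\prod_{j=1}^6\frac{\theta(\lambda_jz)}{(b_jz^\pm)_\infty}\,\frac{dz}{2\pi\mathrm i z},$$ where the integration is over a positively oriented contour encircling all poles of the integrand of the form $z\in b_jq^{\mathbb Z}$ and no poles of the form $z\in b_j^{-1}q^{\mathbb Z}$ ($1\le j\le6$), and $$C=\frac{\prod_{j=3}^6\theta(\lambda_j\lambda_2)\left\{\prod_{j=1}^6\theta(\lambda_1b_j)-q\lambda_1^{-2}\prod_{j=1}^6\theta(\lambda_1/b_j)\right\}}{\lambda_2\,\theta(\lambda_1^2,\lambda_1/\lambda_2)\,(q)_\infty\prod_{1\leq i<j\leq 6}(b_ib_j)_\infty}+\mathrm{idem}(\lambda_1;\lambda_2).$$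
   Context: Throughout, $q$ is a fixed complex number with $0<|q|<1$ (the base $q$ is suppressed from the notation). For $k\in\mathbb Z_{\ge 0}$, $(a)_k=(1-a)(1-aq)\cdots(1-aq^{k-1})$; for $k\in\mathbb Z_{<0}$, $(a)_k=\left((1-aq^{-1})\cdots(1-aq^{k})\right)^{-1}$; $(a)_\infty=\prod_{j=0}^\infty(1-aq^j)$; $\theta(x)=(x)_\infty(q/x)_\infty$. Repeated arguments and $\pm$ denote products, e.g. $(bz^\pm)_k=(bz)_k(b/z)_k$, $\theta(x,y)=\theta(x)\theta(y)$. The notation $F+\mathrm{idem}(\lambda_1;\lambda_2)$ means $F$ plus the expression obtained from $F$ by interchanging $\lambda_1$ and $\lambda_2$. $V$ is the vector space of rational functions $f$ in the variable $(z+z^{-1})/2$ that are regular, including at infinity (the degree of the numerator does not exceed the degree of the denominator), except for possible single (simple) poles at the points with $z\in b_jq^{\mathbb Z_{<0}}$ or $z^{-1}\in b_jq^{\mathbb Z_{<0}}$, $1\leq j\leq 6$. It is spanned by the functions $(b_1z^\pm)_{k_1}\cdots(b_6z^\pm)_{k_6}$ with $k_j\in\mathbb Z$, $k_1+\dots+k_6=0$. Rahman's functional $\mathbf J$ is the linear functional on $V$ determined by $$\mathbf J\left((b_1z^\pm)_{k_1}\cdots(b_6z^\pm)_{k_6}\right)=\frac{\prod_{1\leq i<j\leq 6}(b_ib_j)_{k_i+k_j}}{\prod_{j=1}^6q^{\binom{k_j}2}b_j^{k_j}},\qquad k_1+\dots+k_6=0.$$ The contour (in $\mathbb C\setminus\{0\}$,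 encircling the origin) is allowed to depend on $f$. "Generic" means that no denominator vanishes (including $C\ne 0$). *)

theory Defs
  imports
    "HOL-Complex_Analysis.Complex_Analysis"
    "HOL-Computational_Algebra.Polynomial_Factorial"
    "HOL-Computational_Algebra.Field_as_Ring"
begin

section \<open>\<open>q\<close>-shifted factorials and theta functions\<close>

definition qpoch :: "complex \<Rightarrow> complex \<Rightarrow> int \<Rightarrow> complex" where
  "qpoch q a k =
     (if k \<ge> 0 then \<Prod>i<nat k. 1 - a * q ^ i
      else inverse (\<Prod>i=1..nat (- k). 1 - a * q powi (- int i)))"

definition qpoch_inf :: "complex \<Rightarrow> complex \<Rightarrow> complex" where
  "qpoch_inf q a = (\<Prod>j. 1 - a * q ^ j)"

definition qtheta :: "complex \<Rightarrow> complex \<Rightarrow> complex" where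
  "qtheta q x = qpoch_inf q x * qpoch_inf q (q / x)"

section \<open>Rational functions of \<open>x = (z + 1 / z) / 2\<close>\<close>

text \<open>
  Rational functions are elements of the fraction field of the polynomial ring in \<open>x\<close>;
  \<^const>\<open>quot_of_fract\<close> gives the representation in lowest terms.
\<close>

definition rat_num :: "complex poly fract \<Rightarrow> complex poly" where
  "rat_num f = fst (quot_of_fract f)"

definition rat_den :: "complex poly fract \<Rightarrow> complex poly" where
  "rat_den f = snd (quot_of_fract f)"

definition rat_eval :: "complex poly fract \<Rightarrow> complex \<Rightarrow> complex" where
  "rat_eval f x = poly (rat_num f) x / poly (rat_den f) x"

definition rat_scale :: "complex \<Rightarrow> complex poly fract \<Rightarrow> complex poly fract" where
  "rat_scale c f = to_fract [:c:] * f"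

definition joukowski :: "complex \<Rightarrow> complex" where
  "joukowski z = (z + inverse z) / 2"

text \<open>
  The space \<open>V\<close>. The points \<open>z\<close> and \<open>1 / z\<close> give the same \<open>x\<close>, so it suffices to list the
  points \<open>x\<close> coming from \<open>z = b\<^sub>j q\<^sup>-\<^sup>n\<close> with \<open>n \<ge> 1\<close>. The degree condition is
  regularity at infinity.
\<close>

definition rahman_space :: "complex \<Rightarrow> (nat \<Rightarrow> complex) \<Rightarrow> complex poly fract set" where
  "rahman_space q b =
     {f. degree (rat_num f) \<le> degree (rat_den f) \<and>
         (\<forall>x. poly (rat_den f) x = 0 \<longrightarrow>
            order x (rat_den f) = 1 \<and>
            (\<exists>j\<in>{1..6}. \<exists>n::nat. n \<ge> 1 \<and> x = joukowski (b j * q powi (- int n))))}"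

text \<open>
  The rational function \<open>(a z\<^sup>\<plusminus>)\<^sub>k = (a z)\<^sub>k (a / z)\<^sub>k\<close> of \<open>x\<close>, by means of
  \<open>(1 - c z) (1 - c / z) = 1 + c\<^sup>2 - 2 c x\<close>; see \<open>rat_eval_rahman_elem\<close> below.
\<close>

definition pm_factor :: "complex \<Rightarrow> complex poly fract" where
  "pm_factor c = to_fract [:1 + c\<^sup>2, - 2 * c:]"

definition pm_poch :: "complex \<Rightarrow> complex \<Rightarrow> int \<Rightarrow> complex poly fract" where
  "pm_poch q a k =
     (if k \<ge> 0 then \<Prod>i<nat k. pm_factor (a * q ^ i)
      else inverse (\<Prod>i=1..nat (- k). pm_factor (a * q powi (- int i))))"

definition rahman_elem :: "complex \<Rightarrow> (nat \<Rightarrow> complex) \<Rightarrow> (nat \<Rightarrow> int) \<Rightarrow> complex poly fract" where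
  "rahman_elem q b k = (\<Prod>j=1..6. pm_poch q (b j) (k j))"

lemma rat_eval_Fract:
  assumes "poly r x \<noteq> 0"
  shows "rat_eval (Fract p r) x = poly p x / poly r x"
    and "poly (rat_den (Fract p r)) x \<noteq> 0"
proof -
  define a c where "a = rat_num (Fract p r)" and "c = rat_den (Fract p r)"
  have r: "r \<noteq> 0" using assms by auto
  have c: "c \<noteq> 0" unfolding c_def rat_den_def by simp
  have cop: "coprime a c" unfolding a_def c_def rat_num_def rat_den_def
    by (rule coprime_quot_of_fract)
  have "Fract a c = Fract p r"
    unfolding a_def c_def rat_num_def rat_den_def
    by (metis quot_to_fract_def quot_to_fract_quot_of_fract prod.collapse case_prod_conv)
  hence "a * r = p * c" using r c by (simp add: eq_fract)
  hence eq: "poly a x * poly r x = poly p x * poly c x" by (metis poly_mult)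
  show nz: "poly (rat_den (Fract p r)) x \<noteq> 0"
  proof
    assume "poly (rat_den (Fract p r)) x = 0"
    hence c0: "poly c x = 0" by (simp add: c_def)
    with eq assms have a0: "poly a x = 0" by simp
    from a0 c0 have "[:-x, 1:] dvd a" "[:-x, 1:] dvd c" by (simp_all add: poly_eq_0_iff_dvd)
    hence "is_unit [:-x, 1:]" using cop by (meson coprime_common_divisor)
    thus False by (simp add: is_unit_iff_degree)
  qed
  show "rat_eval (Fract p r) x = poly p x / poly r x"
    using eq assms nz by (simp add: rat_eval_def a_def c_def field_simps)
qed

lemma rat_Fract_eq: "f = Fract (rat_num f) (rat_den f)"
  unfolding rat_num_def rat_den_def
  by (metis quot_to_fract_def quot_to_fract_quot_of_fract prod.collapse case_prod_conv)

lemma rat_eval_mult: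
  assumes "poly (rat_den f) x \<noteq> 0" "poly (rat_den g) x \<noteq> 0"
  shows "rat_eval (f * g) x = rat_eval f x * rat_eval g x"
    and "poly (rat_den (f * g)) x \<noteq> 0"
proof -
  have *: "f * g = Fract (rat_num f * rat_num g) (rat_den f * rat_den g)"
    by (subst (1) rat_Fract_eq[of f], subst (1) rat_Fract_eq[of g]) simp
  have nz: "poly (rat_den f * rat_den g) x \<noteq> 0" using assms by simp
  show "rat_eval (f * g) x = rat_eval f x * rat_eval g x"
    unfolding * rat_eval_Fract(1)[OF nz] by (simp add: rat_eval_def)
  show "poly (rat_den (f * g)) x \<noteq> 0"
    unfolding * by (rule rat_eval_Fract(2)[OF nz])
qed

lemma rat_eval_prod:
  assumes "finite A" "\<And>i. i \<in> A \<Longrightarrow> poly (rat_den (f i)) x \<noteq> 0"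
  shows "rat_eval (\<Prod>i\<in>A. f i) x = (\<Prod>i\<in>A. rat_eval (f i) x) \<and>
         poly (rat_den (\<Prod>i\<in>A. f i)) x \<noteq> 0"
  using assms
proof (induction A rule: finite_induct)
  case empty
  have "(1 :: complex poly fract) = Fract 1 1" by (simp add: One_fract_def)
  then show ?case using rat_eval_Fract[of 1 x 1] by simp
next
  case (insert i A)
  then show ?case using rat_eval_mult[of "f i" x "\<Prod>i\<in>A. f i"] by simp
qed

lemma rat_eval_inverse:
  assumes "poly (rat_den f) x \<noteq> 0" "rat_eval f x \<noteq> 0"
  shows "rat_eval (inverse f) x = inverse (rat_eval f x) \<and>
         poly (rat_den (inverse f)) x \<noteq> 0"
proof -
  have nz: "poly (rat_num f) x \<noteq> 0" using assms(2) by (auto simp: rat_eval_def)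
  have *: "inverse f = Fract (rat_den f) (rat_num f)"
    by (subst (1) rat_Fract_eq[of f]) simp
  show ?thesis
    using rat_eval_Fract[OF nz, of "rat_den f"] by (simp add: * rat_eval_def)
qed

lemma rat_eval_pm_factor:
  assumes "z \<noteq> 0"
  shows "rat_eval (pm_factor c) (joukowski z) = (1 - c * z) * (1 - c / z)"
    and "poly (rat_den (pm_factor c)) (joukowski z) \<noteq> 0"
proof -
  have *: "rat_num (pm_factor c) = [:1 + c\<^sup>2, - 2 * c:]" "rat_den (pm_factor c) = 1"
    unfolding rat_num_def rat_den_def pm_factor_def by simp_all
  have "z * inverse z = 1" using assms by simp
  then have "(1 - c * z) * (1 - c * inverse z) = 1 + c\<^sup>2 - 2 * c * ((z + inverse z) / 2)"
    by (simp add: algebra_simps power2_eq_square)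
  then show "rat_eval (pm_factor c) (joukowski z) = (1 - c * z) * (1 - c / z)"
    by (simp only: rat_eval_def * joukowski_def divide_inverse) (simp add: algebra_simps)
  show "poly (rat_den (pm_factor c)) (joukowski z) \<noteq> 0"
    by (simp only: *) simp
qed

lemma rat_eval_pm_poch:
  assumes "z \<noteq> 0"
    and "\<And>n::nat. n \<ge> 1 \<Longrightarrow> 1 - a * q powi (- int n) * z \<noteq> 0 \<and> 1 - a * q powi (- int n) / z \<noteq> 0"
  shows "rat_eval (pm_poch q a k) (joukowski z) = qpoch q (a * z) k * qpoch q (a / z) k \<and>
         poly (rat_den (pm_poch q a k)) (joukowski z) \<noteq> 0"
proof (cases "k \<ge> 0")
  case True
  show ?thesis
    using True rat_eval_prod[of "{..<nat k}" "\<lambda>i. pm_factor (a * q ^ i)" "joukowski z"]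
      rat_eval_pm_factor[OF assms(1)]
    by (simp add: pm_poch_def qpoch_def prod.distrib[symmetric] mult_ac)
next
  case False
  let ?P = "\<Prod>i=1..nat (- k). pm_factor (a * q powi (- int i))"
  have *: "rat_eval ?P (joukowski z) =
             (\<Prod>i=1..nat (- k). (1 - a * q powi (- int i) * z) * (1 - a * q powi (- int i) / z))"
          "poly (rat_den ?P) (joukowski z) \<noteq> 0"
    using rat_eval_prod[of "{1..nat (- k)}" "\<lambda>i. pm_factor (a * q powi (- int i))" "joukowski z"]
      rat_eval_pm_factor[OF assms(1)] by simp_all
  have "rat_eval ?P (joukowski z) \<noteq> 0"
    unfolding *(1)
  proof (subst prod_zero_iff)
    show "\<not> (\<exists>i\<in>{1..nat (- k)}. (1 - a * q powi (- int i) * z) * (1 - a * q powi (- int i) / z) = 0)"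
      using assms(2) by (metis atLeastAtMost_iff mult_eq_0_iff)
  qed simp
  from rat_eval_inverse[OF *(2) this] show ?thesis
    using False unfolding *(1)
    by (simp add: pm_poch_def qpoch_def prod.distrib mult_ac)
qed

lemma rat_eval_rahman_elem:
  assumes "z \<noteq> 0"
    and "\<And>j n. j \<in> {1..6} \<Longrightarrow> n \<ge> (1::nat) \<Longrightarrow>
           1 - b j * q powi (- int n) * z \<noteq> 0 \<and> 1 - b j * q powi (- int n) / z \<noteq> 0"
  shows "rat_eval (rahman_elem q b k) (joukowski z) =
           (\<Prod>j=1..6. qpoch q (b j * z) (k j) * qpoch q (b j / z) (k j))"
proof -
  have *: "rat_eval (pm_poch q (b j) (k j)) (joukowski z) =
             qpoch q (b j * z) (k j) * qpoch q (b j / z) (k j) \<and>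
           poly (rat_den (pm_poch q (b j) (k j))) (joukowski z) \<noteq> 0" if "j \<in> {1..6}" for j
    by (rule rat_eval_pm_poch[OF assms(1)]) (rule assms(2)[OF that])
  have "rat_eval (rahman_elem q b k) (joukowski z) =
          (\<Prod>j=1..6. rat_eval (pm_poch q (b j) (k j)) (joukowski z))"
    unfolding rahman_elem_def
    by (rule rat_eval_prod[THEN conjunct1]) (simp, rule *[THEN conjunct2])
  also have "\<dots> = (\<Prod>j=1..6. qpoch q (b j * z) (k j) * qpoch q (b j / z) (k j))"
    by (rule prod.cong[OF refl]) (rule *[THEN conjunct1])
  finally show ?thesis .
qed

section \<open>Rahman's functional\<close>

definition is_rahman_functional ::
    "complex \<Rightarrow> (nat \<Rightarrow> complex) \<Rightarrow> (complex poly fract \<Rightarrow> complex) \<Rightarrow> bool" where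
  "is_rahman_functional q b J \<longleftrightarrow>
     (\<forall>f\<in>rahman_space q b. \<forall>g\<in>rahman_space q b. J (f + g) = J f + J g) \<and>
     (\<forall>c. \<forall>f\<in>rahman_space q b. J (rat_scale c f) = c * J f) \<and>
     (\<forall>k::nat \<Rightarrow> int. (\<Sum>j=1..6. k j) = 0 \<longrightarrow>
        J (rahman_elem q b k) =
          (\<Prod>i=1..6. \<Prod>j\<in>{i<..6}. qpoch q (b i * b j) (k i + k j)) /
          (\<Prod>j=1..6. q powi (k j * (k j - 1) div 2) * b j powi k j))"

text \<open>
  The conditions determine the functional on \<^const>\<open>rahman_space\<close> only; its values elsewhere
  are arbitrary.
\<close>

definition rahman_J :: "complex \<Rightarrow> (nat \<Rightarrow> complex) \<Rightarrow> complex poly fract \<Rightarrow> complex" where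
  "rahman_J q b = (SOME J. is_rahman_functional q b J)"

section \<open>The integral\<close>

definition rahman_integrand ::
    "complex \<Rightarrow> (nat \<Rightarrow> complex) \<Rightarrow> (nat \<Rightarrow> complex) \<Rightarrow> complex poly fract \<Rightarrow> complex \<Rightarrow> complex" where
  "rahman_integrand q b l f z =
     rat_eval f (joukowski z) * ((z - inverse z) / z\<^sup>2) *
     (\<Prod>j=1..6. qtheta q (l j * z) / (qpoch_inf q (b j * z) * qpoch_inf q (b j / z))) *
     (1 / (2 * of_real pi * \<i> * z))"

text \<open>
  Orientation and the inside/outside of the contour are expressed by winding numbers. Only
  actual poles of the integrand \<open>F\<close> are constrained: no contour in the punctured plane could
  encircle all of the unbounded set \<open>b\<^sub>j q\<^sup>\<int>\<close>.
\<close>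

definition is_rahman_contour ::
    "complex \<Rightarrow> (nat \<Rightarrow> complex) \<Rightarrow> (complex \<Rightarrow> complex) \<Rightarrow> (real \<Rightarrow> complex) \<Rightarrow> bool" where
  "is_rahman_contour q b F \<gamma> \<longleftrightarrow>
     valid_path \<gamma> \<and> pathfinish \<gamma> = pathstart \<gamma> \<and>
     0 \<notin> path_image \<gamma> \<and> winding_number \<gamma> 0 = 1 \<and>
     (\<forall>j\<in>{1..6}. \<forall>n::int. is_pole F (b j * q powi n) \<longrightarrow>
        b j * q powi n \<notin> path_image \<gamma> \<and> winding_number \<gamma> (b j * q powi n) = 1) \<and>
     (\<forall>j\<in>{1..6}. \<forall>n::int. is_pole F (inverse (b j) * q powi n) \<longrightarrow>
        inverse (b j) * q powi n \<notin> path_image \<gamma> \<and>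
        winding_number \<gamma> (inverse (b j) * q powi n) = 0)"

definition rahman_C_term :: "complex \<Rightarrow> (nat \<Rightarrow> complex) \<Rightarrow> (nat \<Rightarrow> complex) \<Rightarrow> complex" where
  "rahman_C_term q b l =
     ((\<Prod>j=3..6. qtheta q (l j * l 2)) *
      ((\<Prod>j=1..6. qtheta q (l 1 * b j)) -
       q * (l 1) powi (-2) * (\<Prod>j=1..6. qtheta q (l 1 / b j)))) /
     (l 2 * (qtheta q ((l 1)\<^sup>2) * qtheta q (l 1 / l 2)) * qpoch_inf q q *
      (\<Prod>i=1..6. \<Prod>j\<in>{i<..6}. qpoch_inf q (b i * b j)))"

definition rahman_C :: "complex \<Rightarrow> (nat \<Rightarrow> complex) \<Rightarrow> (nat \<Rightarrow> complex) \<Rightarrow> complex" where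
  "rahman_C q b l = rahman_C_term q b l + rahman_C_term q b (l(1 := l 2, 2 := l 1))"

end

theory Submission
  imports Defs "HOL-Computational_Algebra.Fundamental_Theorem_Algebra"
begin

text \<open>
  The theorem has a uniqueness and an existence part, because Rahman's functional is specified only by
  its values on the products \<open>(b\<^sub>1z\<^sup>\<plusminus>)\<^bsub>k\<^sub>1\<^esub>\<cdots>(b\<^sub>6z\<^sup>\<plusminus>)\<^bsub>k\<^sub>6\<^esub>\<close> with \<open>k\<^sub>1 + \<cdots> + k\<^sub>6 = 0\<close>.

  Uniqueness (\<open>rahman_functional_unique\<close>): these products span \<open>V\<close>. The product with exponents \<open>-n\<close> at \<open>j\<close>
  and \<open>n\<close> elsewhere has, apart from poles coming from smaller \<open>n\<close>, exactly one simple pole, at \<open>b\<^sub>j q\<^sup>-\<^sup>n\<close>.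
  By induction on \<open>n\<close> all elementary fractions of \<open>V\<close> lie in the span, and partial fractions do the rest.

  Existence (\<open>rahman_integral_functional\<close>): the integral divided by \<open>C\<close> is a linear functional with the
  prescribed values. Since \<open>(bz\<^sup>\<plusminus>)\<^sub>k / (bz\<^sup>\<plusminus>)\<^sub>\<infinity> = 1 / (bq\<^sup>kz\<^sup>\<plusminus>)\<^sub>\<infinity>\<close>, integrating the product
  with exponents \<open>k\<close> is the same as integrating the constant 1 with parameters \<open>b\<^sub>j q\<^bsup>k\<^sub>j\<^esup>\<close>, and \<open>C\<close> picks up
  exactly the prescribed factor under this shift (\<open>rahman_C_shift\<close>). So only the integral of 1 has to be
  evaluated (\<open>base_integral\<close>).

  That evaluation is a matter of linear algebra and one known integral. The theta functions
  \<open>\<theta>(\<lambda>\<^sub>1z)\<cdots>\<theta>(\<lambda>\<^sub>6z)\<close> enter only through their antisymmetric part under \<open>z \<mapsto> 1/z\<close>, and the space of possible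
  antisymmetric parts is two-dimensional: it is spanned by any two general functions
  \<open>z \<theta>(z\<^sup>2) \<theta>(az) \<theta>(a/z)\<close> (\<open>antisym_theta_interpolation\<close>). For \<open>a = b\<^sub>6\<close> the last two factors cancel the poles
  belonging to \<open>b\<^sub>6\<close> and what remains is the Nassrallah-Rahman integral with parameters \<open>b\<^sub>1, \<dots>, b\<^sub>5\<close>; similarly
  for \<open>a = b\<^sub>5\<close>. Expanding in these two functions evaluates the integral, and expanding in the functions with
  \<open>a = \<lambda>\<^sub>1, \<lambda>\<^sub>2\<close> brings the result into the form \<open>C\<close> (\<open>integral6_eval\<close>).

  The Nassrallah-Rahman integral (\<open>nassrallah_rahman\<close>) changes by an explicit factor when one parameter is
  multiplied by \<open>q\<close>, because a combination of the two integrands has the form \<open>F(z) - F(qz)\<close> and \<open>F\<close> has no pole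
  between the contour and its image under \<open>z \<mapsto> qz\<close>. Iteration moves all parameters to 0; the limit is the
  constant term of \<open>(1 - z\<^sup>-\<^sup>2) \<theta>(z\<^sup>2)\<close>, computed from the \<open>q\<close>-binomial theorem.

  All contours are handled through winding numbers. Two closed curves with the same winding number around
  every point outside the domain of holomorphy give the same integral (\<open>contour_integral_homologous\<close>). This
  replaces deformations of contours, and it also shows that the contour in the theorem is immaterial. As the
  integrand may take arbitrary values at removable singularities on the contour, one also needs that
  countably many values do not matter (\<open>contour_integral_cong_countable\<close>).
\<close>

section \<open>Contour integrals and winding numbers\<close>

text \<open>
  Distinct points get distinct members of a countable basis, each isolating its point.
\<close>

lemma countable_if_no_islimpt:
  fixes A :: "'a::second_countable_topology set"
  assumes "\<And>x. x \<in> A \<Longrightarrow> \<not> x islimpt A"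
  shows "countable A"
proof -
  obtain B :: "'a set set" where B: "countable B" "topological_basis B"
    using ex_countable_basis by blast
  have "\<exists>U\<in>B. U \<inter> A = {x}" if x: "x \<in> A" for x
  proof -
    obtain T where T: "x \<in> T" "open T" "\<And>y. y \<in> A \<Longrightarrow> y \<in> T \<Longrightarrow> y = x"
      using assms[OF x] unfolding islimpt_def by blast
    then obtain U where "U \<in> B" "x \<in> U" "U \<subseteq> T"
      using topological_basisE[OF B(2)] by metis
    then show ?thesis using T x by blast
  qed
  then obtain f where f: "\<And>x. x \<in> A \<Longrightarrow> f x \<in> B \<and> f x \<inter> A = {x}" by metis
  have "inj_on f A" by (rule inj_onI) (metis f singleton_inject)
  moreover have "countable (f ` A)" using f B(1) by (meson countable_subset image_subsetI)
  ultimately show ?thesis by (rule countable_image_inj_on[rotated])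
qed

text \<open>
  The difference quotients at \<open>t\<close> stay away from 0.
\<close>

lemma has_vector_derivative_nonzero_isolated:
  fixes g :: "real \<Rightarrow> 'a::real_normed_vector"
  assumes "(g has_vector_derivative D) (at t)" "D \<noteq> 0"
  shows "\<not> t islimpt {s. g s = g t}"
proof
  assume *: "t islimpt {s. g s = g t}"
  have "((\<lambda>s. (g s - g t) /\<^sub>R (s - t)) \<longlongrightarrow> D) (at t)"
  proof -
    have "((\<lambda>s. ((g s - g t) - (s - t) *\<^sub>R D) /\<^sub>R \<bar>s - t\<bar>) \<longlongrightarrow> 0) (at t)"
      using assms(1) unfolding has_vector_derivative_def has_derivative_def
      by (simp add: Lim_ident_at)
    then have "((\<lambda>s. norm (((g s - g t) - (s - t) *\<^sub>R D) /\<^sub>R (s - t))) \<longlongrightarrow> 0) (at t)"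
      using tendsto_norm_zero by fastforce
    then have "((\<lambda>s. ((g s - g t) - (s - t) *\<^sub>R D) /\<^sub>R (s - t)) \<longlongrightarrow> 0) (at t)"
      by (rule tendsto_norm_zero_cancel)
    then have "((\<lambda>s. ((g s - g t) - (s - t) *\<^sub>R D) /\<^sub>R (s - t) + D) \<longlongrightarrow> 0 + D) (at t)"
      by (intro tendsto_intros)
    moreover have "\<forall>\<^sub>F s in at t. ((g s - g t) - (s - t) *\<^sub>R D) /\<^sub>R (s - t) + D = (g s - g t) /\<^sub>R (s - t)"
      by (auto simp: eventually_at_filter scaleR_diff_right)
    ultimately show ?thesis using Lim_transform_eventually by fastforce
  qed
  then have "\<forall>\<^sub>F s in at t. (g s - g t) /\<^sub>R (s - t) \<noteq> 0"
    using assms(2) tendsto_imp_eventually_ne by blast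
  then have "\<forall>\<^sub>F s in at t. g s \<noteq> g t" by eventually_elim auto
  with * show False
    by (auto simp: islimpt_iff_eventually)
qed

text \<open>
  A curve can stay in a point for a positive time, but then its derivative vanishes there; at the remaining
  times the curve leaves the point at once, and these times form a countable set.
\<close>

lemma contour_integral_cong_countable:
  assumes g: "valid_path g" and S: "countable S"
    and eq: "\<And>z. z \<in> path_image g \<Longrightarrow> z \<notin> S \<Longrightarrow> f z = h z"
  shows "contour_integral g f = contour_integral g h"
proof -
  obtain K where K: "finite K" "g C1_differentiable_on {0..1} - K"
    using g unfolding valid_path_def piecewise_C1_differentiable_on_def by auto
  define V where "V = (\<lambda>t. vector_derivative g (at t))"
  define N where "N p = {t \<in> {0..1} - K. g t = p \<and> V t \<noteq> 0}" for p
  have "countable (N p)" for p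
  proof (rule countable_if_no_islimpt)
    fix t assume t: "t \<in> N p"
    then have "g differentiable at t"
      using K(2) unfolding C1_differentiable_on_eq N_def by auto
    then have "(g has_vector_derivative V t) (at t)"
      unfolding V_def by (simp add: vector_derivative_works)
    moreover have "V t \<noteq> 0" using t by (simp add: N_def)
    ultimately have "\<not> t islimpt {s. g s = g t}"
      by (rule has_vector_derivative_nonzero_isolated)
    moreover have "N p \<subseteq> {s. g s = g t}" using t by (auto simp: N_def)
    ultimately show "\<not> t islimpt N p" using islimpt_subset by blast
  qed
  then have "countable (K \<union> (\<Union>p\<in>S. N p))"
    using S K(1) by (simp add: countable_finite)
  then have "negligible (K \<union> (\<Union>p\<in>S. N p))" 
    by (intro negligible_iff_null_sets[THEN iffD2] null_sets_completionI countable_imp_null_set_lborel)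
  then show ?thesis
    unfolding contour_integral_integral
  proof (rule integral_spike)
    fix t assume t: "t \<in> {0..1} - (K \<union> (\<Union>p\<in>S. N p))"
    show "h (g t) * vector_derivative g (at t) = f (g t) * vector_derivative g (at t)"
    proof (cases "g t \<in> S")
      case True
      then have "V t = 0" using t by (auto simp: N_def)
      then show ?thesis by (simp add: V_def)
    next
      case False
      then show ?thesis using eq[of "g t"] t by (auto simp: path_image_def)
    qed
  qed
qed

text \<open>
  The homology form of Cauchy's theorem for two curves. It follows from the version for one curve by joining
  the two curves along a path and back.
\<close>

lemma contour_integral_homologous:
  assumes D: "open D" "connected D" and f: "f holomorphic_on D"
    and g1: "valid_path g1" "pathfinish g1 = pathstart g1" "path_image g1 \<subseteq> D"
    and g2: "valid_path g2" "pathfinish g2 = pathstart g2" "path_image g2 \<subseteq> D"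
    and wn: "\<And>z. z \<notin> D \<Longrightarrow> winding_number g1 z = winding_number g2 z"
  shows "contour_integral g1 f = contour_integral g2 f"
proof -
  have "pathstart g1 \<in> D" "pathstart g2 \<in> D" using g1 g2 by auto
  then obtain d where d: "polynomial_function d" "path_image d \<subseteq> D"
      "pathstart d = pathstart g1" "pathfinish d = pathstart g2"
    using connected_open_polynomial_connected[OF D] by blast
  have vd: "valid_path d" using d(1) by (rule valid_path_polynomial_function)
  \<comment> \<open>Go round \<open>g1\<close>, along \<open>d\<close>, backwards round \<open>g2\<close>, and back along \<open>d\<close>.\<close>
  define p where "p = (g1 +++ d) +++ (reversepath g2 +++ reversepath d)"
  have vp: "valid_path p" unfolding p_def using g1 g2 d vd
    by (intro valid_path_join valid_path_imp_reverse) auto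
  have int: "f contour_integrable_on g" if "valid_path g" "path_image g \<subseteq> D" for g
    using contour_integrable_holomorphic_simple[OF f D(1) that] .
  have "(f has_contour_integral 0) p"
  proof (rule Cauchy_theorem_global[OF D(1) f vp])
    show "pathfinish p = pathstart p" using d by (simp add: p_def)
    show "path_image p \<subseteq> D" using g1 g2 d by (simp add: p_def path_image_join)
    fix w assume w: "w \<notin> D"
    then have n: "w \<notin> path_image g1" "w \<notin> path_image g2" "w \<notin> path_image d"
      using g1 g2 d by auto
    show "winding_number p w = 0" unfolding p_def
      using g1 g2 d vd n wn[OF w]
      by (simp add: winding_number_join winding_number_reversepath valid_path_imp_path
          not_in_path_image_join)
  qed
  moreover have "contour_integral p f = contour_integral g1 f - contour_integral g2 f"
    unfolding p_def using g1 g2 d vd int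
    by (simp add: contour_integral_reversepath valid_path_join valid_path_imp_reverse
        contour_integrable_joinI contour_integrable_reversepath)
  ultimately show ?thesis by (simp add: contour_integral_unique)
qed

text \<open>
  Start with a circle and attach a small loop around each point of \<open>T\<close>, along paths that avoid \<open>S\<close>. The
  annulus is kept because infinitely many further points will lie close to 0 or far out.
\<close>

lemma ex_loop_prescribed_winding:
  fixes S :: "complex set"
  assumes r: "0 \<le> r'" "r' < r" "r < R" and S: "finite S"
    and SR: "\<And>s. s \<in> S \<Longrightarrow> r < norm s \<and> norm s < R" and T: "T \<subseteq> S"
  shows "\<exists>g. valid_path g \<and> pathfinish g = pathstart g \<and>
           path_image g \<subseteq> {z. r' < norm z \<and> norm z < R} - S \<and>
           (\<forall>s\<in>S. winding_number g s = (if s \<in> T then 1 else 0)) \<and>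
           (\<forall>z. norm z \<le> r' \<longrightarrow> winding_number g z = 1)"
  using finite_subset[OF T S] T
proof (induction T rule: finite_induct)
  case empty
  have "winding_number (circlepath 0 r) s = 0" if "s \<in> S" for s
    by (rule winding_number_zero_outside[where s = "cball 0 r"])
       (use r SR[OF that] in \<open>auto simp: path_image_circlepath_nonneg\<close>)
  moreover have "sphere 0 r \<inter> S = {}" using SR by force
  ultimately show ?case using r SR
    by (intro exI[of _ "circlepath 0 r"])
       (auto simp: path_image_circlepath_nonneg winding_number_circlepath)
next
  case (insert p T)
  define G where "G = {z::complex. r' < norm z \<and> norm z < R}"
  have G: "open G"
    unfolding G_def by (intro open_Collect_conj open_Collect_less continuous_intros)
  have "connected G"
    using connected_annulus(1)[of r' "0::complex" R] by (simp add: G_def)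
  then have GS: "open (G - S)" "connected (G - S)"
    using G S by (auto intro: connected_open_delete_finite simp: open_Diff finite_imp_closed)
  obtain g where g: "valid_path g" "pathfinish g = pathstart g" "path_image g \<subseteq> G - S"
     "\<And>s. s \<in> S \<Longrightarrow> winding_number g s = (if s \<in> T then 1 else 0)"
     "\<And>z. norm z \<le> r' \<Longrightarrow> winding_number g z = 1"
    using insert unfolding G_def by blast
  have p: "p \<in> S" using insert by auto
  then have pG: "p \<in> G" using SR r by (force simp: G_def)
  have "open (G - (S - {p}))" using G S by (simp add: open_Diff finite_imp_closed)
  then obtain e where e: "e > 0" "cball p e \<subseteq> G - (S - {p})"
    using pG by (meson open_contains_cball Diff_iff singletonI)
  have pim: "path_image (circlepath p e) = sphere p e"
    using e by (simp add: path_image_circlepath_nonneg)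
  have pe: "sphere p e \<subseteq> G - S" using e by auto
  have "p + e \<in> sphere p e" using e(1) by (simp add: dist_norm)
  then have "p + e \<in> G - S" using pe by blast
  moreover have "pathstart g \<in> G - S" using g(3) by auto
  ultimately obtain d where d: "polynomial_function d" "path_image d \<subseteq> G - S"
      "pathstart d = pathstart g" "pathfinish d = p + e"
    using connected_open_polynomial_connected[OF GS] by blast
  have vd: "valid_path d" using d(1) by (rule valid_path_polynomial_function)
  \<comment> \<open>Attach a lollipop: walk to \<open>p\<close>, go round it once, and walk back.\<close>
  define g' where "g' = (g +++ d) +++ (circlepath p e +++ reversepath d)"
  have wn: "winding_number g' z = winding_number g z + winding_number (circlepath p e) z"
    if "z \<notin> G - S" for z
  proof -
    have n: "z \<notin> path_image g" "z \<notin> path_image (circlepath p e)" "z \<notin> path_image d"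
      using g d pe that pim by auto
    then show ?thesis unfolding g'_def using g d vd
      by (simp add: winding_number_join winding_number_reversepath valid_path_imp_path
          not_in_path_image_join)
  qed
  have wc: "winding_number (circlepath p e) z = 0" if "z \<notin> cball p e" for z
    by (rule winding_number_zero_outside[where s = "cball p e"]) (use pim that in auto)
  have wp: "winding_number (circlepath p e) p = 1"
    using e by (simp add: winding_number_circlepath)
  show ?case
  proof (intro exI[of _ g'] conjI ballI allI impI)
    show "valid_path g'" unfolding g'_def using g d vd
      by (intro valid_path_join valid_path_imp_reverse) auto
    show "pathfinish g' = pathstart g'" using d by (simp add: g'_def)
    show "path_image g' \<subseteq> {z. r' < norm z \<and> norm z < R} - S"
      unfolding G_def[symmetric] g'_def using g d pe pim by (simp add: path_image_join)
    show "winding_number g' s = (if s \<in> insert p T then 1 else 0)" if s: "s \<in> S" for s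
    proof (cases "s = p")
      case True
      then show ?thesis using wn[of s] g(4)[OF s] wp s insert.hyps by auto
    next
      case False
      then have "s \<notin> cball p e" using e(2) s by blast
      then show ?thesis using wn[of s] g(4)[OF s] wc[of s] s False by auto
    qed
    show "winding_number g' z = 1" if "norm z \<le> r'" for z
    proof -
      have "z \<notin> G" using that by (auto simp: G_def)
      moreover from this have "z \<notin> cball p e" using e(2) by blast
      ultimately show ?thesis using wn[of z] g(5)[OF that] wc[of z] by auto
    qed
  qed
qed

lemma winding_number_scale:
  assumes "valid_path g" "p \<notin> path_image g" "c \<noteq> 0"
  shows "winding_number ((*) c \<circ> g) (c * p) = winding_number g p"
proof -
  have a: "(*) c analytic_on UNIV" by (intro analytic_intros)
  have v: "valid_path ((*) c \<circ> g)" using valid_path_compose_analytic[OF assms(1) a] by simp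
  have n: "c * p \<notin> path_image ((*) c \<circ> g)"
    using assms by (auto simp: path_image_compose)
  have "contour_integral ((*) c \<circ> g) (\<lambda>w. 1 / (w - c * p)) =
        contour_integral g (\<lambda>w. deriv ((*) c) w * (1 / (c * w - c * p)))"
    by (rule contour_integral_comp_analyticW[OF a assms(1)]) simp
  also have "(\<lambda>w. deriv ((*) c) w * (1 / (c * w - c * p))) = (\<lambda>w. 1 / (w - p))"
    using assms(3) by (simp add: fun_eq_iff right_diff_distrib[symmetric] del: right_diff_distrib)
  finally show ?thesis
    by (simp only: winding_number_valid_path[OF v n] winding_number_valid_path[OF assms(1,2)])
qed

lemma contour_integral_inverse:
  assumes g: "valid_path g" "0 \<notin> path_image g"
  shows "valid_path (inverse \<circ> g)"
    and "contour_integral (inverse \<circ> g) f = contour_integral g (\<lambda>w. - 1 / w\<^sup>2 * f (1 / w))"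
proof -
  have a: "inverse analytic_on (- {0 :: complex})" by (auto intro!: analytic_intros)
  have s: "path_image g \<subseteq> - {0}" using g by auto
  show "valid_path (inverse \<circ> g)" using valid_path_compose_analytic[OF g(1) a s] .
  show "contour_integral (inverse \<circ> g) f = contour_integral g (\<lambda>w. - 1 / w\<^sup>2 * f (1 / w))"
    unfolding contour_integral_comp_analyticW[OF a g(1) s]
  proof (rule contour_integral_cong[OF refl])
    fix w assume "w \<in> path_image g"
    then have "w \<noteq> 0" using g(2) by auto
    then have "deriv inverse w = - 1 / w\<^sup>2"
      by (intro DERIV_imp_deriv)
        (auto intro!: derivative_eq_intros simp: power2_eq_square inverse_eq_divide)
    then show "deriv inverse w * f (inverse w) = - 1 / w\<^sup>2 * f (1 / w)"
      by (simp add: inverse_eq_divide)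
  qed
qed

lemma winding_number_inverse:
  assumes g: "valid_path g" "0 \<notin> path_image g"
  shows "winding_number (inverse \<circ> g) 0 = - winding_number g 0"
    and "p \<noteq> 0 \<Longrightarrow> p \<notin> path_image g \<Longrightarrow>
      winding_number (inverse \<circ> g) (1 / p) = winding_number g p - winding_number g 0"
proof -
  note v = contour_integral_inverse[OF g]
  have w0: "((\<lambda>w. 1 / (w - 0)) has_contour_integral (2 * pi * \<i> * winding_number g 0)) g"
    using has_contour_integral_winding_number[OF g] .
  have n0: "0 \<notin> path_image (inverse \<circ> g)" using g(2) by (auto simp: path_image_compose)
  have "contour_integral (inverse \<circ> g) (\<lambda>w. 1 / (w - 0)) = contour_integral g (\<lambda>w. - (1 / (w - 0)))"
    unfolding v(2) using g(2)
    by (intro contour_integral_cong[OF refl]) (auto simp: power2_eq_square)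
  also have "\<dots> = - (2 * pi * \<i> * winding_number g 0)"
    by (rule contour_integral_unique[OF has_contour_integral_neg[OF w0]])
  finally show "winding_number (inverse \<circ> g) 0 = - winding_number g 0"
    by (subst winding_number_valid_path[OF v(1) n0]) simp
  assume p: "p \<noteq> 0" "p \<notin> path_image g"
  have wp: "((\<lambda>w. 1 / (w - p)) has_contour_integral (2 * pi * \<i> * winding_number g p)) g"
    using has_contour_integral_winding_number[OF g(1) p(2)] .
  have n1: "1 / p \<notin> path_image (inverse \<circ> g)"
    using p g(2) by (auto simp: path_image_compose field_simps)
  have "contour_integral (inverse \<circ> g) (\<lambda>w. 1 / (w - 1 / p)) =
        contour_integral g (\<lambda>w. 1 / (w - p) - 1 / (w - 0))"
    unfolding v(2)
  proof (rule contour_integral_cong[OF refl])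
    fix w assume "w \<in> path_image g"
    then have w: "w \<noteq> 0" "w - p \<noteq> 0" using g p by auto
    have e: "1 / w - 1 / p = - (w - p) / (w * p)" using w p by (simp add: field_simps)
    show "- 1 / w\<^sup>2 * (1 / (1 / w - 1 / p)) = 1 / (w - p) - 1 / (w - 0)"
      unfolding e using w p
      by (simp add: power2_eq_square divide_simps) (simp add: algebra_simps)
  qed
  also have "\<dots> = 2 * pi * \<i> * winding_number g p - 2 * pi * \<i> * winding_number g 0"
    by (rule contour_integral_unique[OF has_contour_integral_diff[OF wp w0]])
  also have "\<dots> = 2 * pi * \<i> * (winding_number g p - winding_number g 0)"
    by (simp only: right_diff_distrib)
  finally show "winding_number (inverse \<circ> g) (1 / p) = winding_number g p - winding_number g 0"
    by (subst winding_number_valid_path[OF v(1) n1]) simp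
qed

lemma contour_integral_lincomb:
  assumes "f contour_integrable_on g" "h contour_integrable_on g"
  shows "contour_integral g (\<lambda>z. k * f z - l * h z) = k * contour_integral g f - l * contour_integral g h"
  by (rule contour_integral_unique)
     (intro has_contour_integral_diff has_contour_integral_lmul has_contour_integral_integral assms)

lemma circle_integral_powi:
  "((\<lambda>z. z powi m / z) has_contour_integral (if m = 0 then 2 * of_real pi * \<i> else 0)) (circlepath 0 1)"
proof (cases "m = 0")
  case True
  show ?thesis using True has_contour_integral_winding_number[of "circlepath 0 1" 0]
    by (simp add: winding_number_circlepath)
next
  case False
  have "((\<lambda>z. z powi m / z) has_contour_integral 0) (circlepath 0 1)"
  proof (rule Cauchy_theorem_primitive[where S = "- {0}" and f = "\<lambda>z. z powi m / of_int m"])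
    fix x :: complex assume "x \<in> - {0}"
    then have x: "x \<noteq> 0" by simp
    have "((\<lambda>z. z powi m / of_int m) has_field_derivative of_int m * x powi (m - 1) * 1 / of_int m) (at x within - {0})"
      using x by (auto intro!: derivative_eq_intros)
    then show "((\<lambda>z. z powi m / of_int m) has_field_derivative x powi m / x) (at x within - {0})"
      using x False by (simp add: power_int_diff)
  qed auto
  then show ?thesis using False by simp
qed

section \<open>Infinite products and the theta function\<close>

locale nome =
  fixes q :: complex
  assumes q_pos: "0 < norm q" and q_less_1: "norm q < 1"

begin

abbreviation poc :: "complex \<Rightarrow> complex" where "poc a \<equiv> qpoch_inf q a"

abbreviation theta :: "complex \<Rightarrow> complex" where "theta x \<equiv> qtheta q x"

lemma q_nz [simp]: "q \<noteq> 0"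
  using q_pos by auto

lemma norm_q_power_le_1: "norm q ^ n \<le> 1"
  using q_less_1 by (simp add: power_le_one)

lemma q_power_to_0: "(\<lambda>n. q ^ n) \<longlonglongrightarrow> 0"
  using q_less_1 by (simp add: LIMSEQ_power_zero)

lemma summable_norm_pow: "summable (\<lambda>j. norm (a * q ^ j))"
  using q_less_1 by (simp add: norm_mult norm_power summable_mult summable_geometric)

lemma convergent_prod_poc: "convergent_prod (\<lambda>j. 1 - a * q ^ j)"
proof -
  have "summable (\<lambda>j. norm ((1 - a * q ^ j) - 1))"
    using summable_norm_pow[of a] by simp
  then show ?thesis
    by (intro abs_convergent_prod_imp_convergent_prod summable_imp_abs_convergent_prod)
qed

lemma poc_split: "poc a = (\<Prod>i<n. 1 - a * q ^ i) * poc (a * q ^ n)"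
proof -
  have "(\<lambda>j. 1 - a * q ^ j) has_prod ((\<Prod>k<n. 1 - a * q ^ k) * (\<Prod>k. 1 - a * q ^ (k + n)))"
    by (rule has_prod_ignore_initial_segment'[OF convergent_prod_poc])
  then have "poc a = (\<Prod>k<n. 1 - a * q ^ k) * (\<Prod>k. 1 - a * q ^ (k + n))"
    unfolding qpoch_inf_def by (metis has_prod_iff)
  also have "(\<lambda>k. 1 - a * q ^ (k + n)) = (\<lambda>k. 1 - a * q ^ n * q ^ k)"
    by (simp add: power_add mult_ac)
  finally show ?thesis by (simp add: qpoch_inf_def)
qed

lemma poc_rec: "poc a = (1 - a) * poc (q * a)"
  using poc_split[of a 1] by (simp add: mult.commute)

lemma poc_0 [simp]: "poc 0 = 1"
  by (simp add: qpoch_inf_def)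

lemma poc_eq_0_iff: "poc a = 0 \<longleftrightarrow> (\<exists>n. a * q ^ n = 1)"
proof
  assume "poc a = 0"
  then show "\<exists>n. a * q ^ n = 1"
    using prodinf_nonzero[OF convergent_prod_poc[of a]] unfolding qpoch_inf_def
    by (metis diff_eq_eq add_0)
next
  assume "\<exists>n. a * q ^ n = 1"
  then obtain n where n: "a * q ^ n = 1" by blast
  then have "(\<Prod>i<Suc n. 1 - a * q ^ i) = 0" by simp
  then show "poc a = 0" using poc_split[of a "Suc n"] by simp
qed

lemma poc_uniform_limit:
  assumes "compact A"
  shows "uniform_limit A (\<lambda>n a. \<Prod>k<n. 1 - a * q ^ k) poc sequentially"
proof -
  obtain C where C: "\<And>x. x \<in> A \<Longrightarrow> norm x \<le> C"
    using compact_imp_bounded[OF assms] unfolding bounded_iff by blast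
  have "uniformly_convergent_on A (\<lambda>N x. \<Sum>n<N. norm ((1 - x * q ^ n) - 1))"
  proof (rule Weierstrass_m_test')
    show "norm (norm ((1 - x * q ^ n) - 1)) \<le> \<bar>C\<bar> * norm q ^ n" if "x \<in> A" for n x
    proof -
      have "norm x \<le> \<bar>C\<bar>" using C[OF that] by linarith
      then show ?thesis by (simp add: norm_mult norm_power mult_right_mono)
    qed
    show "summable (\<lambda>n. \<bar>C\<bar> * norm q ^ n)"
      using q_less_1 by (simp add: summable_mult summable_geometric)
  qed
  then have "uniformly_convergent_on A (\<lambda>N x. \<Prod>n<N. 1 - x * q ^ n)"
    by (intro uniformly_convergent_on_prod' assms continuous_intros)
  then obtain g where g: "uniform_limit A (\<lambda>N x. \<Prod>n<N. 1 - x * q ^ n) g sequentially"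
    unfolding uniformly_convergent_on_def by blast
  have "g x = poc x" if "x \<in> A" for x
  proof -
    have "(\<lambda>n. \<Prod>k<n. 1 - x * q ^ k) \<longlonglongrightarrow> g x"
      by (rule tendsto_uniform_limitI[OF g that])
    moreover have "(\<lambda>n. \<Prod>k<n. 1 - x * q ^ k) \<longlonglongrightarrow> poc x"
      using convergent_prod_LIMSEQ[OF convergent_prod_poc[of x]]
      by (simp add: qpoch_inf_def LIMSEQ_lessThan_iff_atMost)
    ultimately show ?thesis by (rule LIMSEQ_unique)
  qed
  with g show ?thesis
    by (metis (mono_tags, lifting) uniform_limit_cong')
qed

lemma poc_tendsto: "(\<lambda>n. \<Prod>k<n. 1 - a * q ^ k) \<longlonglongrightarrow> poc a"
  by (rule tendsto_uniform_limitI[OF poc_uniform_limit[of "{a}"]]) auto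

lemma poc_holomorphic: "poc holomorphic_on UNIV"
proof (rule holomorphic_uniform_sequence)
  show "(\<lambda>a. \<Prod>k<n. 1 - a * q ^ k) holomorphic_on UNIV" for n
    by (intro holomorphic_intros)
  show "\<exists>d>0. cball x d \<subseteq> UNIV \<and>
          uniform_limit (cball x d) (\<lambda>n a. \<Prod>k<n. 1 - a * q ^ k) poc sequentially" for x
    by (intro exI[of _ 1]) (simp add: poc_uniform_limit)
qed simp

lemma poc_holo [holomorphic_intros]:
  "f holomorphic_on A \<Longrightarrow> (\<lambda>z. poc (f z)) holomorphic_on A"
  using holomorphic_on_compose[of f A poc] holomorphic_on_subset[OF poc_holomorphic]
  by (simp add: o_def)

lemma isCont_poc: "isCont poc a"
  using poc_holomorphic holomorphic_on_imp_continuous_on continuous_on_eq_continuous_at open_UNIV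
  by blast

lemma poc_cont [continuous_intros]:
  "continuous_on A f \<Longrightarrow> continuous_on A (\<lambda>z. poc (f z))"
  by (rule continuous_on_compose2[of UNIV poc]) (simp_all add: continuous_at_imp_continuous_on isCont_poc)

lemma theta_holo [holomorphic_intros]:
  "f holomorphic_on A \<Longrightarrow> (\<And>z. z \<in> A \<Longrightarrow> f z \<noteq> 0) \<Longrightarrow> (\<lambda>z. theta (f z)) holomorphic_on A"
  unfolding qtheta_def by (intro holomorphic_intros) auto

lemma theta_inverse:
  assumes "x \<noteq> 0"
  shows "theta (1 / x) = - theta x / x"
proof -
  have 1: "poc (1 / x) = (1 - 1 / x) * poc (q / x)" using poc_rec[of "1 / x"] by simp
  have 2: "poc x = (1 - x) * poc (q * x)" by (rule poc_rec)
  show ?thesis unfolding qtheta_def 1 2 using assms by (simp add: field_simps)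
qed

lemma theta_shift: "x \<noteq> 0 \<Longrightarrow> theta (q * x) = - theta x / x"
  using theta_inverse[of x] by (simp add: qtheta_def mult.commute)

lemma theta_inverse': "x \<noteq> 0 \<Longrightarrow> y \<noteq> 0 \<Longrightarrow> theta (x / y) = - (x / y) * theta (y / x)"
  using theta_inverse[of "y / x"] by (simp add: field_simps)

lemma theta_shift_down: "x \<noteq> 0 \<Longrightarrow> theta (x / q) = - (x / q) * theta x"
  using theta_shift[of "x / q"] by (simp add: field_simps)

lemma theta_eq_0_iff:
  assumes "x \<noteq> 0"
  shows "theta x = 0 \<longleftrightarrow> (\<exists>n. x = q powi n)"
proof
  assume "theta x = 0"
  then consider n where "x * q ^ n = 1" | n where "q / x * q ^ n = 1"
    unfolding qtheta_def by (auto simp: poc_eq_0_iff)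
  then show "\<exists>n. x = q powi n"
  proof cases
    case 1
    then have "x = q powi (- int n)" by (simp add: power_int_minus field_simps)
    then show ?thesis ..
  next
    case 2
    then have "x = q ^ Suc n" using assms by (simp add: field_simps)
    then have "x = q powi (int (Suc n))" by (simp only: power_int_of_nat)
    then show ?thesis ..
  qed
next
  assume "\<exists>n. x = q powi n"
  then obtain n where n: "x = q powi n" ..
  show "theta x = 0"
  proof (cases "n \<le> 0")
    case True
    then have "x * q ^ nat (- n) = 1" using n by (simp flip: power_int_of_nat power_int_add)
    then show ?thesis unfolding qtheta_def using poc_eq_0_iff[of x] by auto
  next
    case False
    have "q / x * q ^ nat (n - 1) = q powi 1 * q powi (- n) * q powi (n - 1)"
      using False n by (simp add: power_int_minus divide_simps flip: power_int_of_nat)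
    also have "\<dots> = 1" by (simp only: power_int_add[symmetric] q_nz simp_thms) simp
    finally show ?thesis unfolding qtheta_def using poc_eq_0_iff[of "q / x"] by auto
  qed
qed

lemma theta_deriv_shift:
  assumes "x \<noteq> 0" "theta x = 0"
  shows "deriv theta (q * x) = 0 \<longleftrightarrow> deriv theta x = 0"
proof -
  have d: "(theta has_field_derivative deriv theta y) (at y)" if "y \<noteq> 0" for y
    using theta_holo[of "\<lambda>z. z" "- {0}"] that
    by (intro holomorphic_derivI[of _ "- {0}"]) auto
  have "((\<lambda>y. theta (q * y)) has_field_derivative deriv theta (q * x) * q) (at x)"
    using DERIV_chain2[of theta "deriv theta (q * x)" "\<lambda>y. q * y" x q UNIV] d[of "q * x"] assms
    by (auto intro!: derivative_eq_intros simp: o_def)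
  moreover have "((\<lambda>y. theta (q * y)) has_field_derivative - deriv theta x / x) (at x)"
  proof (rule DERIV_cong[OF has_field_derivative_transform_within_open[where S = "- {0}"]])
    show "((\<lambda>y. - theta y / y) has_field_derivative
            (- deriv theta x * x - - theta x * 1) / (x * x)) (at x)"
      using d[of x] assms by (auto intro!: derivative_eq_intros)
  qed (use assms in \<open>auto simp: theta_shift\<close>)
  ultimately have "deriv theta (q * x) * q = - deriv theta x / x"
    by (rule DERIV_unique)
  then show ?thesis using assms by auto
qed

lemma theta_deriv_one: "deriv theta 1 \<noteq> 0"
proof -
  define h where "h = (\<lambda>x. poc (q * x) * poc (q / x))"
  have "h holomorphic_on - {0}"
    unfolding h_def by (intro holomorphic_intros) auto
  then have "(h has_field_derivative deriv h 1) (at 1)"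
    by (intro holomorphic_derivI[of _ "- {0}"]) auto
  then have "((\<lambda>x. (1 - x) * h x) has_field_derivative - h 1) (at 1)"
    by (auto intro!: derivative_eq_intros)
  then have "((\<lambda>x. (1 - x) * (poc (q * x) * poc (q / x))) has_field_derivative
           - (poc q * poc q)) (at 1)"
    by (simp add: h_def)
  moreover have "(\<lambda>x. (1 - x) * (poc (q * x) * poc (q / x))) = theta"
  proof
    show "(1 - x) * (poc (q * x) * poc (q / x)) = theta x" for x
      unfolding qtheta_def by (subst (3) poc_rec) simp
  qed
  ultimately have "deriv theta 1 = - (poc q * poc q)"
    by (simp add: DERIV_imp_deriv)
  moreover have "poc q \<noteq> 0"
  proof
    assume "poc q = 0"
    then obtain n where "q ^ Suc n = 1" by (auto simp: poc_eq_0_iff)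
    then have "norm q ^ Suc n = 1" by (metis norm_one norm_power)
    then show False using q_less_1 q_pos power_Suc_less_one[of "norm q" n] by simp
  qed
  ultimately show ?thesis by simp
qed

text \<open>
  By \<open>\<theta>(qx) = - \<theta>(x) / x\<close> it suffices to look at the zero \<open>x = 1\<close>, where one factor of the product vanishes to
  first order.
\<close>

lemma theta_simple_zero:
  assumes "x \<noteq> 0" "theta x = 0"
  shows "deriv theta x \<noteq> 0"
proof -
  obtain n where n: "x = q powi n" using assms theta_eq_0_iff by blast
  have z: "theta (q powi m) = 0" for m :: int
    by (subst theta_eq_0_iff) auto
  have "deriv theta (q powi n) \<noteq> 0"
  proof (induction n rule: int_induct[where k = 0])
    case base
    then show ?case using theta_deriv_one by simp
  next
    case (step1 i)
    then show ?case using theta_deriv_shift[of "q powi i"] z[of i]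
      by (simp add: power_int_add mult.commute)
  next
    case (step2 i)
    have "q * q powi (i - 1) = q powi i" by (simp add: power_int_diff)
    then show ?case using step2 theta_deriv_shift[of "q powi (i - 1)"] z[of "i - 1"]
      by simp
  qed
  with n show ?thesis by simp
qed

text \<open>
  Iterate \<open>\<theta>(qx) = - \<theta>(x) / x\<close> in both directions.
\<close>

lemma theta_powi:
  assumes "x \<noteq> 0"
  shows "theta (x * q powi k) = (-1) powi k / (q powi (k * (k - 1) div 2) * x powi k) * theta x"
proof (induction k rule: int_induct[where k = 0])
  case base
  then show ?case by simp
next
  case (step1 i)
  have e: "(i + 1) * (i + 1 - 1) div 2 = i * (i - 1) div 2 + i"
  proof -
    have "(i + 1) * (i + 1 - 1) = i * (i - 1) + 2 * i" by (simp add: algebra_simps)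
    then show ?thesis by simp
  qed
  have "theta (x * q powi (i + 1)) = theta (q * (x * q powi i))"
    by (simp add: power_int_add mult_ac)
  also have "\<dots> = - theta (x * q powi i) / (x * q powi i)"
    using assms by (subst theta_shift) auto
  finally show ?case unfolding step1 e using assms
    by (simp add: power_int_add field_simps)
next
  case (step2 i)
  have e: "i * (i - 1) div 2 = (i - 1) * (i - 1 - 1) div 2 + (i - 1)"
  proof -
    have "i * (i - 1) = (i - 1) * (i - 1 - 1) + 2 * (i - 1)" by (simp add: algebra_simps)
    then show ?thesis by simp
  qed
  have "theta (x * q powi i) = theta (q * (x * q powi (i - 1)))"
    by (simp add: power_int_diff)
  also have "\<dots> = - theta (x * q powi (i - 1)) / (x * q powi (i - 1))"
    using assms by (subst theta_shift) auto
  finally have "theta (x * q powi (i - 1)) = - (x * q powi (i - 1)) * theta (x * q powi i)"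
    using assms by (simp add: field_simps)
  also have "\<dots> = - (x * q powi (i - 1)) * ((- 1) powi i / (q powi (i * (i - 1) div 2) * x powi i) * theta x)"
    by (simp only: step2)
  also have "\<dots> = (- 1) powi (i - 1) / (q powi ((i - 1) * (i - 1 - 1) div 2) * x powi (i - 1)) * theta x"
    unfolding e using assms
    by (simp add: power_int_add power_int_diff field_simps)
  finally show ?case .
qed

lemma q_powi_eq_iff: "q powi m = q powi n \<longleftrightarrow> m = n"
proof
  assume "q powi m = q powi n"
  then have "norm q powi m = norm q powi n" by (metis norm_power_int)
  then show "m = n" using q_pos q_less_1
    by (metis power_int_strict_decreasing less_irrefl linorder_cases)
qed simp

lemma q_powi_add: "q powi (m + n) = q powi m * q powi n"
  by (simp add: power_int_add)

lemma q_powi_diff: "q powi (m - n) = q powi m / q powi n"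
  by (simp add: power_int_diff)

lemma poc_split_down: "poc (a * q powi (- int N)) = (\<Prod>n=1..N. 1 - a * q powi (- int n)) * poc a"
proof -
  have 1: "(\<Prod>i<N. 1 - a * q powi (- int N) * q ^ i) = (\<Prod>n=1..N. 1 - a * q powi (- int n))"
    by (rule prod.reindex_bij_witness[of _ "\<lambda>i. N - i" "\<lambda>i. N - i"])
       (auto simp: mult.assoc power_int_diff of_nat_diff power_int_minus field_simps
         simp flip: power_int_of_nat)
  have 2: "a * q powi (- int N) * q ^ N = a" by (simp add: power_int_minus)
  show ?thesis using poc_split[of "a * q powi (- int N)" N] unfolding 1 2 .
qed

text \<open>
  The hypothesis excludes a zero denominator in \<open>(a)\<^sub>k\<close> for negative \<open>k\<close>.
\<close>

lemma poc_qpoch: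
  assumes "\<And>n::nat. n \<ge> 1 \<Longrightarrow> a * q powi (- int n) \<noteq> 1"
  shows "poc a = qpoch q a k * poc (a * q powi k)"
proof (cases "k \<ge> 0")
  case True
  then show ?thesis using poc_split[of a "nat k"]
    by (simp add: qpoch_def flip: power_int_of_nat)
next
  case False
  define m where "m = nat (- k)"
  have k: "k = - int m" using False by (simp add: m_def)
  have "(\<Prod>i=1..m. 1 - a * q powi (- int i)) \<noteq> 0"
    using assms by (auto simp: prod_zero_iff)
  then show ?thesis
    using False poc_split_down[of a m] by (simp add: qpoch_def m_def[symmetric] k[symmetric])
qed

lemma poc_mult_q_nz: "poc a \<noteq> 0 \<Longrightarrow> poc (q * a) \<noteq> 0"
  using poc_rec[of a] by auto

lemma poc_zero_right: "a \<noteq> 0 \<Longrightarrow> poc (a * z) = 0 \<longleftrightarrow> (\<exists>n. z = 1 / (a * q ^ n))"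
  by (auto simp: poc_eq_0_iff field_simps)

lemma poc_zero_left: "z \<noteq> 0 \<Longrightarrow> poc (a / z) = 0 \<longleftrightarrow> (\<exists>n. z = a * q ^ n)"
  by (auto simp: poc_eq_0_iff field_simps)

lemma q_power_neq_1: "q ^ Suc n \<noteq> 1"
  using q_powi_eq_iff[of "int (Suc n)" 0] by (simp only: power_int_of_nat) auto

lemma poc_q_nz: "poc q \<noteq> 0"
  using poc_eq_0_iff[of q] q_power_neq_1 by auto

lemma theta_tendsto [tendsto_intros]:
  assumes "(f \<longlongrightarrow> a) F" "a \<noteq> 0"
  shows "((\<lambda>x. theta (f x)) \<longlongrightarrow> theta a) F"
proof -
  have "theta holomorphic_on - {0}" using theta_holo[of "\<lambda>z. z" "- {0}"] by simp
  then have "isCont theta a"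
    using assms(2) continuous_on_eq_continuous_at[of "- {0}" theta] holomorphic_on_imp_continuous_on
    by blast
  then show ?thesis using isCont_tendsto_compose assms(1) by blast
qed

lemma theta_has_deriv:
  assumes "x \<noteq> 0" shows "(theta has_field_derivative deriv theta x) (at x)"
  using theta_holo[of "\<lambda>z. z" "- {0}"] assms by (intro holomorphic_derivI[of _ "- {0}"]) auto

lemma theta_has_deriv_comp [derivative_intros]:
  assumes "(f has_field_derivative f') (at x)" "f x \<noteq> 0"
  shows "((\<lambda>z. theta (f z)) has_field_derivative deriv theta (f x) * f') (at x)"
  using DERIV_chain2[OF theta_has_deriv[OF assms(2)] assms(1)] .

lemma theta_powi_eq_0 [simp]: "theta (q powi n) = 0"
  by (subst theta_eq_0_iff) auto

lemma theta_eq_0_mult: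
  assumes "x \<noteq> 0" "y \<noteq> 0" "theta x = 0" "theta y = 0"
  shows "theta (x * y) = 0" "theta (x / y) = 0"
proof -
  obtain m n where "x = q powi m" "y = q powi n" using assms theta_eq_0_iff by blast
  then have "x * y = q powi (m + n)" "x / y = q powi (m - n)"
    by (simp_all only: q_powi_add q_powi_diff)
  then show "theta (x * y) = 0" "theta (x / y) = 0" by simp_all
qed

lemma theta_1 [simp]: "theta 1 = 0"
  using theta_powi_eq_0[of 0] by simp

lemma theta_sq_shift: "z \<noteq> 0 \<Longrightarrow> theta ((q * z)\<^sup>2) = theta (z\<^sup>2) / (q * z ^ 4)"
  using theta_shift[of "q * z\<^sup>2"] theta_shift[of "z\<^sup>2"]
  by (simp add: power_mult_distrib power2_eq_square power4_eq_xxxx mult_ac)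

definition pocpm where
  "pocpm a z = poc (a * z) * poc (a / z)"

lemma pocpm_holo [holomorphic_intros]:
  "f holomorphic_on S \<Longrightarrow> (\<And>z. z \<in> S \<Longrightarrow> f z \<noteq> 0) \<Longrightarrow> (\<lambda>z. pocpm a (f z)) holomorphic_on S"
  unfolding pocpm_def by (intro holomorphic_intros) auto

lemma theta_pocpm:
  assumes "z \<noteq> 0" "a \<noteq> 0"
  shows "theta (a * z) * theta (a / z) = pocpm a z * pocpm (q / a) z"
  using assms by (simp add: qtheta_def pocpm_def mult_ac)

section \<open>Contours separating two families of points\<close>

text \<open>
  The points \<open>a q\<^sup>n\<close> and \<open>1 / (a q\<^sup>n)\<close> are the zeros of \<open>(a / z)\<^sub>\<infinity>\<close> and \<open>(a z)\<^sub>\<infinity>\<close>. In contrast to the contours of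
  the theorem, all of them are constrained, whether or not some integrand has a pole there.
\<close>

definition separating where
  "separating A g \<longleftrightarrow> valid_path g \<and> pathfinish g = pathstart g \<and>
     0 \<notin> path_image g \<and> winding_number g 0 = 1 \<and>
     (\<forall>a\<in>A. \<forall>n. a * q ^ n \<notin> path_image g \<and> winding_number g (a * q ^ n) = 1 \<and>
        1 / (a * q ^ n) \<notin> path_image g \<and> winding_number g (1 / (a * q ^ n)) = 0)"

lemma separatingD:
  assumes "separating A g"
  shows "valid_path g" "pathfinish g = pathstart g" "0 \<notin> path_image g" "winding_number g 0 = 1"
    "a \<in> A \<Longrightarrow> a * q ^ n \<notin> path_image g" "a \<in> A \<Longrightarrow> winding_number g (a * q ^ n) = 1"
    "a \<in> A \<Longrightarrow> 1 / (a * q ^ n) \<notin> path_image g"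
    "a \<in> A \<Longrightarrow> winding_number g (1 / (a * q ^ n)) = 0"
  using assms by (auto simp: separating_def)

lemma separating_subset:
  assumes g: "separating A g" and B: "\<And>b. b \<in> B \<Longrightarrow> \<exists>a\<in>A. \<exists>k. b = a * q ^ k"
  shows "separating B g"
proof -
  have "b * q ^ n \<notin> path_image g \<and> winding_number g (b * q ^ n) = 1 \<and>
        1 / (b * q ^ n) \<notin> path_image g \<and> winding_number g (1 / (b * q ^ n)) = 0" if bB: "b \<in> B" for b n
  proof -
    obtain a k where "a \<in> A" "b = a * q ^ k" using B[OF bB] by blast
    then have "b * q ^ n = a * q ^ (k + n)" by (simp add: power_add)
    then show ?thesis using g \<open>a \<in> A\<close> unfolding separating_def by metis
  qed
  then show ?thesis using g unfolding separating_def by blast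
qed

lemma finite_large_progression:
  assumes "0 < (e::real)"
  shows "finite {n. norm (a * q ^ n) \<ge> e}"
proof -
  have "(\<lambda>n. norm (a * q ^ n)) \<longlonglongrightarrow> norm (a * 0)"
    by (intro tendsto_intros q_power_to_0)
  then have "\<forall>\<^sub>F n in sequentially. norm (a * q ^ n) < e"
    using assms by (intro order_tendstoD(2)) auto
  then obtain N where "\<And>n. n \<ge> N \<Longrightarrow> norm (a * q ^ n) < e"
    by (auto simp: eventually_sequentially)
  then have "{n. norm (a * q ^ n) \<ge> e} \<subseteq> {..<N}"
    by (force simp: not_less[symmetric])
  then show ?thesis using finite_subset by blast
qed

text \<open>
  The points \<open>a q\<^sup>n\<close> accumulate only at 0 and the points \<open>1 / (a q\<^sup>n)\<close> only at \<open>\<infinity>\<close>, so all but finitely many of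
  them lie inside or outside a circle. The hypothesis says that no point belongs to both families.
\<close>

lemma ex_separating:
  assumes A: "finite A" "0 \<notin> A" and AA: "\<And>a b n. a \<in> A \<Longrightarrow> b \<in> A \<Longrightarrow> a * b \<noteq> q powi n"
  shows "\<exists>g. separating A g"
proof -
  define M where "M = 1 + (\<Sum>a\<in>A. norm a)"
  have M: "norm a < M" if "a \<in> A" for a
    using member_le_sum[of a A norm] that A by (auto simp: M_def)
  have M0: "M \<ge> 1" by (simp add: M_def sum_nonneg)
  \<comment> \<open>Inside radius \<open>1 / M\<close> there are no points \<open>1 / (a q\<^sup>n)\<close>, and outside radius \<open>M\<close> no points
    \<open>a q\<^sup>n\<close>; only the finite set \<open>S\<close> between two such radii needs individual attention.\<close>
  define r' where "r' = 1 / M"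
  define R where "R = M + 1"
  define P where "P = {z. \<exists>a\<in>A. \<exists>n. z = a * q ^ n}"
  define Q where "Q = {z. \<exists>a\<in>A. \<exists>n. z = 1 / (a * q ^ n)}"
  have PM: "norm z < M" if zP: "z \<in> P" for z
  proof -
    obtain a n where z: "a \<in> A" "z = a * q ^ n" using zP by (auto simp: P_def)
    then have "norm z \<le> norm a" using norm_q_power_le_1[of n]
      by (simp add: norm_mult norm_power mult_left_le)
    then show ?thesis using M[OF z(1)] by simp
  qed
  have QM: "z \<noteq> 0 \<and> norm z > r' \<and> 1 / z \<in> P" if "z \<in> Q" for z
  proof -
    from that obtain a n where an: "a \<in> A" "z = 1 / (a * q ^ n)" unfolding Q_def by blast
    then have "1 / z = a * q ^ n" "a \<noteq> 0" using A by auto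
    then have *: "z \<noteq> 0 \<and> 1 / z \<in> P" using an unfolding P_def by auto
    then have "norm (1 / z) < M" using PM by blast
    then show ?thesis using * M0 by (simp add: r'_def norm_divide field_simps)
  qed
  have finP: "finite {z\<in>P. e \<le> norm z}" if "e > 0" for e
  proof -
    have "{z\<in>P. e \<le> norm z} \<subseteq> (\<Union>a\<in>A. (\<lambda>n. a * q ^ n) ` {n. norm (a * q ^ n) \<ge> e})"
      by (auto simp: P_def)
    then show ?thesis
      by (rule finite_subset) (use A finite_large_progression that in auto)
  qed
  define S where "S = {z\<in>P. r' < norm z} \<union> {z\<in>Q. norm z < R}"
  have r'0: "r' > 0" using M0 by (simp add: r'_def)
  have finS: "finite S"
  proof -
    have "finite {z\<in>P. r' < norm z}"
      by (rule finite_subset[OF _ finP[OF r'0]]) auto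
    moreover have "{z\<in>Q. norm z < R} \<subseteq> (\<lambda>z. 1 / z) ` {z\<in>P. 1 / R \<le> norm z}"
    proof
      fix z assume z: "z \<in> {z\<in>Q. norm z < R}"
      then have "1 / z \<in> P" "z \<noteq> 0" using QM by auto
      moreover have "1 / R \<le> norm (1 / z)" using z \<open>z \<noteq> 0\<close> M0
        by (simp add: norm_divide field_simps R_def)
      ultimately show "z \<in> (\<lambda>z. 1 / z) ` {z\<in>P. 1 / R \<le> norm z}"
        by (intro image_eqI[of _ _ "1 / z"]) auto
    qed
    moreover have "finite {z\<in>P. 1 / R \<le> norm z}" using M0 by (intro finP) (simp add: R_def)
    ultimately show ?thesis unfolding S_def using finite_surj by blast
  qed
  have Sr: "r' < norm z \<and> norm z < R" if "z \<in> S" for z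
    using that PM QM by (force simp: S_def R_def)
  have "r' \<le> 1" using M0 by (simp add: r'_def)
  then have r'R: "r' < R" using M0 by (simp add: R_def)
  \<comment> \<open>The initial circle must have all of \<open>S\<close> outside it, so that its winding numbers around \<open>S\<close> are 0.\<close>
  obtain r where r: "r' < r" "r < R" "\<And>z. z \<in> S \<Longrightarrow> r < norm z"
  proof -
    define m where "m = Min (insert R (norm ` S))"
    have "m \<in> insert R (norm ` S)" unfolding m_def using finS by (intro Min_in) auto
    then have "r' < m" using Sr r'R by auto
    then obtain r where r: "r' < r" "r < m" using dense by blast
    have "m \<le> R" "\<And>z. z \<in> S \<Longrightarrow> m \<le> norm z" unfolding m_def using finS by auto
    then show ?thesis using that[of r] r by force
  qed
  have PS: "{z\<in>P. r' < norm z} \<subseteq> S" by (auto simp: S_def)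
  have rS: "r < norm z \<and> norm z < R" if "z \<in> S" for z
    using r(3)[OF that] Sr[OF that] by blast
  from ex_loop_prescribed_winding[OF less_imp_le[OF r'0] r(1,2) finS rS PS]
  obtain g where "valid_path g \<and> pathfinish g = pathstart g \<and>
     path_image g \<subseteq> {z. r' < norm z \<and> norm z < R} - S \<and>
     (\<forall>s\<in>S. winding_number g s = (if s \<in> {z\<in>P. r' < norm z} then 1 else 0)) \<and>
     (\<forall>z. norm z \<le> r' \<longrightarrow> winding_number g z = 1)" ..
  then have g: "valid_path g" "pathfinish g = pathstart g"
     "path_image g \<subseteq> {z. r' < norm z \<and> norm z < R} - S"
     "\<And>s. s \<in> S \<Longrightarrow> winding_number g s = (if s \<in> {z\<in>P. r' < norm z} then 1 else 0)"
     "\<And>z. norm z \<le> r' \<Longrightarrow> winding_number g z = 1"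
    by blast+
  have PQ: "z \<notin> P" if zQ: "z \<in> Q" for z
  proof
    assume "z \<in> P"
    then obtain a n where a: "a \<in> A" "z = a * q ^ n" by (auto simp: P_def)
    obtain b m where b: "b \<in> A" "z = 1 / (b * q ^ m)" using zQ by (auto simp: Q_def)
    have "b \<noteq> 0" using b A by auto
    then have "a * b * q powi (int n + int m) = 1" using a b by (simp add: power_int_add field_simps)
    then have "a * b = q powi (- (int n + int m))" by (simp only: power_int_minus) (simp add: field_simps)
    then show False using AA a(1) b(1) by blast
  qed
  have inP: "a * q ^ n \<notin> path_image g \<and> winding_number g (a * q ^ n) = 1" if "a \<in> A" for a n
  proof -
    have "a * q ^ n \<in> P" using that by (auto simp: P_def)
    then show ?thesis
      using g(3) g(4)[of "a * q ^ n"] g(5)[of "a * q ^ n"] by (cases "r' < norm (a * q ^ n)") (auto simp: S_def)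
  qed
  have inQ: "1 / (a * q ^ n) \<notin> path_image g \<and> winding_number g (1 / (a * q ^ n)) = 0" if "a \<in> A" for a n
  proof -
    let ?z = "1 / (a * q ^ n)"
    have z: "?z \<in> Q" using that by (auto simp: Q_def)
    show ?thesis
    proof (cases "norm ?z < R")
      case True
      then have "?z \<in> S" using z by (simp add: S_def)
      then show ?thesis using g(3) g(4)[of ?z] PQ[OF z] by auto
    next
      case False
      have "winding_number g ?z = 0"
        by (rule winding_number_zero_outside[where s = "ball 0 R"])
           (use g False in \<open>auto simp: valid_path_imp_path\<close>)
      then show ?thesis using False g(3) by auto
    qed
  qed
  have "0 \<notin> path_image g" using g(3) r'0 by auto
  moreover have "winding_number g 0 = 1" using g(5) r'0 by simp
  ultimately have "separating A g" unfolding separating_def using g(1,2) inP inQ by blast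
  then show ?thesis by blast
qed

lemma separating_circle:
  assumes "\<And>a. a \<in> A \<Longrightarrow> a \<noteq> 0 \<and> norm a < 1"
  shows "separating A (circlepath 0 1)"
proof -
  have "z \<notin> path_image (circlepath 0 1) \<and> winding_number (circlepath 0 1) z = 1 \<and>
      1 / z \<notin> path_image (circlepath 0 1) \<and> winding_number (circlepath 0 1) (1 / z) = 0"
    if a: "a \<in> A" and z: "z = a * q ^ n" for a n z
  proof -
    have "norm z \<le> norm a" using norm_q_power_le_1[of n]
      by (simp add: z norm_mult norm_power mult_left_le)
    then have 1: "norm z < 1" "z \<noteq> 0" using assms[OF a] z by auto
    then have 2: "norm (1 / z) > 1" by (simp add: norm_divide)
    have "winding_number (circlepath 0 1) (1 / z) = 0"
      by (rule winding_number_zero_outside[where s = "cball 0 1"]) (use 2 in auto)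
    then show ?thesis using 1 2 by (auto simp: winding_number_circlepath)
  qed
  then show ?thesis
    unfolding separating_def by (simp add: winding_number_circlepath)
qed

text \<open>
  The domain of \<open>1 / ((a z)\<^sub>\<infinity> (a / z)\<^sub>\<infinity>)\<close> for \<open>a \<in> A\<close>.
\<close>

definition regular_at where
  "regular_at A = {z. z \<noteq> 0 \<and> (\<forall>a\<in>A. poc (a * z) \<noteq> 0 \<and> poc (a / z) \<noteq> 0)}"

lemma regular_at_pocpm: "z \<in> regular_at A \<longleftrightarrow> z \<noteq> 0 \<and> (\<forall>a\<in>A. pocpm a z \<noteq> 0)"
  by (auto simp: regular_at_def pocpm_def)

lemma open_poc_nonzero:
  assumes "finite A" "finite B"
  shows "open {z. z \<noteq> 0 \<and> (\<forall>a\<in>A. poc (a * z) \<noteq> 0) \<and> (\<forall>a\<in>B. poc (a / z) \<noteq> 0)}"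
proof -
  have "continuous_on (- {0}) (\<lambda>z. (\<Prod>a\<in>A. poc (a * z)) * (\<Prod>a\<in>B. poc (a / z)))"
    by (intro continuous_intros) auto
  then have "open ((\<lambda>z. (\<Prod>a\<in>A. poc (a * z)) * (\<Prod>a\<in>B. poc (a / z))) -` (- {0}) \<inter> (- {0}))"
    using continuous_on_open_vimage[of "- {0::complex}"] by blast
  also have "((\<lambda>z. (\<Prod>a\<in>A. poc (a * z)) * (\<Prod>a\<in>B. poc (a / z))) -` (- {0}) \<inter> (- {0})) =
     {z. z \<noteq> 0 \<and> (\<forall>a\<in>A. poc (a * z) \<noteq> 0) \<and> (\<forall>a\<in>B. poc (a / z) \<noteq> 0)}"
    using assms by (auto simp: prod_zero_iff)
  finally show ?thesis .
qed

lemma countable_poc_zero: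
  assumes "countable A" "countable B" "0 \<notin> A"
  shows "countable (- {z. z \<noteq> 0 \<and> (\<forall>a\<in>A. poc (a * z) \<noteq> 0) \<and> (\<forall>a\<in>B. poc (a / z) \<noteq> 0)})"
proof -
  have "- {z. z \<noteq> 0 \<and> (\<forall>a\<in>A. poc (a * z) \<noteq> 0) \<and> (\<forall>a\<in>B. poc (a / z) \<noteq> 0)}
     \<subseteq> {0} \<union> (\<Union>a\<in>A. range (\<lambda>n. 1 / (a * q ^ n))) \<union> (\<Union>a\<in>B. range (\<lambda>n. a * q ^ n))"
  proof
    fix z assume z: "z \<in> - {z. z \<noteq> 0 \<and> (\<forall>a\<in>A. poc (a * z) \<noteq> 0) \<and> (\<forall>a\<in>B. poc (a / z) \<noteq> 0)}"
    then consider "z = 0" | a where "a \<in> A" "poc (a * z) = 0" | a where "z \<noteq> 0" "a \<in> B" "poc (a / z) = 0"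
      by blast
    then show "z \<in> {0} \<union> (\<Union>a\<in>A. range (\<lambda>n. 1 / (a * q ^ n))) \<union> (\<Union>a\<in>B. range (\<lambda>n. a * q ^ n))"
    proof cases
      case 2
      then show ?thesis using poc_zero_right[of a z] assms(3) by blast
    next
      case 3
      then show ?thesis using poc_zero_left[of z a] by blast
    qed simp
  qed
  then show ?thesis by (rule countable_subset) (use assms in auto)
qed

lemma connected_poc_nonzero:
  assumes "countable A" "countable B" "0 \<notin> A"
  shows "connected {z. z \<noteq> 0 \<and> (\<forall>a\<in>A. poc (a * z) \<noteq> 0) \<and> (\<forall>a\<in>B. poc (a / z) \<noteq> 0)}"
  using connected_open_diff_countable[OF _ open_UNIV connected_UNIV countable_poc_zero[OF assms]]
  by simp

lemma open_regular_at: "finite A \<Longrightarrow> open (regular_at A)"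
  using open_poc_nonzero[of A A] by (simp add: regular_at_def ball_conj_distrib)

lemma countable_not_regular:
  assumes "countable A" "0 \<notin> A"
  shows "countable (- regular_at A)"
  using countable_poc_zero[OF assms(1,1,2)] by (simp add: regular_at_def ball_conj_distrib)

text \<open>
  The excluded points are the zeros of a holomorphic function on the connected punctured plane, hence isolated.
\<close>

lemma eventually_regular_at:
  assumes A: "finite A" "0 \<notin> A" and z: "z \<noteq> 0"
  shows "\<forall>\<^sub>F w in at z. w \<in> regular_at A"
proof -
  define h where "h w = (\<Prod>a\<in>A. pocpm a w)" for w
  have hol: "h holomorphic_on - {0}" unfolding h_def by (intro holomorphic_intros) auto
  have reg: "w \<in> regular_at A \<longleftrightarrow> w \<noteq> 0 \<and> h w \<noteq> 0" for w
    using A by (auto simp: regular_at_pocpm h_def)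
  have "\<exists>d>0. \<forall>w\<in>ball z d - {z}. h w \<noteq> 0"
  proof (cases "h z = 0")
    case True
    have "regular_at A \<noteq> {}"
    proof
      assume "regular_at A = {}"
      then have "countable (UNIV :: complex set)"
        using countable_not_regular[of A] A by (simp add: countable_finite)
      then show False using uncountable_UNIV_complex by simp
    qed
    then obtain w where w: "w \<in> - {0}" "h w \<noteq> 0" using reg by blast
    have c: "connected (- {0 :: complex})" by (rule connected_punctured_universe) simp
    have o: "open (- {0 :: complex})" and z': "z \<in> - {0}" using z by auto
    obtain r where "0 < r" "ball z r \<subseteq> - {0}" "\<And>w. w \<in> ball z r - {z} \<Longrightarrow> h w \<noteq> 0"
      by (rule isolated_zeros[OF hol o c z' True w]) blast
    then show ?thesis by blast
  next
    case False
    have "continuous_on (- {0}) h" using hol by (rule holomorphic_on_imp_continuous_on)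
    then have "isCont h z" using z by (simp add: continuous_on_eq_continuous_at open_Compl)
    then obtain d where "d > 0" "\<And>w. dist w z < d \<Longrightarrow> dist (h w) (h z) < norm (h z)"
      using False unfolding continuous_at_eps_delta by (metis zero_less_norm_iff)
    then have "h w \<noteq> 0" if "dist w z < d" for w using that by (metis dist_0_norm less_irrefl)
    then show ?thesis using \<open>d > 0\<close> by (intro exI[of _ d]) (auto simp: dist_commute)
  qed
  then obtain d where d: "d > 0" "\<And>w. w \<in> ball z d - {z} \<Longrightarrow> h w \<noteq> 0" by blast
  have "\<forall>\<^sub>F w in at z. w \<in> ball z d - {z}" using d by (intro eventually_at_in_open) auto
  moreover have "\<forall>\<^sub>F w in at z. w \<in> - {0}" using z by (intro eventually_at_in_open') auto
  ultimately show ?thesis by eventually_elim (use d reg in auto)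
qed

lemma separating_regular:
  assumes "separating A g" "0 \<notin> A"
  shows "path_image g \<subseteq> regular_at A"
proof
  fix z assume z: "z \<in> path_image g"
  then have "z \<noteq> 0" using assms by (auto simp: separating_def)
  moreover have "poc (a * z) \<noteq> 0 \<and> poc (a / z) \<noteq> 0" if "a \<in> A" for a
  proof -
    have "a \<noteq> 0" using that assms by auto
    then show ?thesis
      using poc_zero_right[of a z] poc_zero_left[of z a] \<open>z \<noteq> 0\<close> z assms(1) that
      unfolding separating_def by blast
  qed
  ultimately show "z \<in> regular_at A" by (simp add: regular_at_def)
qed

lemma separating_path_props:
  assumes "separating A g" "0 \<notin> A"
  shows "valid_path g" "path_image g \<subseteq> regular_at A"
  using assms separating_regular by (auto simp: separating_def)

lemma separating_integrable:
  assumes "separating A g" "0 \<notin> A" "finite A" "f holomorphic_on regular_at A"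
  shows "f contour_integrable_on g"
  using contour_integrable_holomorphic_simple[OF assms(4) open_regular_at[OF assms(3)]]
    separating_path_props[OF assms(1,2)] by blast

text \<open>
  The definition prescribes the winding numbers around all points outside \<open>regular_at A\<close>.
\<close>

lemma separating_integral_eq:
  assumes A: "finite A" "0 \<notin> A" and f: "f holomorphic_on regular_at A"
    and g: "separating A g" "separating A h"
  shows "contour_integral g f = contour_integral h f"
proof (rule contour_integral_homologous[OF _ _ f])
  have e: "regular_at A = {z. z \<noteq> 0 \<and> (\<forall>a\<in>A. poc (a * z) \<noteq> 0) \<and> (\<forall>a\<in>A. poc (a / z) \<noteq> 0)}"
    by (auto simp: regular_at_def)
  show "open (regular_at A)" unfolding e using A by (intro open_poc_nonzero)
  show "connected (regular_at A)" unfolding e using A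
    by (intro connected_poc_nonzero) (auto intro: countable_finite)
  show "winding_number g z = winding_number h z" if z: "z \<notin> regular_at A" for z
  proof (cases "z = 0")
    case False
    then obtain a where "a \<in> A" "poc (a * z) = 0 \<or> poc (a / z) = 0"
      using z by (auto simp: regular_at_def)
    then show ?thesis using g poc_zero_right[of a z] poc_zero_left[of z a] False A
      unfolding separating_def by (metis (no_types, lifting))
  qed (use g in \<open>auto simp: separating_def\<close>)
qed (use g separating_regular A in \<open>auto simp: separating_def\<close>)

text \<open>
  The substitution \<open>z \<mapsto> q z\<close> turns the left side into an integral along \<open>q g\<close>. Moving \<open>q g\<close> back to \<open>g\<close> is
  allowed since \<open>F\<close> has no poles at the points \<open>a\<close> themselves, only at \<open>a q, a q\<^sup>2, \<dots>\<close>.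
\<close>

lemma separating_shift_integral:
  assumes A: "finite A" "0 \<notin> A" and g: "separating A g"
    and F: "F holomorphic_on {z. z \<noteq> 0 \<and> (\<forall>a\<in>A. poc (a * z) \<noteq> 0 \<and> poc (q * a / z) \<noteq> 0)}"
  shows "contour_integral g (\<lambda>z. F (q * z) / z) = contour_integral g (\<lambda>z. F z / z)"
proof -
  define D where "D = {z. z \<noteq> 0 \<and> (\<forall>a\<in>A. poc (a * z) \<noteq> 0 \<and> poc (q * a / z) \<noteq> 0)}"
  have e: "D = {z. z \<noteq> 0 \<and> (\<forall>a\<in>A. poc (a * z) \<noteq> 0) \<and> (\<forall>a\<in>(*) q ` A. poc (a / z) \<noteq> 0)}"
    by (auto simp: D_def)
  note gv = separatingD(1-4)[OF g] and gA = separatingD(5-8)[OF g]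
  have an: "(*) q analytic_on UNIV" by (intro analytic_intros)
  define h where "h = (*) q \<circ> g"
  have hv: "valid_path h" unfolding h_def
    using valid_path_compose_analytic[OF gv(1) an] by simp
  have reg: "path_image g \<subseteq> regular_at A" using separating_regular[OF g A(2)] .
  have "contour_integral h (\<lambda>z. F z / z) = contour_integral g (\<lambda>z. deriv ((*) q) z * (F (q * z) / (q * z)))"
    unfolding h_def using contour_integral_comp_analyticW[OF an gv(1)] by simp
  also have "\<dots> = contour_integral g (\<lambda>z. F (q * z) / z)" by simp
  finally have 1: "contour_integral h (\<lambda>z. F z / z) = contour_integral g (\<lambda>z. F (q * z) / z)" .
  have "contour_integral h (\<lambda>z. F z / z) = contour_integral g (\<lambda>z. F z / z)"
  proof (rule contour_integral_homologous)
    show "open D" unfolding e using A by (intro open_poc_nonzero) auto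
    show "connected D" unfolding e using A
      by (intro connected_poc_nonzero) (auto intro: countable_finite)
    show "(\<lambda>z. F z / z) holomorphic_on D"
      using F unfolding D_def[symmetric] by (intro holomorphic_intros) (auto simp: D_def)
    show "pathfinish h = pathstart h" using gv by (simp add: h_def pathfinish_compose pathstart_compose)
    show "path_image g \<subseteq> D"
    proof
      fix z assume "z \<in> path_image g"
      then have "z \<in> regular_at A" using reg by auto
      then show "z \<in> D" unfolding D_def regular_at_def
        using poc_mult_q_nz[of "a / z" for a] by auto
    qed
    show "path_image h \<subseteq> D"
    proof
      fix w assume "w \<in> path_image h"
      then obtain z where z: "w = q * z" "z \<in> path_image g"
        by (auto simp: h_def path_image_compose)
      then have "z \<in> regular_at A" using reg by auto
      then show "w \<in> D" unfolding D_def regular_at_def z(1)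
        using poc_mult_q_nz[of "a * z" for a] by (auto simp: mult_ac)
    qed
    show "winding_number h w = winding_number g w" if w: "w \<notin> D" for w
    proof -
      \<comment> \<open>The curves \<open>g\<close> and \<open>q g\<close> wind alike around the singularities of \<open>F\<close>: shrinking \<open>g\<close> by \<open>q\<close>
        could only cross the points \<open>a\<close>, which are not among them.\<close>
      consider "w = 0" | a where "a \<in> A" "poc (a * w) = 0" | a where "w \<noteq> 0" "a \<in> A" "poc (q * a / w) = 0"
        using w unfolding D_def by blast
      then consider "w = 0" | a n where "a \<in> A" "w = 1 / (a * q ^ n)" | a n where "a \<in> A" "w = q * (a * q ^ n)"
      proof cases
        case 2
        then show ?thesis using poc_zero_right[of a w] A that(2)[of a] by blast
      next
        case 3
        then obtain n where "w = q * a * q ^ n" using poc_zero_left[of w "q * a"] by blast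
        then show ?thesis using that(3)[of a n] 3 by (simp add: mult.assoc)
      qed (use that in blast)
      then show ?thesis
      proof cases
        case 1
        then show ?thesis using winding_number_scale[OF gv(1,3) q_nz] unfolding h_def by simp
      next
        case 2
        have "w = q * (1 / (a * q ^ Suc n))" using 2 A by (auto simp: field_simps)
        then have "winding_number h w = winding_number g (1 / (a * q ^ Suc n))"
          unfolding h_def using winding_number_scale[OF gv(1) gA(3)[OF 2(1), of "Suc n"] q_nz] by simp
        then show ?thesis using gA(4)[OF 2(1)] 2 by metis
      next
        case 3
        then have "winding_number h w = winding_number g (a * q ^ n)"
          unfolding h_def using winding_number_scale[OF gv(1) gA(1)[OF 3(1), of n] q_nz] by simp
        moreover have "w = a * q ^ Suc n" using 3 by simp
        ultimately show ?thesis using gA(2)[OF 3(1)] by metis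
      qed
    qed
  qed (use gv hv in auto)
  with 1 show ?thesis by simp
qed

text \<open>
  Inversion exchanges the two families of points and also the inside with the outside; reversing the
  orientation corrects the latter.
\<close>

lemma separating_reverse_inverse:
  assumes A: "0 \<notin> A" and g: "separating A g"
  shows "separating A (reversepath (inverse \<circ> g))"
proof -
  note gv = separatingD(1-4)[OF g] and gA = separatingD(5-8)[OF g]
  define h where "h = inverse \<circ> g"
  have hv: "valid_path h" "winding_number h 0 = -1"
    using contour_integral_inverse(1)[OF gv(1,3)] winding_number_inverse(1)[OF gv(1,3)] gv
    by (auto simp: h_def)
  have h0: "0 \<notin> path_image h" using gv by (auto simp: h_def path_image_compose)
  have him: "1 / z \<notin> path_image h" if "z \<notin> path_image g" "z \<noteq> 0" for z
  proof
    assume "1 / z \<in> path_image h"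
    then obtain w where "w \<in> path_image g" "1 / z = inverse w" by (auto simp: h_def path_image_compose)
    then have "w = z" using that by (metis inverse_eq_divide inverse_inverse_eq)
    then show False using that \<open>w \<in> _\<close> by simp
  qed
  have hw: "winding_number h (1 / z) = winding_number g z - 1" if "z \<notin> path_image g" "z \<noteq> 0" for z
    unfolding h_def using winding_number_inverse(2)[OF gv(1,3) that(2,1)] gv by simp
  have "pathfinish h = pathstart h" using gv by (simp add: h_def pathfinish_compose pathstart_compose)
  moreover have "a * q ^ n \<notin> path_image h \<and> winding_number h (a * q ^ n) = - 1 \<and>
        1 / (a * q ^ n) \<notin> path_image h \<and> winding_number h (1 / (a * q ^ n)) = 0" if "a \<in> A" for a n
    using gA[OF that, of n] him[of "a * q ^ n"] him[of "1 / (a * q ^ n)"]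
       hw[of "a * q ^ n"] hw[of "1 / (a * q ^ n)"] A that by auto
  ultimately show ?thesis unfolding separating_def h_def[symmetric]
    using hv h0 by (simp add: winding_number_reversepath valid_path_imp_path valid_path_imp_reverse)
qed

text \<open>
  Both the integrand and, up to homology, the contour are reflected to their negatives by \<open>z \<mapsto> 1/z\<close>.
\<close>

lemma separating_antisymmetric_integral:
  assumes A: "finite A" "0 \<notin> A" and g: "separating A g"
    and f: "f holomorphic_on regular_at A"
    and anti: "\<And>z. z \<in> regular_at A \<Longrightarrow> f (1 / z) = - f z"
  shows "contour_integral g (\<lambda>z. f z / z) = 0"
proof -
  note ci = contour_integral_inverse[OF separatingD(1,3)[OF g]]
  have "contour_integral g (\<lambda>z. f z / z) = contour_integral (reversepath (inverse \<circ> g)) (\<lambda>z. f z / z)"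
  proof (rule separating_integral_eq[OF A])
    show "(\<lambda>z. f z / z) holomorphic_on regular_at A"
      using f by (intro holomorphic_intros) (auto simp: regular_at_def)
  qed (use g A separating_reverse_inverse in auto)
  also have "\<dots> = - contour_integral (inverse \<circ> g) (\<lambda>z. f z / z)"
    by (rule contour_integral_reversepath[OF ci(1)])
  also have "contour_integral (inverse \<circ> g) (\<lambda>z. f z / z) = contour_integral g (\<lambda>z. f z / z)"
    unfolding ci(2)
  proof (rule contour_integral_cong[OF refl])
    fix w assume w: "w \<in> path_image g"
    then have w0: "w \<noteq> 0" using separatingD(3)[OF g] by auto
    have "f (1 / w) = - f w"
      using anti[of w] w separating_regular[OF g A(2)] by auto
    then show "- 1 / w\<^sup>2 * (f (1 / w) / (1 / w)) = f w / w"
      using w0 by (simp add: power2_eq_square)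
  qed
  finally show ?thesis by simp
qed

section \<open>Antisymmetric theta functions\<close>

lemma fundamental_annulus:
  assumes "z \<noteq> 0"
  shows "\<exists>n. norm q \<le> norm (z * q powi n) \<and> norm (z * q powi n) \<le> 1"
proof -
  define L where "L = ln (norm q)"
  have L: "L < 0" using q_pos q_less_1 by (simp add: L_def)
  define n where "n = - \<lfloor>ln (norm z) / L\<rfloor>"
  define t where "t = ln (norm z) / L + of_int n"
  have t: "0 \<le> t" "t \<le> 1" unfolding t_def n_def by linarith+
  have "norm q powi n = norm q powr of_int n" using q_pos by (simp add: powr_real_of_int')
  also have "\<dots> = exp (of_int n * L)" using q_pos by (simp add: powr_def L_def)
  finally have "norm (z * q powi n) = exp (ln (norm z) + of_int n * L)"
    using assms by (simp add: norm_mult norm_power_int exp_add)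
  also have "ln (norm z) + of_int n * L = t * L" using L by (simp add: t_def distrib_right)
  finally have e: "norm (z * q powi n) = exp (t * L)" .
  have "L \<le> t * L" using mult_right_mono_neg[OF t(2), of L] L by simp
  moreover have "t * L \<le> 0" using L t by (simp add: mult_nonneg_nonpos)
  ultimately have "exp L \<le> exp (t * L)" "exp (t * L) \<le> 1" by auto
  then show ?thesis using e q_pos by (intro exI[of _ n]) (simp add: L_def)
qed

text \<open>
  The multiplicative form of the theorem that an elliptic function without poles is constant, stated for a
  quotient so that only simple zeros of the denominator have to be inspected.
\<close>

lemma elliptic_ratio_constant:
  assumes N: "N holomorphic_on - {0}" and D: "D holomorphic_on - {0}"
    and m: "\<And>z. z \<noteq> 0 \<Longrightarrow> N (q * z) = m z * N z" "\<And>z. z \<noteq> 0 \<Longrightarrow> D (q * z) = m z * D z"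
      "\<And>z. z \<noteq> 0 \<Longrightarrow> m z \<noteq> 0"
    and zeros: "\<And>z. z \<noteq> 0 \<Longrightarrow> D z = 0 \<Longrightarrow> N z = 0 \<and> deriv D z \<noteq> 0"
  shows "\<exists>c. \<forall>z. z \<noteq> 0 \<longrightarrow> N z = c * D z"
proof -
  define g where "g z = N z / D z" for z
  have an: "N analytic_on - {0}" "D analytic_on - {0}"
    using N D analytic_on_open[of "- {0::complex}"] by auto
  have lim: "\<exists>c. g \<midarrow>z\<rightarrow> c" if z: "z \<noteq> 0" for z
  proof (cases "D z = 0")
    case True
    have "(N has_field_derivative deriv N z) (at z)" "(D has_field_derivative deriv D z) (at z)"
      using N D z by (auto intro!: holomorphic_derivI[of _ "- {0}"])
    then have "g \<midarrow>z\<rightarrow> deriv N z / deriv D z"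
      unfolding g_def using zeros[OF z True] True by (intro lhopital_complex_simple) auto
    then show ?thesis ..
  next
    case False
    have "isCont N z" "isCont D z"
      using an z by (auto intro!: analytic_at_imp_isCont intro: analytic_on_subset)
    then have "isCont g z" unfolding g_def using False by (intro continuous_intros)
    then show ?thesis by (auto simp: isCont_def)
  qed
  have "g meromorphic_on - {0}" unfolding g_def
    by (intro meromorphic_intros analytic_on_imp_meromorphic_on an)
  then have iso: "isolated_singularity_at g z" if "z \<noteq> 0" for z
    using that by (auto intro: meromorphic_on_isolated_singularity meromorphic_on_subset)
  \<comment> \<open>The quotient extends holomorphically over the zeros of \<open>D\<close>, and it is invariant under \<open>z \<mapsto> q z\<close>.\<close>
  define G where "G = remove_sings g"
  have "G analytic_on {z}" if "z \<noteq> 0" for z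
    unfolding G_def using lim[OF that] iso[OF that] remove_sings_analytic_at by blast
  then have G: "G analytic_on - {0}" by (subst analytic_on_analytic_at) auto
  have per: "G (q * z) = G z" if z: "z \<noteq> 0" for z
  proof -
    obtain c where c: "g \<midarrow>q * z\<rightarrow> c" using lim[of "q * z"] z by auto
    have "filterlim (\<lambda>w. q * w) (at (q * z)) (at z)"
      by (rule filterlim_atI) (auto intro!: tendsto_eq_intros simp: eventually_at_filter)
    then have "(\<lambda>w. g (q * w)) \<midarrow>z\<rightarrow> c" using c filterlim_compose by blast
    moreover have "\<forall>\<^sub>F w in at z. g (q * w) = g w"
    proof -
      have "\<forall>\<^sub>F w in at z. w \<in> - {0}" using z by (intro eventually_at_in_open') auto
      then show ?thesis by eventually_elim (use m in \<open>auto simp: g_def\<close>)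
    qed
    ultimately have "g \<midarrow>z\<rightarrow> c" by (rule Lim_transform_eventually)
    then show ?thesis using c unfolding G_def by (metis remove_sings_eqI)
  qed
  have per': "G (z * q powi n) = G z" if z: "z \<noteq> 0" for z n
  proof (induction n rule: int_induct[where k = 0])
    case (step1 i)
    then show ?case using per[of "z * q powi i"] z by (simp add: power_int_add mult_ac)
  next
    case (step2 i)
    have "q * (z * q powi (i - 1)) = z * q powi i" by (simp add: power_int_diff)
    moreover have "z * q powi (i - 1) \<noteq> 0" using z by simp
    ultimately show ?case using step2(2) per[of "z * q powi (i - 1)"] by metis
  qed simp
  have "compact {z::complex. norm q \<le> norm z \<and> norm z \<le> 1}"
  proof -
    have e: "{z::complex. norm q \<le> norm z \<and> norm z \<le> 1} = cball 0 1 - ball 0 (norm q)" by auto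
    show ?thesis unfolding e by (rule compact_diff[OF compact_cball open_ball])
  qed
  moreover have "continuous_on {z. norm q \<le> norm z \<and> norm z \<le> 1} G"
    using q_pos by (intro analytic_imp_holomorphic holomorphic_on_imp_continuous_on
        analytic_on_subset[OF G]) auto
  ultimately have "compact (G ` {z. norm q \<le> norm z \<and> norm z \<le> 1})"
    by (rule compact_continuous_image[rotated])
  then have bd: "bounded (G ` {z. norm q \<le> norm z \<and> norm z \<le> 1})" by (rule compact_imp_bounded)
  \<comment> \<open>By invariance all values are taken on one compact annulus; then apply Liouville in the coordinate \<open>w = ln z\<close>.\<close>
  have "range (\<lambda>w. G (exp w)) \<subseteq> G ` {z. norm q \<le> norm z \<and> norm z \<le> 1}"
  proof
    fix y assume "y \<in> range (\<lambda>w. G (exp w))"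
    then obtain w where y: "y = G (exp w)" by auto
    obtain n where "norm q \<le> norm (exp w * q powi n)" "norm (exp w * q powi n) \<le> 1"
      using fundamental_annulus[of "exp w"] by auto
    moreover have "y = G (exp w * q powi n)" using y per'[of "exp w" n] by simp
    ultimately show "y \<in> G ` {z. norm q \<le> norm z \<and> norm z \<le> 1}" by blast
  qed
  then have "bounded (range (\<lambda>w. G (exp w)))" using bd bounded_subset by blast
  moreover have "(\<lambda>w. G (exp w)) holomorphic_on UNIV"
  proof -
    have "exp holomorphic_on (UNIV :: complex set)" by (intro holomorphic_intros)
    moreover have "exp ` UNIV \<subseteq> - {0 :: complex}" by (metis ComplI exp_not_eq_zero image_subsetI singletonD)
    ultimately have "(G \<circ> exp) holomorphic_on UNIV"
      using analytic_imp_holomorphic[OF G] holomorphic_on_compose_gen by blast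
    then show ?thesis by (simp add: o_def)
  qed
  ultimately have "(\<lambda>w. G (exp w)) constant_on UNIV" by (rule Liouville_theorem[rotated])
  then obtain c where c: "\<And>w. G (exp w) = c" by (auto simp: constant_on_def)
  have "N z = c * D z" if z: "z \<noteq> 0" for z
  proof (cases "D z = 0")
    case True
    then show ?thesis using zeros[OF z] by simp
  next
    case False
    have "g analytic_on {z}" unfolding g_def using an z False
      by (auto intro!: analytic_intros intro: analytic_on_subset)
    then have "g z = G z" unfolding G_def by simp
    also have "\<dots> = c" using c[of "ln z"] z by simp
    finally show ?thesis using False by (simp add: g_def field_simps)
  qed
  then show ?thesis by blast
qed

text \<open>
  Theta functions with the quasi-periodicity of \<open>\<theta>(\<lambda>\<^sub>1z)\<cdots>\<theta>(\<lambda>\<^sub>6z)\<close>, \<open>\<lambda>\<^sub>1\<cdots>\<lambda>\<^sub>6 = q\<close>, that become antisymmetric under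
  \<open>z \<mapsto> 1/z\<close> after division by \<open>z\<^sup>2\<close>.
\<close>

definition antisym_theta where
  "antisym_theta \<Phi> \<longleftrightarrow> \<Phi> holomorphic_on - {0} \<and>
     (\<forall>z. z \<noteq> 0 \<longrightarrow> \<Phi> (q * z) = 1 / (q * z ^ 6) * \<Phi> z \<and> \<Phi> (1 / z) = - \<Phi> z / z ^ 4)"

text \<open>
  The standard members of this space, one for each \<open>a\<close>.
\<close>

definition chi where
  "chi a z = z * theta (z\<^sup>2) * (theta (a * z) * theta (a / z))"

lemma antisym_theta_chi:
  assumes "a \<noteq> 0"
  shows "antisym_theta (chi a)"
  unfolding antisym_theta_def
proof (intro conjI allI impI)
  show "chi a holomorphic_on - {0}"
    unfolding chi_def using assms by (intro holomorphic_intros) auto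
  fix z :: complex assume z: "z \<noteq> 0"
  have 1: "theta (a * (q * z)) = - theta (a * z) / (a * z)"
    using theta_shift[of "a * z"] assms z by (simp add: mult_ac)
  have 2: "theta (a / (q * z)) = - (a / z / q) * theta (a / z)"
    using theta_shift_down[of "a / z"] assms z by (simp add: mult_ac)
  show "chi a (q * z) = 1 / (q * z ^ 6) * chi a z"
    unfolding chi_def theta_sq_shift[OF z] 1 2 using assms z
    by (simp add: divide_simps) (simp add: power_numeral_reduce)
  have 3: "theta ((1 / z)\<^sup>2) = - theta (z\<^sup>2) / z\<^sup>2"
    using theta_inverse[of "z\<^sup>2"] z by (simp add: power_divide)
  show "chi a (1 / z) = - chi a z / z ^ 4"
    unfolding chi_def 3 using z by (simp add: divide_simps) (simp add: power_numeral_reduce)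
qed

lemma antisym_theta_diff:
  "antisym_theta f \<Longrightarrow> antisym_theta g \<Longrightarrow> antisym_theta (\<lambda>z. f z - c * g z)"
  unfolding antisym_theta_def
  by (auto intro!: holomorphic_intros simp: algebra_simps diff_divide_distrib)

text \<open>
  Each factor has simple zeros, and two factors cannot vanish together, since then \<open>u\<^sup>2\<close> would be a power
  of \<open>q\<close>.
\<close>

lemma chi_simple_zero:
  assumes u: "u \<noteq> 0" "\<And>n. u\<^sup>2 \<noteq> q powi n" and z: "z \<noteq> 0" "chi u z = 0"
  shows "deriv (chi u) z \<noteq> 0"
proof -
  define d1 where "d1 = theta (z\<^sup>2) + z * (deriv theta (z\<^sup>2) * (2 * z))"
  define d2 where "d2 = deriv theta (u * z) * u"
  define d3 where "d3 = deriv theta (u / z) * (- u / z\<^sup>2)"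
  have e1: "((\<lambda>z. z * theta (z\<^sup>2)) has_field_derivative d1) (at z)"
    unfolding d1_def using z(1) by (auto intro!: derivative_eq_intros)
  have e2: "((\<lambda>z. theta (u * z)) has_field_derivative d2) (at z)"
    unfolding d2_def using z(1) u by (auto intro!: derivative_eq_intros)
  have e3: "((\<lambda>z. theta (u / z)) has_field_derivative d3) (at z)"
    unfolding d3_def using z(1) u by (auto intro!: derivative_eq_intros simp: power2_eq_square)
  have "(chi u has_field_derivative
          (d1 * (theta (u * z) * theta (u / z)) + (d2 * theta (u / z) + d3 * theta (u * z)) * (z * theta (z\<^sup>2)))) (at z)"
    unfolding chi_def by (rule DERIV_mult[OF e1 DERIV_mult[OF e2 e3]])
  then have d: "deriv (chi u) z = d1 * (theta (u * z) * theta (u / z)) +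
                 (d2 * theta (u / z) + d3 * theta (u * z)) * (z * theta (z\<^sup>2))"
    by (rule DERIV_imp_deriv)
  have u2: "theta (u\<^sup>2) \<noteq> 0" using theta_eq_0_iff[of "u\<^sup>2"] u by auto
  have sq: "u\<^sup>2 = (u * z) * (u * z) / z\<^sup>2" "u\<^sup>2 = (u / z) * (u / z) * z\<^sup>2" "u\<^sup>2 = (u * z) * (u / z)"
    using z by (simp_all add: power2_eq_square)
  have 12: "\<not> (theta (z\<^sup>2) = 0 \<and> theta (u * z) = 0)"
    and 13: "\<not> (theta (z\<^sup>2) = 0 \<and> theta (u / z) = 0)"
    and 23: "\<not> (theta (u * z) = 0 \<and> theta (u / z) = 0)"
    using u2 theta_eq_0_mult(2)[of "(u * z) * (u * z)" "z\<^sup>2"] theta_eq_0_mult(1)[of "u * z" "u * z"]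
      theta_eq_0_mult(1)[of "(u / z) * (u / z)" "z\<^sup>2"] theta_eq_0_mult(1)[of "u / z" "u / z"]
      theta_eq_0_mult(1)[of "u * z" "u / z"] u(1) z(1)
    unfolding sq[symmetric] by auto
  consider "theta (z\<^sup>2) = 0" | "theta (u * z) = 0" | "theta (u / z) = 0"
    using z by (auto simp: chi_def)
  then show ?thesis
  proof cases
    case 1
    then have "d1 \<noteq> 0" using theta_simple_zero[of "z\<^sup>2"] z by (simp add: d1_def)
    then show ?thesis using 1 12 13 d by auto
  next
    case 2
    then have "d2 \<noteq> 0" using theta_simple_zero[of "u * z"] z u by (simp add: d2_def)
    then show ?thesis using 2 12 23 d z by auto
  next
    case 3
    then have "d3 \<noteq> 0" using theta_simple_zero[of "u / z"] z u by (simp add: d3_def)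
    then show ?thesis using 3 13 23 d z by auto
  qed
qed

lemma chi_self [simp]: "v \<noteq> 0 \<Longrightarrow> chi v v = 0"
  by (simp add: chi_def)

lemma chi_nonzero:
  assumes "u \<noteq> 0" "v \<noteq> 0" "\<And>n. v\<^sup>2 \<noteq> q powi n" "\<And>n. u * v \<noteq> q powi n" "\<And>n. u / v \<noteq> q powi n"
  shows "chi u v \<noteq> 0"
  using assms theta_eq_0_iff[of "v\<^sup>2"] theta_eq_0_iff[of "u * v"] theta_eq_0_iff[of "u / v"]
  by (auto simp: chi_def)

text \<open>
  \<open>chi u\<close> has only simple zeros and \<open>\<Phi>\<close> vanishes at all of them: at the zeros of \<open>\<theta>(z\<^sup>2)\<close> because it is
  antisymmetric, and at the points \<open>u\<^sup>\<plusminus>\<^sup>1 q\<^sup>n\<close> because it vanishes at \<open>u\<close>.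
\<close>

lemma antisym_theta_vanishing:
  assumes \<Phi>: "antisym_theta \<Phi>" and u: "u \<noteq> 0" "\<And>n. u\<^sup>2 \<noteq> q powi n" and \<Phi>u: "\<Phi> u = 0"
  shows "\<exists>c. \<forall>z. z \<noteq> 0 \<longrightarrow> \<Phi> z = c * chi u z"
proof (rule elliptic_ratio_constant[where m = "\<lambda>z. 1 / (q * z ^ 6)"])
  have sh: "\<Phi> (q * z) = 1 / (q * z ^ 6) * \<Phi> z" "\<Phi> (1 / z) = - \<Phi> z / z ^ 4" if "z \<noteq> 0" for z
    using \<Phi> that by (auto simp: antisym_theta_def)
  have inv: "\<Phi> (1 / z) = 0 \<longleftrightarrow> \<Phi> z = 0" if "z \<noteq> 0" for z
    using sh(2)[OF that] that by simp
  have qz: "\<Phi> (q * z) = 0 \<longleftrightarrow> \<Phi> z = 0" if "z \<noteq> 0" for z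
    using sh(1)[OF that] that by simp
  have pw: "\<Phi> (z * q powi n) = 0 \<longleftrightarrow> \<Phi> z = 0" if "z \<noteq> 0" for z n
  proof (induction n rule: int_induct[where k = 0])
    case (step1 i)
    then show ?case using qz[of "z * q powi i"] that by (simp add: power_int_add mult_ac)
  next
    case (step2 i)
    have "q * (z * q powi (i - 1)) = z * q powi i" by (simp add: power_int_diff)
    moreover have "z * q powi (i - 1) \<noteq> 0" using that by simp
    ultimately show ?case using step2(2) qz[of "z * q powi (i - 1)"] by metis
  qed simp
  show "\<Phi> holomorphic_on - {0}" using \<Phi> by (simp add: antisym_theta_def)
  have c: "antisym_theta (chi u)" using antisym_theta_chi[OF u(1)] .
  show "chi u holomorphic_on - {0}" using c by (simp add: antisym_theta_def)
  show "\<Phi> (q * z) = 1 / (q * z ^ 6) * \<Phi> z" if "z \<noteq> 0" for z using sh(1)[OF that] .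
  show "chi u (q * z) = 1 / (q * z ^ 6) * chi u z" if "z \<noteq> 0" for z
    using c that by (simp add: antisym_theta_def)
  show "1 / (q * z ^ 6) \<noteq> 0" if "z \<noteq> 0" for z using that by simp
  show "\<Phi> z = 0 \<and> deriv (chi u) z \<noteq> 0" if z: "z \<noteq> 0" "chi u z = 0" for z
  proof
    show "deriv (chi u) z \<noteq> 0" using chi_simple_zero[OF u z] .
    consider "theta (z\<^sup>2) = 0" | "theta (u * z) = 0" | "theta (u / z) = 0"
      using z by (auto simp: chi_def)
    then show "\<Phi> z = 0"
    proof cases
      case 1
      then obtain n where n: "z\<^sup>2 = q powi n" using theta_eq_0_iff[of "z\<^sup>2"] z by auto
      \<comment> \<open>Modulo powers of \<open>q\<close> the zeros of \<open>\<theta>(z\<^sup>2)\<close> are the points with \<open>z\<^sup>2 = 1\<close> or \<open>z\<^sup>2 = q\<close>.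
        There \<open>1 / z\<close> equals \<open>z\<close> or \<open>z / q\<close>, and the antisymmetry gives \<open>\<Phi> z = - \<Phi> z\<close>.\<close>
      define k where "k = n div 2"
      define w where "w = z * q powi (- k)"
      have w0: "w \<noteq> 0" using z by (simp add: w_def)
      have "w\<^sup>2 = q powi n * (q powi (- k) * q powi (- k))"
        unfolding w_def power_mult_distrib n by (simp add: power2_eq_square)
      also have "\<dots> = q powi (n mod 2)"
        by (simp add: k_def minus_mult_div_eq_mod flip: power_int_add)
      finally have "w\<^sup>2 = q powi (n mod 2)" .
      moreover have "n mod 2 = 0 \<or> n mod 2 = 1" by presburger
      ultimately consider "w\<^sup>2 = 1" | "w\<^sup>2 = q" by auto
      then have "\<Phi> w = - \<Phi> w"
      proof cases
        case 1
        then have "w = 1 / w" "w ^ 4 = 1" using w0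
          by (simp_all add: field_simps power2_eq_square power4_eq_xxxx)
        then show ?thesis using sh(2)[OF w0] by simp
      next
        case 2
        then have e: "w = q * (1 / w)" using w0 by (simp add: field_simps power2_eq_square)
        have "\<Phi> (q * (1 / w)) = 1 / (q * (1 / w) ^ 6) * (- \<Phi> w / w ^ 4)"
          using sh(1)[of "1 / w"] sh(2)[OF w0] w0 by simp
        also have "\<dots> = - (w\<^sup>2 / q) * \<Phi> w"
          using w0 by (simp add: divide_simps power_numeral_reduce)
        finally show ?thesis using 2 e by simp
      qed
      then have "\<Phi> w = 0" by simp
      then show ?thesis using pw[OF z(1), of "- k"] by (simp add: w_def)
    next
      case 2
      then obtain n where n: "u * z = q powi n" using theta_eq_0_iff[of "u * z"] z u by auto
      then have "z = 1 / u * q powi n" using u by (simp add: field_simps)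
      then show ?thesis using pw[of "1 / u" n] inv[of u] u \<Phi>u by simp
    next
      case 3
      then obtain n where n: "u / z = q powi n" using theta_eq_0_iff[of "u / z"] z u by auto
      then have "z = u * q powi (- n)" using z by (simp add: power_int_minus field_simps)
      then show ?thesis using pw[of u "- n"] u \<Phi>u by simp
    qed
  qed
qed

text \<open>
  Subtracting a multiple of \<open>chi v\<close> makes \<open>\<Phi>\<close> vanish at \<open>u\<close>; in particular the space is two-dimensional.
\<close>

lemma antisym_theta_interpolation:
  assumes \<Phi>: "antisym_theta \<Phi>" and uv: "u \<noteq> 0" "v \<noteq> 0"
    and gen: "\<And>n. u\<^sup>2 \<noteq> q powi n" "\<And>n. v\<^sup>2 \<noteq> q powi n" "\<And>n. u * v \<noteq> q powi n"
      "\<And>n. u / v \<noteq> q powi n"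
    and z: "z \<noteq> 0"
  shows "\<Phi> z = \<Phi> v / chi u v * chi u z + \<Phi> u / chi v u * chi v z"
proof -
  have vu: "v / u \<noteq> q powi n" for n
  proof
    assume "v / u = q powi n"
    then have "u / v = q powi (- n)" using uv by (simp add: power_int_minus field_simps)
    then show False using gen by blast
  qed
  have nz: "chi u v \<noteq> 0" "chi v u \<noteq> 0"
    using chi_nonzero[OF uv gen(2,3,4)] chi_nonzero[OF uv(2,1) gen(1) _ vu] gen(3)
    by (auto simp: mult.commute)
  define \<Psi> where "\<Psi> z = \<Phi> z - \<Phi> u / chi v u * chi v z" for z
  have "antisym_theta \<Psi>" unfolding \<Psi>_def
    by (intro antisym_theta_diff \<Phi> antisym_theta_chi uv)
  moreover have "\<Psi> u = 0" using nz by (simp add: \<Psi>_def)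
  ultimately obtain c where c: "\<And>z. z \<noteq> 0 \<Longrightarrow> \<Psi> z = c * chi u z"
    using antisym_theta_vanishing[OF _ uv(1) gen(1)] by blast
  have "\<Phi> v = c * chi u v" using c[OF uv(2)] uv by (simp add: \<Psi>_def)
  then have "c = \<Phi> v / chi u v" using nz by simp
  then show ?thesis using c[OF z] by (simp add: \<Psi>_def algebra_simps)
qed

definition theta_product where
  "theta_product a b c d e f z = theta (a * z) * theta (b * z) * theta (c * z) * theta (d * z) * theta (e * z) * theta (f * z)"

text \<open>
  The factor \<open>z\<^sup>4\<close> makes this the antisymmetric part of \<open>theta_product\<close> (up to a factor 2) when both are divided
  by \<open>z\<^sup>2\<close>.
\<close>

definition antisym_part where
  "antisym_part a b c d e f z = theta_product a b c d e f z - z ^ 4 * theta_product a b c d e f (1 / z)"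

lemma antisym_theta_antisym_part:
  assumes prod: "a * b * c * d * e * f = q"
  shows "antisym_theta (antisym_part a b c d e f)"
proof -
  have nz: "a \<noteq> 0" "b \<noteq> 0" "c \<noteq> 0" "d \<noteq> 0" "e \<noteq> 0" "f \<noteq> 0"
    using prod q_nz by auto
  have sh: "theta_product a b c d e f (q * z) = theta_product a b c d e f z / (q * z ^ 6)" if z: "z \<noteq> 0" for z
  proof -
    have t: "theta (x * (q * z)) = - theta (x * z) / (x * z)" if "x \<noteq> 0" for x
      using theta_shift[of "x * z"] z that by (simp add: mult_ac)
    have "theta_product a b c d e f (q * z) = theta_product a b c d e f z / ((a * b * c * d * e * f) * z ^ 6)"
      unfolding theta_product_def t[OF nz(1)] t[OF nz(2)] t[OF nz(3)] t[OF nz(4)] t[OF nz(5)] t[OF nz(6)]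
      by (simp add: power_numeral_reduce)
    then show ?thesis by (simp only: prod)
  qed
  have sh': "theta_product a b c d e f (1 / (q * z)) = theta_product a b c d e f (1 / z) / (q ^ 5 * z ^ 6)" if z: "z \<noteq> 0" for z
  proof -
    have "theta_product a b c d e f (1 / z) = theta_product a b c d e f (1 / (q * z)) / (q * (1 / (q * z)) ^ 6)"
      using sh[of "1 / (q * z)"] z by simp
    moreover have "q * (1 / (q * z)) ^ 6 = 1 / (q ^ 5 * z ^ 6)"
      using z by (simp add: power_divide power_mult_distrib power_numeral_reduce)
    ultimately show ?thesis using z by simp
  qed
  show ?thesis unfolding antisym_theta_def
  proof (intro conjI allI impI)
    show "antisym_part a b c d e f holomorphic_on - {0}"
      unfolding antisym_part_def theta_product_def using nz by (intro holomorphic_intros) auto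
    fix z :: complex assume z: "z \<noteq> 0"
    have "q ^ 5 = q * q ^ 4" by (simp add: eval_nat_numeral)
    then have "(q * z) ^ 4 / (q ^ 5 * z ^ 6) = z ^ 4 / (q * z ^ 6)"
      by (simp add: power_mult_distrib)
    then have x: "(q * z) ^ 4 * (X / (q ^ 5 * z ^ 6)) = 1 / (q * z ^ 6) * (z ^ 4 * X)" for X
      by (metis times_divide_eq_left times_divide_eq_right mult_1)
    show "antisym_part a b c d e f (q * z) = 1 / (q * z ^ 6) * antisym_part a b c d e f z"
      unfolding antisym_part_def sh[OF z] sh'[OF z] x by (simp add: right_diff_distrib diff_divide_distrib)
    show "antisym_part a b c d e f (1 / z) = - antisym_part a b c d e f z / z ^ 4"
      unfolding antisym_part_def using z by (simp add: field_simps)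
  qed
qed

text \<open>
  This coefficient occurs in \<open>C\<close>, with \<open>(a, b) = (\<lambda>\<^sub>1, \<lambda>\<^sub>2)\<close> in the first term and \<open>(\<lambda>\<^sub>2, \<lambda>\<^sub>1)\<close> in the second.
\<close>

definition interp_coeff where
  "interp_coeff a b c d e f = theta (c * b) * theta (d * b) * theta (e * b) * theta (f * b) / (b * theta (a / b))"

text \<open>
  Interpolation at \<open>a\<close> and \<open>b\<close>, where the subtracted half of \<open>antisym_part\<close> vanishes because of \<open>\<theta>(1) = 0\<close>.
\<close>

lemma antisym_part_eq_generic:
  assumes prod: "a * b * c * d * e * f = q"
    and gen: "theta (a\<^sup>2) \<noteq> 0" "theta (b\<^sup>2) \<noteq> 0" "theta (a * b) \<noteq> 0" "theta (a / b) \<noteq> 0"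
    and z: "z \<noteq> 0"
  shows "antisym_part a b c d e f z = interp_coeff a b c d e f * chi a z + interp_coeff b a c d e f * chi b z"
proof -
  have nz: "a \<noteq> 0" "b \<noteq> 0" using prod q_nz by auto
  have at_b: "antisym_part a b c d e f b = theta (a * b) * theta (b\<^sup>2) * (theta (c * b) * theta (d * b) * theta (e * b) * theta (f * b))"
    using nz by (simp add: antisym_part_def theta_product_def power2_eq_square)
  have at_a: "antisym_part a b c d e f a = theta (a * b) * theta (a\<^sup>2) * (theta (c * a) * theta (d * a) * theta (e * a) * theta (f * a))"
    using nz by (simp add: antisym_part_def theta_product_def power2_eq_square mult_ac)
  have ba: "theta (b / a) \<noteq> 0" using theta_inverse'[of b a] nz gen by simp
  have g: "\<And>n. a\<^sup>2 \<noteq> q powi n" "\<And>n. b\<^sup>2 \<noteq> q powi n" "\<And>n. a * b \<noteq> q powi n" "\<And>n. a / b \<noteq> q powi n"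
    using gen theta_powi_eq_0 by metis+
  show ?thesis
    unfolding antisym_theta_interpolation[OF antisym_theta_antisym_part[OF prod] nz g z] at_a at_b
    using nz gen ba by (simp add: interp_coeff_def chi_def mult_ac)
qed

text \<open>
  If \<open>a b\<close> is a power of \<open>q\<close> then \<open>chi a\<close> and \<open>chi b\<close> are proportional and interpolation is impossible; the
  identity persists by continuity.
\<close>

lemma antisym_part_eq:
  assumes prod: "a * b * c * d * e * f = q"
    and gen: "theta (a\<^sup>2) \<noteq> 0" "theta (b\<^sup>2) \<noteq> 0" "theta (a / b) \<noteq> 0"
    and z: "z \<noteq> 0"
  shows "antisym_part a b c d e f z = interp_coeff a b c d e f * chi a z + interp_coeff b a c d e f * chi b z"
proof (cases "theta (a * b) = 0")
  case False
  then show ?thesis using antisym_part_eq_generic[OF prod gen(1,2) _ gen(3) z] by simp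
next
  case True
  have nz: "a \<noteq> 0" "b \<noteq> 0" "c \<noteq> 0" "d \<noteq> 0" "e \<noteq> 0" "f \<noteq> 0"
    using prod q_nz by auto
  obtain n where n: "a * b = q powi n" using True theta_eq_0_iff nz by auto
  have ba: "theta (b / a) \<noteq> 0" using theta_inverse'[of b a] nz gen by simp
  define R where "R a c = interp_coeff a b c d e f * chi a z + interp_coeff b a c d e f * chi b z" for a c
  \<comment> \<open>Replace \<open>(a, c)\<close> by \<open>(a t, c / t)\<close> with real \<open>t > 1\<close> close to 1. Since \<open>t\<close> is then not a power of \<open>q\<close>,
    the generic case applies, and \<open>t \<rightarrow> 1\<close> gives the claim.\<close>
  define w where "w t = complex_of_real t" for t
  have w: "(w \<longlongrightarrow> 1) (at_right 1)" unfolding w_def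
    by (rule tendsto_eq_intros refl)+ simp
  define A C where "A t = a * w t" and "C t = c / w t" for t
  have A: "(A \<longlongrightarrow> a) (at_right 1)" and C: "(C \<longlongrightarrow> c) (at_right 1)"
    unfolding A_def C_def by (rule tendsto_eq_intros w refl | simp)+
  have lims: "((\<lambda>t. antisym_part (A t) b (C t) d e f z) \<longlongrightarrow> antisym_part a b c d e f z) (at_right 1)"
    "((\<lambda>t. R (A t) (C t)) \<longlongrightarrow> R a c) (at_right 1)"
    unfolding antisym_part_def theta_product_def R_def interp_coeff_def chi_def
    by (intro tendsto_intros A C; use nz z gen ba in simp)+
  have ev: "\<forall>\<^sub>F t in at_right 1. theta ((A t)\<^sup>2) \<noteq> 0"
    by (rule tendsto_imp_eventually_ne[OF _ gen(1)]) (intro tendsto_intros A; use nz in simp)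
  have ev2: "\<forall>\<^sub>F t in at_right 1. theta (A t / b) \<noteq> 0"
    by (rule tendsto_imp_eventually_ne[OF _ gen(3)]) (intro tendsto_intros A; use nz in simp)
  note lims = lims[unfolded A_def C_def] and ev = ev[unfolded A_def] ev2[unfolded A_def]
  have "1 < 1 / norm q" using q_pos q_less_1 by simp
  then have ev': "\<forall>\<^sub>F t in at_right 1. 1 < t \<and> t < 1 / norm q"
    by (intro eventually_conj eventually_at_right_less order_tendstoD(2)[OF tendsto_ident_at])
  have "\<forall>\<^sub>F t in at_right 1. antisym_part (a * w t) b (c / w t) d e f z = R (a * w t) (c / w t)"
    using ev(1) ev(2) ev'
  proof eventually_elim
    case (elim t)
    have w0: "w t \<noteq> 0" using elim by (simp add: w_def)
    have "theta (a * w t * b) \<noteq> 0"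
    proof
      assume "theta (a * w t * b) = 0"
      then obtain m where "a * w t * b = q powi m" using theta_eq_0_iff nz w0 by auto
      then have "w t * (a * b) = q powi m" by (simp add: mult_ac)
      then have "w t = q powi m / q powi n" unfolding n by (simp add: field_simps)
      then have "w t = q powi (m - n)" by (simp add: power_int_diff)
      then have "norm (w t) = norm q powi (m - n)" by (simp add: norm_power_int)
      then have t: "t = norm q powi (m - n)" using elim by (simp add: w_def)
      show False
      proof (cases "m - n \<ge> 0")
        case True
        then have "norm q powi (m - n) \<le> 1" using norm_q_power_le_1[of "nat (m - n)"]
          by (simp add: power_int_def)
        then show False using t elim by simp
      next
        case False
        then obtain k where k: "m - n = - int (Suc k)"
          by (metis add.commute linorder_not_le negD of_nat_0_less_iff plus_1_eq_Suc)
        have "norm q powi (m - n) = (1 / norm q) ^ Suc k"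
          unfolding k by (simp only: power_int_minus power_int_of_nat) (simp add: field_simps)
        moreover have "1 / norm q \<le> (1 / norm q) ^ Suc k"
          using \<open>1 < 1 / norm q\<close> by (intro self_le_power) auto
        ultimately show False using t elim by simp
      qed
    qed
    moreover have "a * w t * b * (c / w t) * d * e * f = a * b * c * d * e * f" using w0 by simp
    then have "a * w t * b * (c / w t) * d * e * f = q" by (simp only: prod)
    ultimately show ?case unfolding R_def using elim gen z
      by (intro antisym_part_eq_generic) auto
  qed
  then have "((\<lambda>t. R (a * w t) (c / w t)) \<longlongrightarrow> antisym_part a b c d e f z) (at_right 1)"
    using lims(1) by (rule Lim_transform_eventually[rotated])
  then have "antisym_part a b c d e f z = R a c"
    using lims(2) tendsto_unique by (metis trivial_limit_at_right_real)
  then show ?thesis by (simp add: R_def)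
qed

end

section \<open>The \<open>q\<close>-binomial theorem and the constant term of the theta function\<close>

lemma prod_lessThan_add:
  "(\<Prod>i<m + n. f i) = (\<Prod>i<m. f i) * (\<Prod>i<n. f (m + i) :: 'a::comm_monoid_mult)" for m n :: nat
  by (induction n) (simp_all add: mult_ac)

lemma bounded_const_image [simp]: "bounded ((\<lambda>_. c) ` S)"
  by (simp add: image_constant_conv)

lemma uniform_bounded_circle:
  assumes "continuous_on (sphere 0 1) (f :: complex \<Rightarrow> complex)"
  shows "bounded (f ` sphere 0 1)"
  using compact_imp_bounded[OF compact_continuous_image[OF assms]] by simp

context nome
begin

definition fin_poc where
  "fin_poc p n = (\<Prod>i<n. 1 - p * q ^ i)"

lemma fin_poc_add4: "fin_poc p (4 * n) * fin_poc (p * q ^ (4 * n)) 4 = fin_poc p (4 * Suc n)"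
  by (simp add: fin_poc_def eval_nat_numeral power_add mult_ac)

lemma fin_poc_tendsto: "(\<lambda>n. fin_poc p (4 * n)) \<longlonglongrightarrow> poc p"
proof -
  have "filterlim (\<lambda>n::nat. 4 * n) sequentially sequentially"
    by (rule filterlim_subseq) (simp add: strict_mono_def)
  then show ?thesis using filterlim_compose[OF poc_tendsto] unfolding fin_poc_def by blast
qed

definition qfac where "qfac n = fin_poc q n"

lemma qfac_Suc: "qfac (Suc n) = qfac n * (1 - q ^ Suc n)"
  by (simp add: qfac_def fin_poc_def)

lemma qfac_0 [simp]: "qfac 0 = 1"
  by (simp add: qfac_def fin_poc_def)

lemma qfac_nz [simp]: "qfac n \<noteq> 0"
  by (induction n) (use q_power_neq_1 in \<open>auto simp: qfac_Suc\<close>)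

text \<open>
  The Gaussian binomial coefficient.
\<close>

definition gauss where
  "gauss M k = (if k \<le> M then qfac M / (qfac k * qfac (M - k)) else 0)"

lemma gauss_Suc:
  assumes "k \<le> M"
  shows "gauss (Suc M) (Suc k) = gauss M (Suc k) + q ^ (M - k) * gauss M k"
proof (cases "k = M")
  case True
  then show ?thesis by (simp add: gauss_def)
next
  case False
  then obtain j where j: "M = k + Suc j" using assms
    by (metis le_neq_implies_less less_imp_Suc_add add_Suc_right)
  have nz: "1 - q ^ Suc n \<noteq> 0" for n using q_power_neq_1[of n] by simp
  have "(1 - q ^ Suc M) = (1 - q ^ Suc j) + q ^ Suc j * (1 - q ^ Suc k)"
    by (simp add: j algebra_simps power_add)
  then have "qfac (Suc M) / (qfac (Suc k) * qfac (Suc j)) =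
     qfac M * ((1 - q ^ Suc j) + q ^ Suc j * (1 - q ^ Suc k)) / (qfac (Suc k) * qfac (Suc j))"
    by (simp only: qfac_Suc[of M])
  also have "\<dots> = qfac M * (1 - q ^ Suc j) / (qfac (Suc k) * qfac (Suc j)) +
      q ^ Suc j * (qfac M * (1 - q ^ Suc k) / (qfac (Suc k) * qfac (Suc j)))"
    by (simp only: distrib_left add_divide_distrib mult_ac times_divide_eq_right)
  also have "qfac M * (1 - q ^ Suc j) / (qfac (Suc k) * qfac (Suc j)) = qfac M / (qfac (Suc k) * qfac j)"
    unfolding qfac_Suc[of j] using nz[of j] by (simp del: power_Suc)
  also have "qfac M * (1 - q ^ Suc k) / (qfac (Suc k) * qfac (Suc j)) = qfac M / (qfac k * qfac (Suc j))"
    unfolding qfac_Suc[of k] using nz[of k] by (simp del: power_Suc)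
  finally show ?thesis by (simp add: gauss_def j)
qed

text \<open>
  This is \<open>(-1)\<^sup>k q\<^bsup>k(k-1)/2\<^esup>\<close>; the product form avoids halving exponents.
\<close>

definition qtri where "qtri k = (\<Prod>i<k. - (q ^ i))"

lemma q_binomial: "(\<Prod>i<M. 1 - x * q ^ i) = (\<Sum>k\<le>M. qtri k * gauss M k * x ^ k)"
proof (induction M)
  case 0
  then show ?case by (simp add: qtri_def gauss_def)
next
  case (Suc M)
  have g0: "gauss N 0 = 1" for N by (simp add: gauss_def)
  have "(\<Sum>k\<le>Suc M. qtri k * gauss (Suc M) k * x ^ k) =
     qtri 0 * gauss M 0 * x ^ 0 + (\<Sum>k\<le>M. qtri (Suc k) * gauss (Suc M) (Suc k) * x ^ Suc k)"
    by (subst sum.atMost_Suc_shift) (simp add: g0)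
  also have "(\<Sum>k\<le>M. qtri (Suc k) * gauss (Suc M) (Suc k) * x ^ Suc k) =
     (\<Sum>k\<le>M. qtri (Suc k) * gauss M (Suc k) * x ^ Suc k - x * q ^ M * (qtri k * gauss M k * x ^ k))"
  proof (rule sum.cong[OF refl])
    \<comment> \<open>This is Pascal's rule \<open>gauss_Suc\<close>, multiplied by the power of \<open>q\<close> in front.\<close>
    fix k assume "k \<in> {..M}"
    then have k: "k \<le> M" by simp
    then have "q ^ k * q ^ (M - k) = q ^ M" by (simp flip: power_add)
    moreover have "qtri (Suc k) = - (q ^ k) * qtri k" by (simp add: qtri_def)
    ultimately show "qtri (Suc k) * gauss (Suc M) (Suc k) * x ^ Suc k =
       qtri (Suc k) * gauss M (Suc k) * x ^ Suc k - x * q ^ M * (qtri k * gauss M k * x ^ k)"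
      unfolding gauss_Suc[OF k] by (simp add: algebra_simps)
  qed
  also have "qtri 0 * gauss M 0 * x ^ 0 + \<dots> =
     (\<Sum>k\<le>Suc M. qtri k * gauss M k * x ^ k) - x * q ^ M * (\<Sum>k\<le>M. qtri k * gauss M k * x ^ k)"
    by (subst sum.atMost_Suc_shift) (simp add: sum_subtractf sum_distrib_left)
  also have "(\<Sum>k\<le>Suc M. qtri k * gauss M k * x ^ k) = (\<Sum>k\<le>M. qtri k * gauss M k * x ^ k)"
    by (simp add: gauss_def)
  also have "(\<Sum>k\<le>M. qtri k * gauss M k * x ^ k) - x * q ^ M * (\<Sum>k\<le>M. qtri k * gauss M k * x ^ k) =
     (\<Prod>i<Suc M. 1 - x * q ^ i)"
    unfolding Suc[symmetric] by (simp add: algebra_simps)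
  finally show ?case ..
qed

lemma qtri_sq: "qtri N * qtri N * q ^ N = q ^ (N * N)"
proof (induction N)
  case (Suc N)
  have "qtri (Suc N) * qtri (Suc N) * q ^ Suc N = qtri N * qtri N * q ^ N * (q ^ N * q ^ N * q)"
    by (simp add: qtri_def mult_ac)
  also have "\<dots> = q ^ (N * N + (N + N + 1))" unfolding Suc by (simp add: power_add mult_ac)
  also have "N * N + (N + N + 1) = Suc N * Suc N" by simp
  finally show ?case .
qed (simp add: qtri_def)

text \<open>
  The finite form of the triple product identity.
\<close>

lemma finite_theta_expansion:
  assumes w: "w \<noteq> 0"
  shows "fin_poc w N * fin_poc (q / w) N =
     (\<Sum>k\<le>2 * N. qtri N * q ^ N * qtri k * gauss (2 * N) k / q ^ (N * k) * w powi (int k - int N))"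
proof -
  have "fin_poc (q / w) N = (\<Prod>i<N. - (q ^ Suc i / w) * (1 - w / q ^ Suc i))"
    unfolding fin_poc_def by (rule prod.cong) (use w in \<open>auto simp: field_simps\<close>)
  also have "\<dots> = (\<Prod>i<N. - (q ^ i) * (q / w)) * (\<Prod>i<N. 1 - w / q ^ Suc i)"
    by (simp add: prod.distrib[symmetric] mult_ac)
  also have "(\<Prod>i<N. - (q ^ i) * (q / w)) = qtri N * (q / w) ^ N"
    unfolding qtri_def by (subst prod.distrib) simp
  also have "(\<Prod>i<N. 1 - w / q ^ Suc i) = (\<Prod>i<N. 1 - w / q ^ N * q ^ i)"
  proof (rule prod.reindex_bij_witness[of _ "\<lambda>i. N - Suc i" "\<lambda>i. N - Suc i"])
    fix i assume "i \<in> {..<N}"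
    then have "q ^ N = q ^ Suc i * q ^ (N - Suc i)" by (subst power_add[symmetric]) simp
    then show "1 - w / q ^ N * q ^ (N - Suc i) = 1 - w / q ^ Suc i" by simp
  qed auto
  \<comment> \<open>All \<open>2 N\<close> factors are now values of a single product \<open>(w q\<^sup>-\<^sup>N)\<^sub>2\<^sub>N\<close>, to which the binomial theorem applies.\<close>
  finally have 1: "fin_poc (q / w) N = qtri N * (q / w) ^ N * (\<Prod>i<N. 1 - w / q ^ N * q ^ i)" .
  have 2: "fin_poc w N = (\<Prod>i<N. 1 - w / q ^ N * q ^ (N + i))"
    unfolding fin_poc_def by (simp add: power_add)
  have "(\<Prod>i<N + N. 1 - w / q ^ N * q ^ i) =
     (\<Prod>i<N. 1 - w / q ^ N * q ^ i) * (\<Prod>i<N. 1 - w / q ^ N * q ^ (N + i))"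
    by (rule prod_lessThan_add)
  then have "fin_poc w N * fin_poc (q / w) N = qtri N * (q / w) ^ N * (\<Prod>i<2 * N. 1 - w / q ^ N * q ^ i)"
    unfolding 1 2 mult_2 by (simp only: mult_ac)
  also have "\<dots> = (\<Sum>k\<le>2 * N. qtri N * (q / w) ^ N * (qtri k * gauss (2 * N) k * (w / q ^ N) ^ k))"
    unfolding q_binomial by (simp add: sum_distrib_left)
  also have "\<dots> = (\<Sum>k\<le>2 * N. qtri N * q ^ N * qtri k * gauss (2 * N) k / q ^ (N * k) * w powi (int k - int N))"
  proof (rule sum.cong[OF refl])
    fix k
    have "(q ^ N) ^ k = q ^ (N * k)" by (rule power_mult[symmetric])
    moreover have "w powi (int k - int N) = w ^ k / w ^ N" using w by (simp add: power_int_diff)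
    ultimately show "qtri N * (q / w) ^ N * (qtri k * gauss (2 * N) k * (w / q ^ N) ^ k) =
       qtri N * q ^ N * qtri k * gauss (2 * N) k / q ^ (N * k) * w powi (int k - int N)"
      by (simp add: power_divide mult_ac)
  qed
  finally show ?thesis .
qed

lemma finite_theta_integral:
  "((\<lambda>z. (1 - 1 / z\<^sup>2) * (fin_poc (z\<^sup>2) N * fin_poc (q / z\<^sup>2) N) / z) has_contour_integral
     2 * of_real pi * \<i> * (gauss (2 * N) N + gauss (2 * N) (Suc N))) (circlepath 0 1)"
proof -
  define c where "c k = qtri N * q ^ N * qtri k * gauss (2 * N) k / q ^ (N * k)" for k
  let ?d = "\<lambda>m::int. if m = 0 then 2 * of_real pi * \<i> else (0::complex)"
  let ?m = "\<lambda>k. 2 * (int k - int N)"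
  have "((\<lambda>z. \<Sum>k\<le>2 * N. c k * (z powi (?m k) / z - z powi (?m k - 2) / z)) has_contour_integral
     (\<Sum>k\<le>2 * N. c k * (?d (?m k) - ?d (?m k - 2)))) (circlepath 0 1)"
    by (intro has_contour_integral_sum has_contour_integral_lmul has_contour_integral_diff
        circle_integral_powi finite_atMost)
  moreover have "(\<Sum>k\<le>2 * N. c k * (z powi (?m k) / z - z powi (?m k - 2) / z)) =
     (1 - 1 / z\<^sup>2) * (fin_poc (z\<^sup>2) N * fin_poc (q / z\<^sup>2) N) / z" if z: "z \<noteq> 0" for z
  proof -
    have e: "(z\<^sup>2) powi (int k - int N) = z powi (?m k)" for k
      by (simp only: power_int_mult) (simp add: power_int_numeral)
    have fe: "fin_poc (z\<^sup>2) N * fin_poc (q / z\<^sup>2) N = (\<Sum>k\<le>2 * N. c k * z powi (?m k))"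
      using finite_theta_expansion[of "z\<^sup>2" N] z unfolding e c_def by simp
    have "(1 - 1 / z\<^sup>2) * (fin_poc (z\<^sup>2) N * fin_poc (q / z\<^sup>2) N) / z =
       (\<Sum>k\<le>2 * N. (1 - 1 / z\<^sup>2) * (c k * z powi (?m k)) / z)"
      unfolding fe by (simp only: sum_distrib_left sum_divide_distrib)
    also have "\<dots> = (\<Sum>k\<le>2 * N. c k * (z powi (?m k) / z - z powi (?m k - 2) / z))"
    proof (rule sum.cong[OF refl])
      fix k
      have "z powi (?m k - 2) = z powi (?m k) / z\<^sup>2" using z by (simp add: power_int_diff)
      then show "(1 - 1 / z\<^sup>2) * (c k * z powi (?m k)) / z = c k * (z powi (?m k) / z - z powi (?m k - 2) / z)"
        by (simp add: algebra_simps diff_divide_distrib)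
    qed
    finally show ?thesis ..
  qed
  ultimately have "((\<lambda>z. (1 - 1 / z\<^sup>2) * (fin_poc (z\<^sup>2) N * fin_poc (q / z\<^sup>2) N) / z) has_contour_integral
     (\<Sum>k\<le>2 * N. c k * (?d (?m k) - ?d (?m k - 2)))) (circlepath 0 1)"
    by (rule has_contour_integral_eq) (auto simp: path_image_circlepath_nonneg)
  moreover have "(\<Sum>k\<le>2 * N. c k * (?d (?m k) - ?d (?m k - 2))) =
     2 * of_real pi * \<i> * (gauss (2 * N) N + gauss (2 * N) (Suc N))"
  proof -
    \<comment> \<open>Only \<open>k = N\<close> and \<open>k = N + 1\<close> contribute to the constant term.\<close>
    have "(\<Sum>k\<le>2 * N. c k * (?d (?m k) - ?d (?m k - 2))) =
      (\<Sum>k\<le>2 * N. (if k = N then c k * (2 * of_real pi * \<i>) else 0)) -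
      (\<Sum>k\<le>2 * N. (if k = Suc N then c k * (2 * of_real pi * \<i>) else 0))"
      by (subst sum_subtractf[symmetric], rule sum.cong[OF refl]) auto
    also have "\<dots> = c N * (2 * of_real pi * \<i>) -
       (if Suc N \<le> 2 * N then c (Suc N) * (2 * of_real pi * \<i>) else 0)"
      by simp
    also have "c N = gauss (2 * N) N"
    proof -
      have "c N = (qtri N * qtri N * q ^ N) * gauss (2 * N) N / q ^ (N * N)"
        unfolding c_def by (simp add: mult_ac)
      then show ?thesis unfolding qtri_sq by simp
    qed
    also have "(if Suc N \<le> 2 * N then c (Suc N) * (2 * of_real pi * \<i>) else 0) = - gauss (2 * N) (Suc N) * (2 * of_real pi * \<i>)"
    proof (cases "Suc N \<le> 2 * N")
      case True
      have "qtri (Suc N) = - (q ^ N) * qtri N" by (simp add: qtri_def)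
      then have "c (Suc N) = - ((qtri N * qtri N * q ^ N) * q ^ N * gauss (2 * N) (Suc N) / q ^ (N * Suc N))"
        unfolding c_def by (simp add: mult_ac)
      also have "\<dots> = - gauss (2 * N) (Suc N)" unfolding qtri_sq by (simp add: power_add)
      finally show ?thesis using True by simp
    next
      case False
      then show ?thesis by (simp add: gauss_def)
    qed
    finally show ?thesis by (simp add: algebra_simps)
  qed
  ultimately show ?thesis by simp
qed

lemma gauss_central_limits:
  "(\<lambda>N. gauss (2 * N) N) \<longlonglongrightarrow> 1 / poc q" "(\<lambda>N. gauss (2 * N) (Suc N)) \<longlonglongrightarrow> 1 / poc q"
proof -
  have "qfac = (\<lambda>n. \<Prod>k<n. 1 - q * q ^ k)" by (simp add: fun_eq_iff qfac_def fin_poc_def)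
  then have t: "qfac \<longlonglongrightarrow> poc q" using poc_tendsto[of q] by (simp only:)
  have "filterlim (\<lambda>n::nat. 2 * n) sequentially sequentially"
    by (rule filterlim_subseq) (simp add: strict_mono_def)
  then have t2: "(\<lambda>N. qfac (2 * N)) \<longlonglongrightarrow> poc q" using t filterlim_compose by blast
  have tS: "(\<lambda>N. qfac (Suc N)) \<longlonglongrightarrow> poc q" using t by (simp add: LIMSEQ_Suc)
  have tP: "(\<lambda>N. qfac (N - 1)) \<longlonglongrightarrow> poc q"
    by (rule LIMSEQ_imp_Suc) (simp add: t)
  have "(\<lambda>N. qfac (2 * N) / (qfac N * qfac N)) \<longlonglongrightarrow> poc q / (poc q * poc q)"
    using poc_q_nz by (intro tendsto_intros t t2) auto
  then show "(\<lambda>N. gauss (2 * N) N) \<longlonglongrightarrow> 1 / poc q"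
    using poc_q_nz by (simp add: gauss_def mult_2)
  have "(\<lambda>N. qfac (2 * N) / (qfac (Suc N) * qfac (N - 1))) \<longlonglongrightarrow> poc q / (poc q * poc q)"
    using poc_q_nz by (intro tendsto_intros tS tP t2) auto
  then have l: "(\<lambda>N. qfac (2 * N) / (qfac (Suc N) * qfac (N - 1))) \<longlonglongrightarrow> 1 / poc q"
    using poc_q_nz by simp
  have "\<forall>\<^sub>F N in sequentially. qfac (2 * N) / (qfac (Suc N) * qfac (N - 1)) = gauss (2 * N) (Suc N)"
    using eventually_ge_at_top[of 1]
  proof eventually_elim
    case (elim N)
    then have "2 * N - Suc N = N - 1" by simp
    then show ?case using elim by (simp add: gauss_def)
  qed
  with l show "(\<lambda>N. gauss (2 * N) (Suc N)) \<longlonglongrightarrow> 1 / poc q" by (rule Lim_transform_eventually)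
qed

text \<open>
  Replace \<open>\<theta>\<close> by the finite products, which converge uniformly on the circle.
\<close>

lemma theta_circle_integral:
  "contour_integral (circlepath 0 1) (\<lambda>z. (1 - 1 / z\<^sup>2) * theta (z\<^sup>2) / z) = 2 * of_real pi * \<i> * (2 / poc q)"
proof -
  let ?f = "\<lambda>N z. (1 - 1 / z\<^sup>2) * (fin_poc (z\<^sup>2) N * fin_poc (q / z\<^sup>2) N) / z"
  have s: "z \<noteq> 0" if "z \<in> sphere (0::complex) 1" for z using that by auto
  have u1: "uniform_limit (sphere 0 1) (\<lambda>N z. fin_poc (z\<^sup>2) N) (\<lambda>z. poc (z\<^sup>2)) sequentially"
    unfolding fin_poc_def
    by (rule uniform_limit_compose'[OF poc_uniform_limit[of "sphere 0 1"]]) (auto simp: norm_power)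
  have u2: "uniform_limit (sphere 0 1) (\<lambda>N z. fin_poc (q / z\<^sup>2) N) (\<lambda>z. poc (q / z\<^sup>2)) sequentially"
    unfolding fin_poc_def
    by (rule uniform_limit_compose'[OF poc_uniform_limit[of "sphere 0 (norm q)"]]) (auto simp: norm_power norm_divide)
  have c: "continuous_on (sphere 0 1) (\<lambda>z. poc (z\<^sup>2))" "continuous_on (sphere 0 1) (\<lambda>z. poc (q / z\<^sup>2))"
    "continuous_on (sphere 0 1) (\<lambda>z::complex. (1 - 1 / z\<^sup>2) / z)"
    using s by (auto intro!: continuous_intros)
  have u: "uniform_limit (sphere 0 1) (\<lambda>N z. (1 - 1 / z\<^sup>2) / z * (fin_poc (z\<^sup>2) N * fin_poc (q / z\<^sup>2) N))
     (\<lambda>z. (1 - 1 / z\<^sup>2) / z * (poc (z\<^sup>2) * poc (q / z\<^sup>2))) sequentially"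
    by (intro uniform_lim_mult u1 u2 uniform_limit_const uniform_bounded_circle c continuous_on_mult)
  have "(\<lambda>N. contour_integral (circlepath 0 1) (?f N)) \<longlonglongrightarrow>
     contour_integral (circlepath 0 1) (\<lambda>z. (1 - 1 / z\<^sup>2) * theta (z\<^sup>2) / z)"
  proof (rule contour_integral_uniform_limit_circlepath(2))
    show "\<forall>\<^sub>F N in sequentially. ?f N contour_integrable_on circlepath 0 1"
      using finite_theta_integral has_contour_integral_integrable by (intro always_eventually) blast
    show "uniform_limit (sphere 0 1) ?f (\<lambda>z. (1 - 1 / z\<^sup>2) * theta (z\<^sup>2) / z) sequentially"
      using u by (simp add: qtheta_def)
  qed auto
  moreover have "(\<lambda>N. contour_integral (circlepath 0 1) (?f N)) \<longlonglongrightarrow> 2 * of_real pi * \<i> * (1 / poc q + 1 / poc q)"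
    unfolding contour_integral_unique[OF finite_theta_integral]
    by (intro tendsto_intros gauss_central_limits)
  ultimately show ?thesis using LIMSEQ_unique by fastforce
qed

end

section \<open>The Nassrallah-Rahman integral\<close>

text \<open>
  Here \<open>r, s, t, u\<close> are the elementary symmetric functions of four parameters. Using them as variables keeps the
  identity small enough for direct verification.
\<close>

lemma nr_poly_identity:
  fixes a r s t u z :: complex
  shows "a * (1 - a^2 * u) * ((1 - a * u * z) * (z - a) * (z^4 - r * z^3 + s * z^2 - t * z + u)
      - (z - a * u) * (1 - a * z) * (1 - r * z + s * z^2 - t * z^3 + u * z^4))
   = (z^2 - 1) * ((1 - r * a + s * a^2 - t * a^3 + u * a^4) * (1 - a * u * z) * (z - a * u)
      - (1 - a * t + a^2 * u * s - a^3 * u^2 * r + a^4 * u^3) * (1 - a * z) * (z - a)) * z"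
  by algebra

text \<open>
  Multiplied by \<open>z\<close>, the difference on the left is antisymmetric under \<open>z \<mapsto> 1/z\<close>, and its terms of degree \<open>\<plusminus>3\<close>
  cancel because of \<open>A = a b c d e\<close>. Divided by \<open>z - z\<^sup>-\<^sup>1\<close> it therefore has the form \<open>\<alpha> + \<beta> (z + z\<^sup>-\<^sup>1)\<close>, which is determined by
  the values at \<open>z = a\<close> and \<open>z = A\<close>.
\<close>

lemma nr_rational_identity:
  fixes a b c d e z :: complex
  assumes z: "z \<noteq> 0" and A: "A = a * b * c * d * e"
  shows "a * (1 - a * A) *
     (z * (1 - A * z) * ((1 - a / z) * (1 - b / z) * (1 - c / z) * (1 - d / z) * (1 - e / z))
      - 1 / z ^ 3 * (1 - A / z) * ((1 - a * z) * (1 - b * z) * (1 - c * z) * (1 - d * z) * (1 - e * z)))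
   = (1 - 1 / z\<^sup>2) *
     ((1 - a * b) * (1 - a * c) * (1 - a * d) * (1 - a * e) * ((1 - A * z) * (1 - A / z))
      - (1 - a * c * d * e) * (1 - a * b * d * e) * (1 - a * b * c * e) * (1 - a * b * c * d) *
        ((1 - a * z) * (1 - a / z)))"
proof -
  define r where "r = b + c + d + e"
  define s where "s = b * c + b * d + b * e + c * d + c * e + d * e"
  define t where "t = b * c * d + b * c * e + b * d * e + c * d * e"
  define u where "u = b * c * d * e"
  have p1: "(z - b) * (z - c) * (z - d) * (z - e) = z^4 - r * z^3 + s * z^2 - t * z + u"
    unfolding r_def s_def t_def u_def by algebra
  have p2: "(1 - b * x) * (1 - c * x) * (1 - d * x) * (1 - e * x) = 1 - r * x + s * x^2 - t * x^3 + u * x^4" for x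
    unfolding r_def s_def t_def u_def by algebra
  have p3: "(1 - a * b) * (1 - a * c) * (1 - a * d) * (1 - a * e) = 1 - r * a + s * a^2 - t * a^3 + u * a^4"
    using p2[of a] by (simp add: mult.commute)
  have p4: "(1 - a * c * d * e) * (1 - a * b * d * e) * (1 - a * b * c * e) * (1 - a * b * c * d) =
      1 - a * t + a^2 * u * s - a^3 * u^2 * r + a^4 * u^3"
    unfolding r_def s_def t_def u_def by algebra
  have A': "A = a * u" unfolding A u_def by (simp add: mult_ac)
  have m: "1 - x / z = (z - x) / z" for x using z by (simp add: field_simps)
  have 1: "z * (1 - A * z) * ((1 - a / z) * (1 - b / z) * (1 - c / z) * (1 - d / z) * (1 - e / z)) =
     (1 - A * z) * (z - a) * ((z - b) * (z - c) * (z - d) * (z - e)) / z ^ 4"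
    unfolding m using z by (simp add: eval_nat_numeral)
  have 2: "1 / z ^ 3 * (1 - A / z) * ((1 - a * z) * (1 - b * z) * (1 - c * z) * (1 - d * z) * (1 - e * z)) =
     (z - A) * (1 - a * z) * ((1 - b * z) * (1 - c * z) * (1 - d * z) * (1 - e * z)) / z ^ 4"
    unfolding m using z by (simp add: eval_nat_numeral mult_ac)
  have 3: "(1 - 1 / z\<^sup>2) * (X * ((1 - A * z) * (1 - A / z)) - Y * ((1 - a * z) * (1 - a / z))) =
    (z^2 - 1) * (X * (1 - A * z) * (z - A) - Y * (1 - a * z) * (z - a)) * z / z ^ 4" for X Y
  proof -
    have "1 - 1 / z\<^sup>2 = (z\<^sup>2 - 1) / z\<^sup>2" using z by (simp add: field_simps)
    moreover have "X * ((1 - x * z) * (1 - x / z)) = X * (1 - x * z) * (z - x) / z" for X x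
      unfolding m by (simp only: times_divide_eq_right mult.assoc)
    then have "X * ((1 - A * z) * (1 - A / z)) - Y * ((1 - a * z) * (1 - a / z)) =
      (X * (1 - A * z) * (z - A) - Y * (1 - a * z) * (z - a)) / z"
      by (simp only: diff_divide_distrib)
    ultimately show ?thesis using z by (simp add: eval_nat_numeral)
  qed
  have 4: "a * (1 - a * A) * ((1 - A * z) * (z - a) * ((z - b) * (z - c) * (z - d) * (z - e)) -
     (z - A) * (1 - a * z) * ((1 - b * z) * (1 - c * z) * (1 - d * z) * (1 - e * z)))
    = (z^2 - 1) * ((1 - a * b) * (1 - a * c) * (1 - a * d) * (1 - a * e) * (1 - A * z) * (z - A)
      - (1 - a * c * d * e) * (1 - a * b * d * e) * (1 - a * b * c * e) * (1 - a * b * c * d) * (1 - a * z) * (z - a)) * z"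
    unfolding p1 p2 p3 p4 A'
    using nr_poly_identity[of a u z r s t] by (simp add: power2_eq_square mult.assoc)
  show ?thesis unfolding 1 2 3 4[symmetric]
    by (simp add: diff_divide_distrib right_diff_distrib)
qed

context nome
begin

text \<open>
  The usual numerator \<open>(z\<^sup>2)\<^sub>\<infinity> (z\<^sup>-\<^sup>2)\<^sub>\<infinity>\<close> is written as \<open>(1 - z\<^sup>-\<^sup>2) \<theta>(z\<^sup>2)\<close>.
\<close>

definition nr_integrand where
  "nr_integrand a b c d e z = (1 - 1 / z\<^sup>2) * theta (z\<^sup>2) * pocpm (a * b * c * d * e) z /
     (pocpm a z * pocpm b z * pocpm c z * pocpm d z * pocpm e z)"

text \<open>
  The function \<open>F\<close> with \<open>F(z) - F(qz)\<close> a combination of two integrands. Compared with \<open>nr_integrand\<close> every \<open>a / z\<close> is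
  replaced by \<open>q a / z\<close>, which removes the poles at \<open>z = a\<close>.
\<close>

definition nr_potential where
  "nr_potential a b c d e z = z * theta (z\<^sup>2) * (poc (a * b * c * d * e * z) * poc (q * (a * b * c * d * e / z))) /
     (poc (a * z) * poc (q * (a / z)) * (poc (b * z) * poc (q * (b / z))) * (poc (c * z) * poc (q * (c / z))) *
      (poc (d * z) * poc (q * (d / z))) * (poc (e * z) * poc (q * (e / z))))"

lemma nr_integrand_difference:
  assumes z: "z \<in> regular_at {a, b, c, d, e}"
  shows "a * (1 - a * (a * b * c * d * e)) * (nr_potential a b c d e z - nr_potential a b c d e (q * z)) =
     (1 - a * b) * (1 - a * c) * (1 - a * d) * (1 - a * e) * nr_integrand a b c d e z
     - (1 - a * c * d * e) * (1 - a * b * d * e) * (1 - a * b * c * e) * (1 - a * b * c * d) * nr_integrand (q * a) b c d e z"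
proof -
  define A where "A = a * b * c * d * e"
  have z0: "z \<noteq> 0" using z by (simp add: regular_at_def)
  have nz: "pocpm a z \<noteq> 0" "pocpm b z \<noteq> 0" "pocpm c z \<noteq> 0" "pocpm d z \<noteq> 0" "pocpm e z \<noteq> 0"
    using z by (auto simp: regular_at_pocpm)
  have r1: "poc (x * z) * poc (q * (x / z)) = pocpm x z / (1 - x / z)" if "pocpm x z \<noteq> 0" for x
    using that poc_rec[of "x / z"] by (auto simp: pocpm_def)
  have r2: "poc (x * (q * z)) * poc (q * (x / (q * z))) = pocpm x z / (1 - x * z)" if "pocpm x z \<noteq> 0" for x
    using that poc_rec[of "x * z"] by (auto simp: pocpm_def mult_ac)
  have r3: "pocpm (q * a) z = pocpm a z / ((1 - a * z) * (1 - a / z))"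
    using nz(1) poc_rec[of "a * z"] poc_rec[of "a / z"] by (auto simp: pocpm_def mult_ac)
  have r4: "pocpm A z = ((1 - A * z) * (1 - A / z)) * (poc (q * (A * z)) * poc (q * (A / z)))"
    using poc_rec[of "A * z"] poc_rec[of "A / z"] by (simp add: pocpm_def mult_ac)
  have A': "q * a * b * c * d * e = q * A" by (simp add: A_def mult_ac)
  have r5: "pocpm (q * A) z = poc (q * (A * z)) * poc (q * (A / z))"
    by (simp add: pocpm_def mult_ac)
  define Y where "Y = theta (z\<^sup>2) * (poc (q * (A * z)) * poc (q * (A / z))) /
     (pocpm a z * pocpm b z * pocpm c z * pocpm d z * pocpm e z)"
  have F1: "nr_potential a b c d e z = Y * (z * (1 - A * z) *
      ((1 - a / z) * (1 - b / z) * (1 - c / z) * (1 - d / z) * (1 - e / z)))"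
    unfolding nr_potential_def A_def[symmetric] r1[OF nz(1)] r1[OF nz(2)] r1[OF nz(3)] r1[OF nz(4)] r1[OF nz(5)] Y_def
    using poc_rec[of "A * z"] by (simp add: mult_ac)
  have "q * z * (theta (z\<^sup>2) / (q * z ^ 4)) = theta (z\<^sup>2) * (1 / z ^ 3)"
    using z0 by (simp add: eval_nat_numeral)
  then have F2: "nr_potential a b c d e (q * z) = Y * (1 / z ^ 3 * (1 - A / z) *
      ((1 - a * z) * (1 - b * z) * (1 - c * z) * (1 - d * z) * (1 - e * z)))"
    unfolding nr_potential_def A_def[symmetric] r2[OF nz(1)] r2[OF nz(2)] r2[OF nz(3)] r2[OF nz(4)] r2[OF nz(5)]
       theta_sq_shift[OF z0] Y_def
    using poc_rec[of "A / z"] by (simp add: mult_ac)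
  have N1: "nr_integrand a b c d e z = Y * ((1 - 1 / z\<^sup>2) * ((1 - A * z) * (1 - A / z)))"
    unfolding nr_integrand_def A_def[symmetric] r4 Y_def by (simp add: mult_ac)
  have N2: "nr_integrand (q * a) b c d e z = Y * ((1 - 1 / z\<^sup>2) * ((1 - a * z) * (1 - a / z)))"
    unfolding nr_integrand_def A' r3 r5 Y_def by (simp add: mult_ac)
  have g1: "m * (Y * P - Y * Q) = Y * (m * (P - Q))" for m P Q by (simp only: right_diff_distrib mult_ac)
  have g2: "Y * (V * (k * N - l * M)) = k * (Y * (V * N)) - l * (Y * (V * M))" for V k l N M
    by (simp only: right_diff_distrib mult_ac)
  show ?thesis
    unfolding A_def[symmetric] F1 F2 g1 nr_rational_identity[OF z0 A_def] g2 N1 N2 ..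
qed

lemma nr_integrand_holo: "(\<lambda>z. nr_integrand a b c d e z / z) holomorphic_on regular_at {a, b, c, d, e}"
  unfolding nr_integrand_def by (intro holomorphic_intros) (auto simp: regular_at_pocpm)

definition nr_integral where
  "nr_integral g a b c d e = contour_integral g (\<lambda>z. nr_integrand a b c d e z / z)"

lemma separating_mult_q:
  assumes "separating {a, b, c, d, e} g" shows "separating {q * a, b, c, d, e} g"
proof (rule separating_subset[OF assms])
  fix x assume "x \<in> {q * a, b, c, d, e}"
  then consider "x = a * q ^ 1" | "x \<in> {b, c, d, e}" by auto
  then show "\<exists>y\<in>{a, b, c, d, e}. \<exists>k. x = y * q ^ k"
  proof cases
    case 2
    then show ?thesis by (intro bexI[of _ x] exI[of _ 0]) auto
  qed blast
qed

lemma nr_integral_contiguous: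
  assumes g: "separating {a, b, c, d, e} g" and nz: "0 \<notin> {a, b, c, d, e}"
  shows "(1 - a * b) * (1 - a * c) * (1 - a * d) * (1 - a * e) * nr_integral g a b c d e =
     (1 - a * c * d * e) * (1 - a * b * d * e) * (1 - a * b * c * e) * (1 - a * b * c * d) * nr_integral g (q * a) b c d e"
    (is "?k * _ = ?l * _")
proof -
  let ?S = "{a, b, c, d, e}"
  let ?m = "a * (1 - a * (a * b * c * d * e))"
  let ?F = "\<lambda>z. ?m * nr_potential a b c d e z"
  have fin: "finite ?S" by simp
  \<comment> \<open>The integrals of \<open>F z\<close> and \<open>F (q z)\<close> agree, so the difference formula integrates to 0.\<close>
  have "?F holomorphic_on {z. z \<noteq> 0 \<and> (\<forall>a\<in>?S. poc (a * z) \<noteq> 0 \<and> poc (q * a / z) \<noteq> 0)}"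
    unfolding nr_potential_def by (intro holomorphic_intros) auto
  from separating_shift_integral[OF fin nz g this]
  have 1: "contour_integral g (\<lambda>z. ?F (q * z) / z) = contour_integral g (\<lambda>z. ?F z / z)" .
  have r1: "poc (x * z) \<noteq> 0 \<and> poc (q * (x / z)) \<noteq> 0" if "z \<in> regular_at ?S" "x \<in> ?S" for x z
  proof -
    have "poc (x * z) \<noteq> 0" "poc (x / z) \<noteq> 0" using that unfolding regular_at_def by blast+
    then show ?thesis using poc_mult_q_nz[of "x / z"] by blast
  qed
  have r2: "poc (x * (q * z)) \<noteq> 0 \<and> poc (q * (x / (q * z))) \<noteq> 0" if "z \<in> regular_at ?S" "x \<in> ?S" for x z
  proof -
    have "poc (x * z) \<noteq> 0" "poc (x / z) \<noteq> 0" using that unfolding regular_at_def by blast+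
    moreover have "x * (q * z) = q * (x * z)" "q * (x / (q * z)) = x / z" by simp_all
    ultimately show ?thesis using poc_mult_q_nz[of "x * z"] by metis
  qed
  have r0: "z \<noteq> 0" if "z \<in> regular_at ?S" for z using that unfolding regular_at_def by blast
  have holF: "(\<lambda>z. ?F z / z) holomorphic_on regular_at ?S"
    unfolding nr_potential_def by (intro holomorphic_intros) (use r0 r1 in \<open>simp_all\<close>)
  have holF': "(\<lambda>z. ?F (q * z) / z) holomorphic_on regular_at ?S"
    unfolding nr_potential_def by (intro holomorphic_intros) (use r0 r2 in \<open>simp_all\<close>)
  note int = separating_integrable[OF g nz fin]
  have hol2: "(\<lambda>z. nr_integrand (q * a) b c d e z / z) holomorphic_on regular_at ?S"
  proof (rule holomorphic_on_subset[OF nr_integrand_holo])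
    show "regular_at ?S \<subseteq> regular_at {q * a, b, c, d, e}"
    proof
      fix z assume z: "z \<in> regular_at ?S"
      have "poc (q * a * z) \<noteq> 0 \<and> poc (q * a / z) \<noteq> 0"
        using r0[OF z] r1[OF z, of a] z poc_mult_q_nz[of "a * z"] by (simp add: mult.assoc)
      then show "z \<in> regular_at {q * a, b, c, d, e}" using z by (simp add: regular_at_def)
    qed
  qed
  have "contour_integral g (\<lambda>z. ?F z / z - ?F (q * z) / z) = 0"
    using contour_integral_diff[OF int[OF holF] int[OF holF']] 1 by simp
  moreover have "contour_integral g (\<lambda>z. ?F z / z - ?F (q * z) / z) =
     contour_integral g (\<lambda>z. ?k * (nr_integrand a b c d e z / z) - ?l * (nr_integrand (q * a) b c d e z / z))"
  proof (rule contour_integral_cong[OF refl])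
    fix z assume "z \<in> path_image g"
    then have z: "z \<in> regular_at ?S" using separating_path_props[OF g nz] by blast
    have "?F z / z - ?F (q * z) / z = ?m * (nr_potential a b c d e z - nr_potential a b c d e (q * z)) / z"
      by (simp only: right_diff_distrib diff_divide_distrib)
    also have "\<dots> = ?k * (nr_integrand a b c d e z / z) - ?l * (nr_integrand (q * a) b c d e z / z)"
      unfolding nr_integrand_difference[OF z] by (simp add: diff_divide_distrib)
    finally show "?F z / z - ?F (q * z) / z = ?k * (nr_integrand a b c d e z / z) - ?l * (nr_integrand (q * a) b c d e z / z)" .
  qed
  moreover have "contour_integral g (\<lambda>z. ?k * (nr_integrand a b c d e z / z) - ?l * (nr_integrand (q * a) b c d e z / z)) =
     ?k * nr_integral g a b c d e - ?l * nr_integral g (q * a) b c d e"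
    unfolding nr_integral_def by (rule contour_integral_lincomb) (intro int nr_integrand_holo hol2)+
  ultimately show ?thesis by simp
qed

text \<open>
  Multiplication by the denominator of the expected value turns the recurrence into one whose coefficients
  are all of the form \<open>1 - p\<close>, so that zeros of these factors need no attention.
\<close>

definition nr_scaled where
  "nr_scaled g a b c d e = nr_integral g a b c d e *
     (poc (a * b) * poc (a * c) * poc (a * d) * poc (a * e)) *
     (poc (b * c) * poc (b * d) * poc (b * e) * poc (c * d) * poc (c * e) * poc (d * e))"

lemma nr_scaled_rotate: "nr_scaled g a b c d e = nr_scaled g b c d e a"
proof -
  have "nr_integrand a b c d e = nr_integrand b c d e a" unfolding nr_integrand_def by (intro ext) (simp add: mult_ac)
  then have "nr_integral g a b c d e = nr_integral g b c d e a" by (simp add: nr_integral_def)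
  then show ?thesis unfolding nr_scaled_def by (simp add: mult_ac)
qed

text \<open>
  The parameter that has been multiplied by \<open>q\<close> is moved to the end, so that five steps treat all of them.
\<close>

lemma nr_scaled_step:
  assumes g: "separating {a, b, c, d, e} g" and nz: "0 \<notin> {a, b, c, d, e}"
  shows "nr_scaled g a b c d e = (1 - a * c * d * e) * (1 - a * b * d * e) * (1 - a * b * c * e) * (1 - a * b * c * d) *
     nr_scaled g b c d e (q * a)"
proof -
  have p: "poc (a * x) = (1 - a * x) * poc (q * a * x)" for x
    using poc_rec[of "a * x"] by (simp add: mult.assoc)
  have "nr_scaled g a b c d e = ((1 - a * b) * (1 - a * c) * (1 - a * d) * (1 - a * e) * nr_integral g a b c d e) *
     (poc (q * a * b) * poc (q * a * c) * poc (q * a * d) * poc (q * a * e)) *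
     (poc (b * c) * poc (b * d) * poc (b * e) * poc (c * d) * poc (c * e) * poc (d * e))"
    unfolding nr_scaled_def p by (simp only: mult_ac)
  also have "\<dots> = (1 - a * c * d * e) * (1 - a * b * d * e) * (1 - a * b * c * e) * (1 - a * b * c * d) *
     nr_scaled g (q * a) b c d e"
    unfolding nr_integral_contiguous[OF g nz] nr_scaled_def by (simp only: mult_ac)
  finally show ?thesis by (simp only: nr_scaled_rotate[of g "q * a"])
qed

lemma nr_scaled_step5:
  assumes g: "separating {a, b, c, d, e} g" and nz: "0 \<notin> {a, b, c, d, e}"
  shows "nr_scaled g a b c d e = fin_poc (b * c * d * e) 4 * fin_poc (a * c * d * e) 4 * fin_poc (a * b * d * e) 4 *
     fin_poc (a * b * c * e) 4 * fin_poc (a * b * c * d) 4 * nr_scaled g (q * a) (q * b) (q * c) (q * d) (q * e)"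
proof -
  have rot: "{x, y, u, v, w} = {y, u, v, w, x}" for x y u v w :: complex by auto
  have g1: "separating {b, c, d, e, q * a} g"
    using separating_mult_q[OF g] by (subst rot[symmetric])
  then have g2: "separating {c, d, e, q * a, q * b} g"
    using separating_mult_q[OF g1] by (subst rot[symmetric])
  then have g3: "separating {d, e, q * a, q * b, q * c} g"
    using separating_mult_q[OF g2] by (subst rot[symmetric])
  then have g4: "separating {e, q * a, q * b, q * c, q * d} g"
    using separating_mult_q[OF g3] by (subst rot[symmetric])
  have f4: "fin_poc p 4 = (1 - p) * (1 - p * q) * (1 - p * (q * q)) * (1 - p * (q * q * q))" for p
    by (simp add: fin_poc_def eval_nat_numeral mult_ac)
  have n: "0 \<notin> {b, c, d, e, q * a}" "0 \<notin> {c, d, e, q * a, q * b}" "0 \<notin> {d, e, q * a, q * b, q * c}"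
      "0 \<notin> {e, q * a, q * b, q * c, q * d}" using nz by auto
  show ?thesis
    unfolding nr_scaled_step[OF g nz] nr_scaled_step[OF g1 n(1)] nr_scaled_step[OF g2 n(2)] nr_scaled_step[OF g3 n(3)]
      nr_scaled_step[OF g4 n(4)] f4
    by (simp only: mult_ac)
qed

lemma nr_scaled_iterate:
  assumes g: "separating {a, b, c, d, e} g" and nz: "0 \<notin> {a, b, c, d, e}"
  shows "nr_scaled g a b c d e = fin_poc (b * c * d * e) (4 * n) * fin_poc (a * c * d * e) (4 * n) *
     fin_poc (a * b * d * e) (4 * n) * fin_poc (a * b * c * e) (4 * n) * fin_poc (a * b * c * d) (4 * n) *
     nr_scaled g (a * q ^ n) (b * q ^ n) (c * q ^ n) (d * q ^ n) (e * q ^ n)"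
proof (induction n)
  case 0
  then show ?case by (simp add: fin_poc_def)
next
  case (Suc n)
  let ?t = "q ^ n"
  have g': "separating {a * ?t, b * ?t, c * ?t, d * ?t, e * ?t} g"
    by (rule separating_subset[OF g]) blast
  have nz': "0 \<notin> {a * ?t, b * ?t, c * ?t, d * ?t, e * ?t}" using nz by auto
  have "4 * n = n + (n + (n + n))" by simp
  then have t4: "?t * (?t * (?t * ?t)) = q ^ (4 * n)" by (simp only: power_add)
  have m: "x * ?t * (y * ?t) * (u * ?t) * (v * ?t) = x * y * u * v * q ^ (4 * n)" for x y u v
    unfolding t4[symmetric] by (simp only: mult_ac)
  have s: "q * (x * q ^ n) = x * q ^ Suc n" for x by simp
  show ?case
    unfolding Suc.IH nr_scaled_step5[OF g' nz'] m s fin_poc_add4[symmetric] by (simp only: mult_ac)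
qed

lemma pocpm_uniform_limit_1:
  assumes c: "c \<longlonglongrightarrow> 0"
  shows "uniform_limit (sphere 0 1) (\<lambda>n z. pocpm (c n) z) (\<lambda>_. 1) sequentially"
proof -
  have p: "\<forall>\<^sub>F n in sequentially. \<forall>x. norm x = norm (c n) \<longrightarrow> dist (poc x) 1 < e" if e: "e > 0" for e
  proof -
    obtain d where d: "d > 0" "\<And>x. dist x 0 < d \<Longrightarrow> dist (poc x) (poc 0) < e"
      using isCont_poc[of 0] e unfolding continuous_at_eps_delta by (metis dist_norm)
    have "\<forall>\<^sub>F n in sequentially. dist (c n) 0 < d" using c d(1) by (rule tendstoD)
    then show ?thesis by eventually_elim (use d(2) in auto)
  qed
  have "uniform_limit (sphere 0 1) (\<lambda>n z. poc (c n * z)) (\<lambda>_. 1) sequentially"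
  proof (rule uniform_limitI)
    fix e :: real assume "e > 0"
    from p[OF this] show "\<forall>\<^sub>F n in sequentially. \<forall>z\<in>sphere 0 1. dist (poc (c n * z)) 1 < e"
      by eventually_elim (auto simp: norm_mult)
  qed
  moreover have "uniform_limit (sphere 0 1) (\<lambda>n z. poc (c n / z)) (\<lambda>_. 1) sequentially"
  proof (rule uniform_limitI)
    fix e :: real assume "e > 0"
    from p[OF this] show "\<forall>\<^sub>F n in sequentially. \<forall>z\<in>sphere 0 1. dist (poc (c n / z)) 1 < e"
      by eventually_elim (auto simp: norm_divide)
  qed
  ultimately have "uniform_limit (sphere 0 1) (\<lambda>n z. poc (c n * z) * poc (c n / z)) (\<lambda>_. 1 * 1) sequentially"
    by (rule uniform_lim_mult) auto
  then show ?thesis by (simp add: pocpm_def)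
qed

text \<open>
  For large \<open>n\<close> the unit circle is an admissible contour, and on it the integrand tends uniformly to
  \<open>(1 - z\<^sup>-\<^sup>2) \<theta>(z\<^sup>2)\<close>.
\<close>

lemma nr_integral_circle_limit:
  assumes nz: "0 \<notin> {a, b, c, d, e}"
  shows "(\<lambda>n. nr_integral (circlepath 0 1) (a * q ^ n) (b * q ^ n) (c * q ^ n) (d * q ^ n) (e * q ^ n))
     \<longlonglongrightarrow> 2 * of_real pi * \<i> * (2 / poc q)"
    and "\<forall>\<^sub>F n in sequentially. separating {a * q ^ n, b * q ^ n, c * q ^ n, d * q ^ n, e * q ^ n} (circlepath 0 1)"
proof -
  have t0: "(\<lambda>n. x * q ^ n) \<longlonglongrightarrow> 0" for x
    using tendsto_mult[OF tendsto_const q_power_to_0, of x] by simp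
  have ev: "\<forall>\<^sub>F n in sequentially. norm (x * q ^ n) < 1" for x
    using tendstoD[OF t0[of x], of 1] by simp
  show sep: "\<forall>\<^sub>F n in sequentially. separating {a * q ^ n, b * q ^ n, c * q ^ n, d * q ^ n, e * q ^ n} (circlepath 0 1)"
    using ev[of a] ev[of b] ev[of c] ev[of d] ev[of e]
    by eventually_elim (use nz in \<open>auto intro!: separating_circle\<close>)
  let ?A = "\<lambda>n. a * q ^ n * (b * q ^ n) * (c * q ^ n) * (d * q ^ n) * (e * q ^ n)"
  have tA: "?A \<longlonglongrightarrow> 0"
    using tendsto_mult[OF tendsto_mult[OF tendsto_mult[OF tendsto_mult[OF t0[of a] t0[of b]] t0[of c]] t0[of d]] t0[of e]]
    by simp
  note u = pocpm_uniform_limit_1[OF t0]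
  let ?D = "\<lambda>n z. pocpm (a * q ^ n) z * pocpm (b * q ^ n) z * pocpm (c * q ^ n) z * pocpm (d * q ^ n) z * pocpm (e * q ^ n) z"
  have "uniform_limit (sphere 0 1) ?D (\<lambda>_. 1 * 1 * 1 * 1 * 1) sequentially"
    by (intro uniform_lim_mult u) auto
  then have "uniform_limit (sphere 0 1) (\<lambda>n z. pocpm (?A n) z / ?D n z) (\<lambda>_. 1 / 1) sequentially"
    by (intro uniform_lim_divide[where b = 1] pocpm_uniform_limit_1[OF tA]) auto
  then have "uniform_limit (sphere 0 1) (\<lambda>n z. (1 - 1 / z\<^sup>2) * theta (z\<^sup>2) / z * (pocpm (?A n) z / ?D n z))
     (\<lambda>z. (1 - 1 / z\<^sup>2) * theta (z\<^sup>2) / z * (1 / 1)) sequentially"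
    unfolding qtheta_def
    by (intro uniform_lim_mult uniform_limit_const uniform_bounded_circle continuous_intros) auto
  then have ul: "uniform_limit (sphere 0 1)
     (\<lambda>n z. nr_integrand (a * q ^ n) (b * q ^ n) (c * q ^ n) (d * q ^ n) (e * q ^ n) z / z)
     (\<lambda>z. (1 - 1 / z\<^sup>2) * theta (z\<^sup>2) / z) sequentially"
    by (simp add: nr_integrand_def mult_ac)
  have int: "\<forall>\<^sub>F n in sequentially. (\<lambda>z. nr_integrand (a * q ^ n) (b * q ^ n) (c * q ^ n) (d * q ^ n) (e * q ^ n) z / z)
     contour_integrable_on circlepath 0 1"
    using sep by eventually_elim (rule separating_integrable[OF _ _ _ nr_integrand_holo], use nz in auto)
  show "(\<lambda>n. nr_integral (circlepath 0 1) (a * q ^ n) (b * q ^ n) (c * q ^ n) (d * q ^ n) (e * q ^ n))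
     \<longlonglongrightarrow> 2 * of_real pi * \<i> * (2 / poc q)"
    unfolding nr_integral_def theta_circle_integral[symmetric]
    by (rule contour_integral_uniform_limit_circlepath(2)[OF int ul]) auto
qed

text \<open>
  Iterate the recurrence and let all parameters tend to 0.
\<close>

theorem nassrallah_rahman:
  assumes g: "separating {a, b, c, d, e} g" and nz: "0 \<notin> {a, b, c, d, e}"
  shows "nr_scaled g a b c d e = 2 * of_real pi * \<i> * (2 / poc q) *
     (poc (b * c * d * e) * poc (a * c * d * e) * poc (a * b * d * e) * poc (a * b * c * e) * poc (a * b * c * d))"
proof -
  let ?K = "2 * of_real pi * \<i> * (2 / poc q)"
  have "(\<lambda>n. nr_integral g (a * q ^ n) (b * q ^ n) (c * q ^ n) (d * q ^ n) (e * q ^ n)) \<longlonglongrightarrow> ?K"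
  proof (rule Lim_transform_eventually[OF nr_integral_circle_limit(1)[OF nz]])
    show "\<forall>\<^sub>F n in sequentially.
       nr_integral (circlepath 0 1) (a * q ^ n) (b * q ^ n) (c * q ^ n) (d * q ^ n) (e * q ^ n) =
       nr_integral g (a * q ^ n) (b * q ^ n) (c * q ^ n) (d * q ^ n) (e * q ^ n)"
      using nr_integral_circle_limit(2)[OF nz]
    proof eventually_elim
      case (elim n)
      have "separating {a * q ^ n, b * q ^ n, c * q ^ n, d * q ^ n, e * q ^ n} g"
        by (rule separating_subset[OF g]) blast
      then show ?case unfolding nr_integral_def
        by (intro separating_integral_eq[OF _ _ nr_integrand_holo elim]) (use nz in auto)
    qed
  qed
  moreover have pp: "(\<lambda>n. poc (x * q ^ n * (y * q ^ n))) \<longlonglongrightarrow> 1" for x y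
  proof -
    have "(\<lambda>n. x * q ^ n * (y * q ^ n)) \<longlonglongrightarrow> x * 0 * (y * 0)"
      by (intro tendsto_intros q_power_to_0)
    then show ?thesis using isCont_tendsto_compose[OF isCont_poc] by fastforce
  qed
  ultimately have X: "(\<lambda>n. nr_scaled g (a * q ^ n) (b * q ^ n) (c * q ^ n) (d * q ^ n) (e * q ^ n)) \<longlonglongrightarrow>
     ?K * (1 * 1 * 1 * 1) * (1 * 1 * 1 * 1 * 1 * 1)"
    unfolding nr_scaled_def by (intro tendsto_intros)
  have "(\<lambda>n. fin_poc (b * c * d * e) (4 * n) * fin_poc (a * c * d * e) (4 * n) *
     fin_poc (a * b * d * e) (4 * n) * fin_poc (a * b * c * e) (4 * n) * fin_poc (a * b * c * d) (4 * n) *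
     nr_scaled g (a * q ^ n) (b * q ^ n) (c * q ^ n) (d * q ^ n) (e * q ^ n)) \<longlonglongrightarrow>
     poc (b * c * d * e) * poc (a * c * d * e) * poc (a * b * d * e) * poc (a * b * c * e) * poc (a * b * c * d) *
     (?K * (1 * 1 * 1 * 1) * (1 * 1 * 1 * 1 * 1 * 1))"
    by (intro tendsto_mult fin_poc_tendsto X)
  then have "(\<lambda>n. nr_scaled g a b c d e) \<longlonglongrightarrow>
     poc (b * c * d * e) * poc (a * c * d * e) * poc (a * b * d * e) * poc (a * b * c * e) * poc (a * b * c * d) *
     (?K * (1 * 1 * 1 * 1) * (1 * 1 * 1 * 1 * 1 * 1))"
    by (simp only: nr_scaled_iterate[OF g nz, symmetric])
  then show ?thesis using LIMSEQ_unique[OF tendsto_const] by (simp add: mult_ac)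
qed

section \<open>The integral with six parameters\<close>

definition pocpm6 where
  "pocpm6 a b c d e f z = pocpm a z * pocpm b z * pocpm c z * pocpm d z * pocpm e z * pocpm f z"

definition pair_pocs where
  "pair_pocs a b c d e f = poc (a * b) * poc (a * c) * poc (a * d) * poc (a * e) * poc (a * f) *
     (poc (b * c) * poc (b * d) * poc (b * e) * poc (b * f)) *
     (poc (c * d) * poc (c * e) * poc (c * f)) * (poc (d * e) * poc (d * f)) * poc (e * f)"

text \<open>
  The integral of the theorem for \<open>f = 1\<close>, without \<open>1 / (2 \<pi> \<i>)\<close> and with a general numerator \<open>\<Phi>\<close>;
  \<open>(1 - z\<^sup>-\<^sup>2) / z\<close> is \<open>(z - z\<^sup>-\<^sup>1) / z\<^sup>2\<close>.
\<close>

definition integral6 where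
  "integral6 g a b c d e f \<Phi> = contour_integral g (\<lambda>z. (1 - 1 / z\<^sup>2) / z * \<Phi> z / pocpm6 a b c d e f z / z)"

text \<open>
  The theta functions in \<open>chi f\<close> cancel the factor belonging to \<open>f\<close> and leave \<open>(q z\<^sup>\<plusminus> / f)\<^sub>\<infinity>\<close>. As \<open>q / f = a b c d e\<close>, this is
  the Nassrallah-Rahman integral.
\<close>

lemma integral6_chi:
  assumes g: "separating {a, b, c, d, e, f} g" and prod: "a * b * c * d * e * f = q"
  shows "integral6 g a b c d e f (chi f) * (poc q * pair_pocs a b c d e f) = 2 * of_real pi * \<i> * 2 *
     (theta (f * a) * theta (f * b) * theta (f * c) * theta (f * d) * theta (f * e))"
proof -
  have nz: "a \<noteq> 0" "b \<noteq> 0" "c \<noteq> 0" "d \<noteq> 0" "e \<noteq> 0" "f \<noteq> 0"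
    using prod q_nz by auto
  have g5: "separating {a, b, c, d, e} g"
    by (rule separating_subset[OF g]) (metis insertCI mult.right_neutral power_0 insertE singletonD)
  have qf: "q / f = a * b * c * d * e" using prod nz by (simp add: field_simps)
  have "integral6 g a b c d e f (chi f) = nr_integral g a b c d e"
    unfolding integral6_def nr_integral_def
  proof (rule contour_integral_cong[OF refl])
    fix z assume "z \<in> path_image g"
    then have z: "z \<in> regular_at {a, b, c, d, e, f}" using separating_regular[OF g] nz by auto
    then have z0: "z \<noteq> 0" "pocpm f z \<noteq> 0" by (auto simp: regular_at_pocpm)
    show "(1 - 1 / z\<^sup>2) / z * chi f z / pocpm6 a b c d e f z / z = nr_integrand a b c d e z / z"
      unfolding chi_def theta_pocpm[OF z0(1) nz(6)] qf pocpm6_def nr_integrand_def using z0 by (simp add: mult_ac)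
  qed
  moreover have "theta (f * x) = poc (f * x) * poc (q / f / x)" for x by (simp add: qtheta_def)
  then have t: "theta (f * a) = poc (f * a) * poc (b * c * d * e)" "theta (f * b) = poc (f * b) * poc (a * c * d * e)"
    "theta (f * c) = poc (f * c) * poc (a * b * d * e)" "theta (f * d) = poc (f * d) * poc (a * b * c * e)"
    "theta (f * e) = poc (f * e) * poc (a * b * c * d)"
    unfolding qf using nz by (simp_all add: mult.assoc)
  have "nr_scaled g a b c d e * poc q = 2 * of_real pi * \<i> * 2 *
     (poc (b * c * d * e) * poc (a * c * d * e) * poc (a * b * d * e) * poc (a * b * c * e) * poc (a * b * c * d))"
    using nassrallah_rahman[OF g5] nz poc_q_nz by simp
  ultimately show ?thesis unfolding t nr_scaled_def pair_pocs_def
    by (simp add: mult_ac)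
qed

lemma integral6_swap: "integral6 g a b c d e f = integral6 g a b c d f e"
  unfolding integral6_def pocpm6_def by (intro ext) (simp add: mult_ac)

lemma pair_pocs_swap: "pair_pocs a b c d e f = pair_pocs a b c d f e"
  unfolding pair_pocs_def by (simp add: mult_ac)

lemma integral6_holo:
  assumes "\<Phi> holomorphic_on - {0}"
  shows "(\<lambda>z. (1 - 1 / z\<^sup>2) / z * \<Phi> z / pocpm6 a b c d e f z) holomorphic_on regular_at {a, b, c, d, e, f}"
  unfolding pocpm6_def
  by (intro holomorphic_intros holomorphic_on_subset[OF assms]) (auto simp: regular_at_pocpm)

lemma integral6_integrable:
  assumes "separating {a, b, c, d, e, f} g" "0 \<notin> {a, b, c, d, e, f}" "\<Phi> holomorphic_on - {0}"
  shows "(\<lambda>z. (1 - 1 / z\<^sup>2) / z * \<Phi> z / pocpm6 a b c d e f z / z) contour_integrable_on g"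
  by (rule separating_integrable[OF assms(1,2) _ holomorphic_on_divide[OF integral6_holo[OF assms(3)] holomorphic_on_ident]])
     (simp_all add: regular_at_def)

lemma integral6_lincomb:
  assumes "separating {a, b, c, d, e, f} g" "0 \<notin> {a, b, c, d, e, f}"
    "\<Phi> holomorphic_on - {0}" "\<Psi> holomorphic_on - {0}"
  shows "integral6 g a b c d e f (\<lambda>z. k * \<Phi> z + l * \<Psi> z) = k * integral6 g a b c d e f \<Phi> + l * integral6 g a b c d e f \<Psi>"
proof -
  have "integral6 g a b c d e f (\<lambda>z. k * \<Phi> z + l * \<Psi> z) = contour_integral g
    (\<lambda>z. k * ((1 - 1 / z\<^sup>2) / z * \<Phi> z / pocpm6 a b c d e f z / z) - (- l) * ((1 - 1 / z\<^sup>2) / z * \<Psi> z / pocpm6 a b c d e f z / z))"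
    unfolding integral6_def by (simp add: distrib_left add_divide_distrib mult_ac)
  also have "\<dots> = k * integral6 g a b c d e f \<Phi> - (- l) * integral6 g a b c d e f \<Psi>"
    unfolding integral6_def by (intro contour_integral_lincomb integral6_integrable assms)
  finally show ?thesis by simp
qed

lemma integral6_cong:
  assumes "separating {a, b, c, d, e, f} g" "\<And>z. z \<noteq> 0 \<Longrightarrow> \<Phi> z = \<Psi> z"
  shows "integral6 g a b c d e f \<Phi> = integral6 g a b c d e f \<Psi>"
  unfolding integral6_def
  by (rule contour_integral_cong[OF refl]) (use assms in \<open>auto simp: separating_def\<close>)

lemma theta_product_holo:
  assumes "0 \<notin> {a, b, c, d, e, f}"
  shows "theta_product a b c d e f holomorphic_on - {0}" "(\<lambda>z. theta_product a b c d e f (1 / z)) holomorphic_on - {0}"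
  unfolding theta_product_def using assms by (auto intro!: holomorphic_intros)

text \<open>
  The complementary part gives an integrand that is antisymmetric under \<open>z \<mapsto> 1/z\<close>.
\<close>

lemma integral6_antisym_part:
  assumes g: "separating {a, b, c, d, e, f} g" and nz: "0 \<notin> {a, b, c, d, e, f}" "0 \<notin> {l, m, n, r, s, t}"
  shows "integral6 g a b c d e f (theta_product l m n r s t) = 1 / 2 * integral6 g a b c d e f (antisym_part l m n r s t)"
proof -
  let ?A = "{a, b, c, d, e, f}"
  let ?p = "theta_product l m n r s t" and ?P = "antisym_part l m n r s t"
  define S where "S z = ?p z + z ^ 4 * ?p (1 / z)" for z
  have hS: "S holomorphic_on - {0}" unfolding S_def by (intro holomorphic_intros theta_product_holo nz(2))
  have hP: "?P holomorphic_on - {0}" unfolding antisym_part_def by (intro holomorphic_intros theta_product_holo nz(2))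
  have "integral6 g a b c d e f S = 0" unfolding integral6_def
  proof (rule separating_antisymmetric_integral[OF _ nz(1) g integral6_holo[OF hS]])
    fix z assume z: "z \<in> regular_at ?A"
    then have z0: "z \<noteq> 0" by (simp add: regular_at_def)
    have "S (1 / z) = S z / z ^ 4" unfolding S_def using z0 by (simp add: add_divide_distrib power_divide)
    moreover have "pocpm6 a b c d e f (1 / z) = pocpm6 a b c d e f z"
      unfolding pocpm6_def pocpm_def by (simp add: mult_ac)
    moreover have "(1 - 1 / (1 / z)\<^sup>2) / (1 / z) * (X / z ^ 4) = - ((1 - 1 / z\<^sup>2) / z * X)" for X
    proof -
      have "(1 - 1 / (1 / z)\<^sup>2) / (1 / z) / z ^ 4 = - ((1 - 1 / z\<^sup>2) / z)"
        using z0 by (simp add: power_divide divide_simps) (simp add: power_numeral_reduce algebra_simps)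
      then show ?thesis by (metis mult_minus_left times_divide_eq_left times_divide_eq_right)
    qed
    ultimately show "(1 - 1 / (1 / z)\<^sup>2) / (1 / z) * S (1 / z) / pocpm6 a b c d e f (1 / z) =
      - ((1 - 1 / z\<^sup>2) / z * S z / pocpm6 a b c d e f z)"
      by (simp only: minus_divide_left)
  qed simp
  moreover have "integral6 g a b c d e f ?p = integral6 g a b c d e f (\<lambda>z. 1 / 2 * S z + 1 / 2 * ?P z)"
    by (rule integral6_cong[OF g]) (simp add: S_def antisym_part_def field_simps)
  ultimately show ?thesis by (simp only: integral6_lincomb[OF g nz(1) hS hP] mult_zero_right add_0_left)
qed

text \<open>
  The right side is the expression in braces in \<open>C\<close>.
\<close>

lemma antisym_part_eq_C_numerator:
  assumes prod: "a * b * c * d * e * f = q" and x: "x \<noteq> 0"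
  shows "antisym_part a b c d e f x = theta (x * a) * theta (x * b) * theta (x * c) * theta (x * d) * theta (x * e) * theta (x * f)
     - q * x powi (-2) * (theta (x / a) * theta (x / b) * theta (x / c) * theta (x / d) * theta (x / e) * theta (x / f))"
proof -
  have nz: "a \<noteq> 0" "b \<noteq> 0" "c \<noteq> 0" "d \<noteq> 0" "e \<noteq> 0" "f \<noteq> 0"
    using prod q_nz by auto
  have "q * x powi (-2) * (theta (x / a) * theta (x / b) * theta (x / c) * theta (x / d) * theta (x / e) * theta (x / f)) =
     q / x\<^sup>2 * (x ^ 6 / (a * b * c * d * e * f)) * theta_product a b c d e f (1 / x)"
    unfolding theta_product_def theta_inverse'[OF x nz(1)] theta_inverse'[OF x nz(2)] theta_inverse'[OF x nz(3)]
      theta_inverse'[OF x nz(4)] theta_inverse'[OF x nz(5)] theta_inverse'[OF x nz(6)]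
    by (simp add: power_int_minus divide_inverse power_numeral_reduce mult_ac)
  also have "\<dots> = x ^ 4 * theta_product a b c d e f (1 / x)"
    unfolding prod using x by (simp add: eval_nat_numeral)
  finally show ?thesis unfolding antisym_part_def theta_product_def by (simp add: mult.commute[of x])
qed

definition antisym_quot where
  "antisym_quot a b c d e f x = antisym_part a b c d e f x / theta (x\<^sup>2)"

text \<open>
  Write \<open>\<Phi>\<^sub>\<lambda>\<close> and \<open>\<Phi>\<^sub>b\<close> for the antisymmetric parts with parameters \<open>l, \<dots>, t\<close> and \<open>a, \<dots>, f\<close>. Expanding
  \<open>\<Phi>\<^sub>\<lambda>\<close> in \<open>chi e\<close> and \<open>chi f\<close> expresses the integral by the values of \<open>\<Phi>\<^sub>\<lambda>\<close> at \<open>e\<close> and \<open>f\<close>. Expanding \<open>\<Phi>\<^sub>b\<close> in the same two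
  functions and \<open>\<Phi>\<^sub>\<lambda>\<close> in \<open>chi l\<close> and \<open>chi m\<close> brings the right side to the same form.
\<close>

lemma integral6_eval:
  assumes g: "separating {a, b, c, d, e, f} g" and prod: "a * b * c * d * e * f = q"
    and gen: "theta (e\<^sup>2) \<noteq> 0" "theta (f\<^sup>2) \<noteq> 0" "theta (e * f) \<noteq> 0" "theta (e / f) \<noteq> 0"
    and pair_pocs: "pair_pocs a b c d e f \<noteq> 0"
    and lprod: "l * m * n * r * s * t = q"
    and lgen: "theta (l\<^sup>2) \<noteq> 0" "theta (m\<^sup>2) \<noteq> 0" "theta (l / m) \<noteq> 0"
  shows "integral6 g a b c d e f (antisym_part l m n r s t) * (poc q * pair_pocs a b c d e f) = 2 * of_real pi * \<i> * 2 *
     (interp_coeff l m n r s t * antisym_quot a b c d e f l + interp_coeff m l n r s t * antisym_quot a b c d e f m)"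
proof -
  have nz: "a \<noteq> 0" "b \<noteq> 0" "c \<noteq> 0" "d \<noteq> 0" "e \<noteq> 0" "f \<noteq> 0"
    using prod q_nz by auto
  have lnz: "l \<noteq> 0" "m \<noteq> 0" using lprod q_nz by auto
  let ?P = "antisym_part l m n r s t"
  let ?K = "2 * of_real pi * \<i> * 2 :: complex"
  have nz': "0 \<notin> {a, b, c, d, e, f}" using nz by auto
  have "{a, b, c, d, f, e} = {a, b, c, d, e, f}" by auto
  then have g': "separating {a, b, c, d, f, e} g" using g by (simp only:)
  have prod': "a * b * c * d * f * e = q" using prod by (simp add: mult_ac)
  have prod'': "e * f * a * b * c * d = q" using prod by (simp add: mult_ac)
  have fe: "theta (f / e) = - (f / e) * theta (e / f)" by (rule theta_inverse'[OF nz(6,5)])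
  have hc: "chi x holomorphic_on - {0}" if "x \<noteq> 0" for x
    using antisym_theta_chi[OF that] by (simp add: antisym_theta_def)
  have Ge: "integral6 g a b c d e f (chi e) * (poc q * pair_pocs a b c d e f) =
     ?K * (theta (e * a) * theta (e * b) * theta (e * c) * theta (e * d) * theta (e * f))"
    using integral6_chi[OF g' prod'] by (simp add: integral6_swap[of g a b c d f e] pair_pocs_swap[of a b c d f e])
  have Gf: "integral6 g a b c d e f (chi f) * (poc q * pair_pocs a b c d e f) =
     ?K * (theta (f * a) * theta (f * b) * theta (f * c) * theta (f * d) * theta (f * e))"
    by (rule integral6_chi[OF g prod])
  have gq: "\<And>n. e\<^sup>2 \<noteq> q powi n" "\<And>n. f\<^sup>2 \<noteq> q powi n" "\<And>n. e * f \<noteq> q powi n" "\<And>n. e / f \<noteq> q powi n"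
    using gen theta_powi_eq_0 by metis+
  have anti: "antisym_theta ?P" by (rule antisym_theta_antisym_part[OF lprod])
  have "integral6 g a b c d e f ?P = integral6 g a b c d e f (\<lambda>z. ?P f / chi e f * chi e z + ?P e / chi f e * chi f z)"
    by (rule integral6_cong[OF g]) (rule antisym_theta_interpolation[OF anti nz(5,6) gq])
  also have "\<dots> = ?P f / chi e f * integral6 g a b c d e f (chi e) + ?P e / chi f e * integral6 g a b c d e f (chi f)"
    by (rule integral6_lincomb[OF g nz' hc hc]) (use nz in auto)
  finally have "integral6 g a b c d e f ?P * (poc q * pair_pocs a b c d e f) =
     ?P f / chi e f * (integral6 g a b c d e f (chi e) * (poc q * pair_pocs a b c d e f)) +
     ?P e / chi f e * (integral6 g a b c d e f (chi f) * (poc q * pair_pocs a b c d e f))"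
    by (simp only: distrib_right mult.assoc)
  then have L: "integral6 g a b c d e f ?P * (poc q * pair_pocs a b c d e f) = ?K *
     (?P f / chi e f * (theta (e * a) * theta (e * b) * theta (e * c) * theta (e * d) * theta (e * f)) +
      ?P e / chi f e * (theta (f * a) * theta (f * b) * theta (f * c) * theta (f * d) * theta (f * e)))"
    unfolding Ge Gf by (simp only: distrib_left mult_ac)
  \<comment> \<open>Now interpolate \<open>\<Phi>\<^sub>b\<close>, which occurs in \<open>antisym_quot\<close>, at \<open>e, f\<close> and compare: up to sign the roles of
    the two variables of \<open>chi\<close> can be exchanged.\<close>
  define ce where "ce = interp_coeff e f a b c d / theta (e\<^sup>2)"
  define cf where "cf = interp_coeff f e a b c d / theta (f\<^sup>2)"
  have ce: "ce = - (theta (f * a) * theta (f * b) * theta (f * c) * theta (f * d) * theta (f * e)) / chi f e"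
    unfolding ce_def interp_coeff_def chi_def fe using nz gen by (simp add: field_simps)
  have cf: "cf = - (theta (e * a) * theta (e * b) * theta (e * c) * theta (e * d) * theta (e * f)) / chi e f"
    unfolding cf_def interp_coeff_def chi_def fe using nz gen by (simp add: field_simps)
  have H: "antisym_quot a b c d e f x = - ce * chi x e - cf * chi x f"
    if x: "x \<noteq> 0" "theta (x\<^sup>2) \<noteq> 0" for x
  proof -
    have P: "antisym_part a b c d e f x = antisym_part e f a b c d x"
      unfolding antisym_part_def theta_product_def by (simp add: mult_ac)
    have c: "chi y x / theta (x\<^sup>2) = - chi x y / theta (y\<^sup>2)" if "y \<noteq> 0" "theta (y\<^sup>2) \<noteq> 0" for y
      unfolding chi_def theta_inverse'[OF that(1) x(1)] using that x by (simp add: mult.commute[of x y])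
    have "antisym_quot a b c d e f x = interp_coeff e f a b c d * (chi e x / theta (x\<^sup>2)) + interp_coeff f e a b c d * (chi f x / theta (x\<^sup>2))"
      unfolding antisym_quot_def P antisym_part_eq[OF prod'' gen(1,2,4) x(1)] by (simp add: add_divide_distrib)
    then show ?thesis unfolding c[OF nz(5) gen(1)] c[OF nz(6) gen(2)] ce_def cf_def by simp
  qed
  have "interp_coeff l m n r s t * antisym_quot a b c d e f l + interp_coeff m l n r s t * antisym_quot a b c d e f m =
     - ce * (interp_coeff l m n r s t * chi l e + interp_coeff m l n r s t * chi m e)
     - cf * (interp_coeff l m n r s t * chi l f + interp_coeff m l n r s t * chi m f)"
    unfolding H[OF lnz(1) lgen(1)] H[OF lnz(2) lgen(2)] by (simp add: algebra_simps)
  also have "\<dots> = - ce * ?P e - cf * ?P f"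
    unfolding antisym_part_eq[OF lprod lgen nz(5)] antisym_part_eq[OF lprod lgen nz(6)] ..
  also have "\<dots> = ?P f / chi e f * (theta (e * a) * theta (e * b) * theta (e * c) * theta (e * d) * theta (e * f)) +
      ?P e / chi f e * (theta (f * a) * theta (f * b) * theta (f * c) * theta (f * d) * theta (f * e))"
    unfolding ce cf by (simp add: mult_ac add.commute)
  finally show ?thesis unfolding L by simp
qed

end

section \<open>The space \<open>V\<close> and the uniqueness of the functional\<close>

text \<open>
  The numerator of \<open>pm_factor c\<close>; its root is \<open>joukowski c\<close>.
\<close>

definition pm_poly :: "complex \<Rightarrow> complex poly" where "pm_poly c = [:1 + c\<^sup>2, - 2 * c:]"

lemma pm_factor_Fract: "pm_factor c = Fract (pm_poly c) 1"
  by (simp add: pm_factor_def pm_poly_def to_fract_def)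

lemma pm_poly_nz [simp]: "pm_poly c \<noteq> 0"
  by (auto simp: pm_poly_def)

lemma degree_pm_poly_le: "degree (pm_poly c) \<le> 1"
  by (simp add: pm_poly_def)

lemma pm_poly_eq:
  assumes "c \<noteq> 0"
  shows "pm_poly c = smult (- 2 * c) [:- joukowski c, 1:]"
proof -
  have "2 * c * joukowski c = 1 + c\<^sup>2"
    using assms by (simp add: joukowski_def distrib_left power2_eq_square)
  then show ?thesis by (simp add: pm_poly_def)
qed

lemma degree_pm_poly: "c \<noteq> 0 \<Longrightarrow> degree (pm_poly c) = 1"
  by (simp add: pm_poly_def)

lemma poly_pm_poly_joukowski:
  assumes "z \<noteq> 0"
  shows "poly (pm_poly c) (joukowski z) = (1 - c * z) * (1 - c / z)"
proof -
  have "z * inverse z = 1" using assms by simp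
  then have "(1 - c * z) * (1 - c * inverse z) = 1 + c\<^sup>2 - 2 * c * ((z + inverse z) / 2)"
    by (simp add: algebra_simps power2_eq_square)
  then show ?thesis by (simp only: pm_poly_def joukowski_def divide_inverse) (simp add: algebra_simps)
qed

lemma poly_pm_poly_eq_0_iff: "c \<noteq> 0 \<Longrightarrow> poly (pm_poly c) x = 0 \<longleftrightarrow> x = joukowski c"
  by (auto simp: pm_poly_eq)

lemma Fract_prod: "(\<Prod>i\<in>A. Fract (f i) 1) = Fract (\<Prod>i\<in>A. f i) (1 :: 'a :: idom)"
  by (induction A rule: infinite_finite_induct) (simp_all add: One_fract_def)

lemma prod_1_6: "(\<Prod>j=1..(6::nat). f j) = f 1 * f 2 * f 3 * f 4 * f 5 * (f 6 :: 'a::comm_monoid_mult)"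
  by (simp add: numeral_eq_Suc mult_ac)

lemma pairs_1_6: "(\<Prod>i=1..(6::nat). \<Prod>j\<in>{i<..6}. f i j) =
   f 1 2 * f 1 3 * f 1 4 * f 1 5 * f 1 6 * (f 2 3 * f 2 4 * f 2 5 * f 2 6) *
   (f 3 4 * f 3 5 * f 3 6) * (f 4 5 * f 4 6) * (f 5 6 :: 'a::comm_monoid_mult)"
proof -
  have s: "{1<..6} = {2,3,4,5,6::nat}" "{2<..6} = {3,4,5,6::nat}" "{3<..6} = {4,5,6::nat}"
    "{4<..6} = {5,6::nat}" "{5<..6} = {6::nat}" "{6<..6} = ({}::nat set)" by auto
  show ?thesis unfolding prod_1_6 s by (simp add: mult.assoc)
qed

lemma prod_3_6: "(\<Prod>j=3..(6::nat). f j) = f 3 * f 4 * f 5 * (f 6 :: 'a::comm_monoid_mult)"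
  by (simp add: numeral_eq_Suc mult_ac)

lemma prod_powi_sum:
  fixes c :: "'a::field"
  assumes "c \<noteq> 0"
  shows "(\<Prod>j\<in>A. c powi k j) = c powi (\<Sum>j\<in>A. k j)"
  using assms by (induction A rule: infinite_finite_induct) (auto simp: power_int_add)

locale rahman = nome +
  fixes b :: "nat \<Rightarrow> complex"
  assumes b_prod: "(\<Prod>j=1..6. b j) = q"
    and b_quot: "\<And>i j n. 1 \<le> i \<Longrightarrow> i < j \<Longrightarrow> j \<le> 6 \<Longrightarrow> b i / b j \<noteq> q powi n"
    and b_mult: "\<And>i j n. 1 \<le> i \<Longrightarrow> i \<le> j \<Longrightarrow> j \<le> 6 \<Longrightarrow> b i * b j \<noteq> q powi n"

begin

lemma b_nz: "j \<in> {1..6} \<Longrightarrow> b j \<noteq> 0"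
  using b_prod q_nz by (metis finite_atLeastAtMost prod_zero)

lemma b_quot_ne:
  assumes "i \<in> {1..6}" "j \<in> {1..6}" "i \<noteq> j"
  shows "b i \<noteq> b j * q powi n"
proof (cases "i < j")
  case True
  then show ?thesis using b_quot[of i j n] b_nz[of j] assms by auto
next
  case False
  then show ?thesis using b_quot[of j i "- n"] b_nz[of j] b_nz[of i] assms
    by (auto simp: power_int_minus field_simps)
qed

lemma b_mult_ne: "i \<in> {1..6} \<Longrightarrow> j \<in> {1..6} \<Longrightarrow> b i * b j \<noteq> q powi n"
  using b_mult[of i j n] b_mult[of j i n] by (cases "i \<le> j") (auto simp: mult.commute)

text \<open>
  The pair \<open>(j, n)\<close> stands for the possible pole at \<open>z = b\<^sub>j q\<^sup>-\<^sup>n\<close>.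
\<close>

definition pole_point :: "nat \<times> nat \<Rightarrow> complex" where "pole_point s = b (fst s) * q powi (- int (snd s))"

definition pole_poly :: "(nat \<times> nat) set \<Rightarrow> complex poly" where "pole_poly S = (\<Prod>s\<in>S. pm_poly (pole_point s))"

definition pole_set :: "(nat \<times> nat) set \<Rightarrow> bool" where "pole_set S \<longleftrightarrow> finite S \<and> S \<subseteq> {1..6} \<times> {1..}"

lemma pole_set_insert: "pole_set (insert s S) \<longleftrightarrow> fst s \<in> {1..6} \<and> 1 \<le> snd s \<and> pole_set S"
  by (cases s) (auto simp: pole_set_def)

lemma pole_set_subset: "pole_set S \<Longrightarrow> T \<subseteq> S \<Longrightarrow> pole_set T"
  by (auto simp: pole_set_def intro: finite_subset)

lemma pole_set_Un: "pole_set S \<Longrightarrow> pole_set T \<Longrightarrow> pole_set (S \<union> T)"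
  by (auto simp: pole_set_def)

lemma pole_point_nz: "fst s \<in> {1..6} \<Longrightarrow> pole_point s \<noteq> 0"
  using b_nz by (auto simp: pole_point_def)

lemma joukowski_eq_iff: "c \<noteq> 0 \<Longrightarrow> d \<noteq> 0 \<Longrightarrow> joukowski c = joukowski d \<longleftrightarrow> c = d \<or> c * d = 1"
proof -
  assume nz: "c \<noteq> 0" "d \<noteq> 0"
  have "joukowski c = joukowski d \<longleftrightarrow> poly (pm_poly d) (joukowski c) = 0"
    using poly_pm_poly_eq_0_iff[OF nz(2)] by simp
  also have "\<dots> \<longleftrightarrow> 1 - d * c = 0 \<or> 1 - d / c = 0"
    unfolding poly_pm_poly_joukowski[OF nz(1)] by simp
  also have "\<dots> \<longleftrightarrow> c = d \<or> c * d = 1"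
    using nz by (auto simp: mult.commute)
  finally show ?thesis .
qed

text \<open>
  \<open>joukowski\<close> identifies only \<open>z\<close> and \<open>1/z\<close>, so a coincidence would make \<open>b\<^sub>i / b\<^sub>j\<close> or \<open>b\<^sub>i b\<^sub>j\<close> a power of \<open>q\<close>.
\<close>

lemma joukowski_ne:
  assumes "i \<in> {1..6}" "j \<in> {1..6}" "i \<noteq> j \<or> m \<noteq> n"
  shows "joukowski (b i * q powi m) \<noteq> joukowski (b j * q powi n)"
proof
  assume "joukowski (b i * q powi m) = joukowski (b j * q powi n)"
  then consider "b i * q powi m = b j * q powi n" | "b i * q powi m * (b j * q powi n) = 1"
    using joukowski_eq_iff b_nz assms by auto
  then show False
  proof cases
    case 1
    then have "b i = b j * q powi (n - m)" by (simp add: power_int_diff field_simps)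
    then have "i = j" using b_quot_ne assms by blast
    then have "q powi m = q powi n" using 1 b_nz assms by simp
    then show False using q_powi_eq_iff \<open>i = j\<close> assms(3) by auto
  next
    case 2
    then have "b i * b j * q powi (m + n) = 1" by (simp add: power_int_add mult_ac)
    then have "b i * b j = q powi (- (m + n))" by (simp only: power_int_minus) (simp add: field_simps)
    then show False using b_mult_ne assms by blast
  qed
qed

lemma joukowski_pole_point_inj:
  assumes "fst s \<in> {1..6}" "fst t \<in> {1..6}" "joukowski (pole_point s) = joukowski (pole_point t)"
  shows "s = t"
  using joukowski_ne[OF assms(1,2), of "- int (snd s)" "- int (snd t)"] assms(3)
  by (auto simp: pole_point_def intro: prod_eqI)

lemma pole_poly_nz [simp]: "pole_poly S \<noteq> 0"
  by (cases "finite S") (auto simp: pole_poly_def)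

lemma degree_pole_poly: "pole_set S \<Longrightarrow> degree (pole_poly S) = card S"
proof -
  assume S: "pole_set S"
  have "degree (pole_poly S) = (\<Sum>s\<in>S. degree (pm_poly (pole_point s)))"
    unfolding pole_poly_def by (rule degree_prod_eq_sum_degree) auto
  also have "\<dots> = (\<Sum>s\<in>S. 1)"
    using S pole_point_nz by (intro sum.cong[OF refl] degree_pm_poly) (auto simp: pole_set_def)
  finally show ?thesis by simp
qed

lemma pole_poly_insert: "pole_set S \<Longrightarrow> s \<notin> S \<Longrightarrow> pole_poly (insert s S) = pm_poly (pole_point s) * pole_poly S"
  by (simp add: pole_poly_def pole_set_def)

lemma poly_pole_poly_nz:
  assumes "pole_set S" "fst s \<in> {1..6}" "s \<notin> S"
  shows "poly (pole_poly S) (joukowski (pole_point s)) \<noteq> 0"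
proof -
  have "poly (pm_poly (pole_point t)) (joukowski (pole_point s)) \<noteq> 0" if "t \<in> S" for t
  proof -
    have t: "fst t \<in> {1..6}" using that assms(1) by (auto simp: pole_set_def)
    then show ?thesis using poly_pm_poly_eq_0_iff[OF pole_point_nz[OF t]] joukowski_pole_point_inj[OF t assms(2)] assms(3) that
      by metis
  qed
  then show ?thesis using assms(1) by (auto simp: pole_poly_def poly_prod pole_set_def)
qed

definition V :: "complex poly fract set" where "V = rahman_space q b"

text \<open>
  The reduced denominator divides \<open>pole_poly S\<close>, whose roots are simple and of the allowed form.
\<close>

lemma Fract_in_V:
  assumes S: "pole_set S" and p: "degree p \<le> card S"
  shows "Fract p (pole_poly S) \<in> V"
proof -
  define f where "f = Fract p (pole_poly S)"
  define rn rd where "rn = rat_num f" and "rd = rat_den f"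
  have rd: "rd \<noteq> 0" unfolding rd_def rat_den_def by simp
  have cop: "coprime rn rd" unfolding rn_def rd_def rat_num_def rat_den_def
    by (rule coprime_quot_of_fract)
  have "Fract rn rd = Fract p (pole_poly S)" unfolding rn_def rd_def by (metis f_def rat_Fract_eq)
  then have eq: "rn * pole_poly S = p * rd" using rd by (simp add: eq_fract)
  have "rd dvd rn * pole_poly S" by (simp add: eq)
  then have dvd: "rd dvd pole_poly S" using cop by (metis coprime_commute coprime_dvd_mult_right_iff)
  have deg: "degree rn \<le> degree rd"
  proof (cases "rn = 0")
    case False
    then have "p \<noteq> 0" using eq by auto
    have "degree rn + card S = degree p + degree rd"
      using arg_cong[OF eq, of degree] False \<open>p \<noteq> 0\<close> rd degree_pole_poly[OF S] by (simp add: degree_mult_eq)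
    then show ?thesis using p by linarith
  qed simp
  have "order x rd = 1 \<and> (\<exists>j\<in>{1..6}. \<exists>n::nat. n \<ge> 1 \<and> x = joukowski (b j * q powi (- int n)))"
    if x: "poly rd x = 0" for x
  proof
    have "poly (pole_poly S) x = 0" using dvd x by (metis dvd_def mult_zero_left poly_mult)
    then obtain s where s: "s \<in> S" "poly (pm_poly (pole_point s)) x = 0"
      using S by (auto simp: pole_poly_def poly_prod pole_set_def)
    have s6: "fst s \<in> {1..6}" "1 \<le> snd s" using s(1) S by (auto simp: pole_set_def)
    have xs: "x = joukowski (pole_point s)" using s(2) poly_pm_poly_eq_0_iff[OF pole_point_nz[OF s6(1)]] by simp
    then show "\<exists>j\<in>{1..6}. \<exists>n::nat. n \<ge> 1 \<and> x = joukowski (b j * q powi (- int n))"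
      using s6 unfolding pole_point_def by blast
    have S': "pole_set (S - {s})" using S pole_set_subset by blast
    have e: "pole_poly S = pm_poly (pole_point s) * pole_poly (S - {s})"
      using pole_poly_insert[OF S', of s] s(1) by (simp add: insert_absorb)
    have l0: "pm_poly (pole_point s) * pole_poly (S - {s}) \<noteq> 0" by simp
    have "order x (pole_poly S) = order x (pm_poly (pole_point s)) + order x (pole_poly (S - {s}))"
      unfolding e by (rule order_mult[OF l0])
    also have "order x (pole_poly (S - {s})) = 0"
      using poly_pole_poly_nz[OF S' s6(1)] xs by (simp add: order_0I)
    also have "order x (pm_poly (pole_point s)) = 1"
    proof -
      have "order x (pm_poly (pole_point s)) \<le> 1" using order_degree[OF pm_poly_nz] degree_pm_poly_le by (metis order_trans)
      moreover have "order x (pm_poly (pole_point s)) \<noteq> 0" using s(2) by (simp add: order_root)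
      ultimately show ?thesis by simp
    qed
    finally have "order x (pole_poly S) = 1" by simp
    moreover have "order x rd \<le> order x (pole_poly S)" using dvd by (intro dvd_imp_order_le) auto
    moreover have "order x rd \<noteq> 0" using x rd by (simp add: order_root)
    ultimately show "order x rd = 1" by simp
  qed
  then show ?thesis using deg unfolding V_def rahman_space_def rn_def rd_def f_def by blast
qed

text \<open>
  Conversely, the reduced denominator itself is such a product up to a constant. This description shows that \<open>V\<close> is
  a linear space, which is not visible from the one by reduced fractions.
\<close>

lemma V_imp_Fract:
  assumes f: "f \<in> V"
  shows "\<exists>S p. pole_set S \<and> degree p \<le> card S \<and> f = Fract p (pole_poly S)"
proof -
  define rn rd where "rn = rat_num f" and "rd = rat_den f"
  have rd0: "rd \<noteq> 0" unfolding rd_def rat_den_def by simp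
  have deg: "degree rn \<le> degree rd" and
    roots: "\<And>x. poly rd x = 0 \<Longrightarrow> order x rd = 1 \<and> (\<exists>j\<in>{1..6}. \<exists>n::nat. n \<ge> 1 \<and> x = joukowski (b j * q powi (- int n)))"
    using f unfolding V_def rahman_space_def rn_def rd_def by auto
  define Z where "Z = {x. poly rd x = 0}"
  have finZ: "finite Z" unfolding Z_def using rd0 by (rule poly_roots_finite)
  have "\<exists>s. fst s \<in> {1..6} \<and> 1 \<le> snd s \<and> x = joukowski (pole_point s)" if x: "x \<in> Z" for x
  proof -
    obtain j n where "j \<in> {1..6}" "1 \<le> (n::nat)" "x = joukowski (b j * q powi (- int n))"
      using roots[of x] x unfolding Z_def by blast
    then show ?thesis by (intro exI[of _ "(j, n)"]) (simp add: pole_point_def)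
  qed
  then obtain g where g: "\<And>x. x \<in> Z \<Longrightarrow> fst (g x) \<in> {1..6} \<and> 1 \<le> snd (g x) \<and> x = joukowski (pole_point (g x))"
    by metis
  have inj: "inj_on g Z" by (rule inj_onI) (metis g)
  define S where "S = g ` Z"
  have "g ` Z \<subseteq> {1..6} \<times> {1..}"
    by (rule image_subsetI) (use g in \<open>simp add: mem_Times_iff\<close>)
  then have S: "pole_set S" using finZ by (simp add: S_def pole_set_def)
  \<comment> \<open>The denominator has only simple roots, hence it is up to a constant the product of its linear factors.\<close>
  have "rsquarefree rd" unfolding rsquarefree_def using rd0 roots
    by (metis order_root)
  then have dec: "rd = smult (lead_coeff rd) (\<Prod>z\<in>Z. [:- z, 1:])"
    unfolding Z_def using complex_poly_decompose_rsquarefree by metis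
  have degZ: "degree rd = card Z"
    by (subst dec) (use rd0 in \<open>simp add: degree_prod_eq_sum_degree\<close>)
  define k where "k = (\<Prod>z\<in>Z. - 2 * pole_point (g z)) / lead_coeff rd"
  have k: "k \<noteq> 0" using g pole_point_nz finZ rd0 by (auto simp: k_def)
  have "pole_poly S = (\<Prod>z\<in>Z. pm_poly (pole_point (g z)))" unfolding pole_poly_def S_def using inj by (simp add: prod.reindex)
  also have "\<dots> = (\<Prod>z\<in>Z. smult (- 2 * pole_point (g z)) [:- z, 1:])"
    using g pole_point_nz by (intro prod.cong[OF refl]) (metis pm_poly_eq)
  also have "\<dots> = smult (\<Prod>z\<in>Z. - 2 * pole_point (g z)) (\<Prod>z\<in>Z. [:- z, 1:])"
    by (rule prod_smult)
  also have "\<dots> = smult k rd" by (subst dec) (use rd0 in \<open>simp add: k_def\<close>)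
  finally have pole_poly: "pole_poly S = smult k rd" .
  have "f = Fract rn rd" unfolding rn_def rd_def by (rule rat_Fract_eq)
  also have "\<dots> = Fract (smult k rn) (pole_poly S)" unfolding pole_poly using rd0 k by (simp add: eq_fract)
  finally have "f = Fract (smult k rn) (pole_poly S)" .
  moreover have "degree (smult k rn) \<le> card S"
    using deg degZ k inj by (simp add: S_def card_image)
  ultimately show ?thesis using S by blast
qed

lemma Fract_enlarge:
  assumes "pole_set S" "pole_set T" "S \<subseteq> T" "degree p \<le> card S"
  shows "\<exists>p'. degree p' \<le> card T \<and> Fract p (pole_poly S) = Fract p' (pole_poly T)"
proof -
  have fin: "finite S" "finite T" using assms by (auto simp: pole_set_def)
  have "pole_poly T = pole_poly S * pole_poly (T - S)"
    unfolding pole_poly_def using prod.subset_diff[OF assms(3) fin(2)] by (simp add: mult.commute)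
  then have "Fract p (pole_poly S) = Fract (p * pole_poly (T - S)) (pole_poly T)" by (simp add: eq_fract)
  moreover have "degree (p * pole_poly (T - S)) \<le> card T"
  proof -
    have "degree (p * pole_poly (T - S)) \<le> degree p + card (T - S)"
      using degree_mult_le[of p "pole_poly (T - S)"] degree_pole_poly[OF pole_set_subset[OF assms(2)], of "T - S"] by auto
    also have "\<dots> \<le> card S + card (T - S)" using assms by simp
    also have "\<dots> = card T" using fin assms by (simp add: card_Diff_subset card_mono)
    finally show ?thesis .
  qed
  ultimately show ?thesis by blast
qed

lemma V_Fract_common:
  assumes "f \<in> V" "g \<in> V"
  shows "\<exists>S p p'. pole_set S \<and> degree p \<le> card S \<and> degree p' \<le> card S \<and>
           f = Fract p (pole_poly S) \<and> g = Fract p' (pole_poly S)"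
proof -
  obtain S p where S: "pole_set S" "degree p \<le> card S" "f = Fract p (pole_poly S)"
    using V_imp_Fract[OF assms(1)] by blast
  obtain T r where T: "pole_set T" "degree r \<le> card T" "g = Fract r (pole_poly T)"
    using V_imp_Fract[OF assms(2)] by blast
  show ?thesis
    using Fract_enlarge[OF S(1) pole_set_Un[OF S(1) T(1)] _ S(2)] Fract_enlarge[OF T(1) pole_set_Un[OF S(1) T(1)] _ T(2)]
      pole_set_Un[OF S(1) T(1)] S(3) T(3) by blast
qed

lemma V_add: "f \<in> V \<Longrightarrow> g \<in> V \<Longrightarrow> f + g \<in> V"
proof -
  assume "f \<in> V" "g \<in> V"
  then obtain S p p' where S: "pole_set S" "degree p \<le> card S" "degree p' \<le> card S"
      "f = Fract p (pole_poly S)" "g = Fract p' (pole_poly S)" using V_Fract_common by blast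
  have "f + g = Fract (p + p') (pole_poly S)"
    unfolding S by (simp add: eq_fract algebra_simps)
  then show ?thesis using Fract_in_V[OF S(1), of "p + p'"] S degree_add_le by metis
qed

lemma rat_scale_Fract: "rat_scale c (Fract p r) = Fract (smult c p) r"
  by (cases "r = 0") (simp_all add: rat_scale_def to_fract_def)

lemma V_scale: "f \<in> V \<Longrightarrow> rat_scale c f \<in> V"
proof -
  assume "f \<in> V"
  then obtain S p where S: "pole_set S" "degree p \<le> card S" "f = Fract p (pole_poly S)"
    using V_imp_Fract by blast
  show ?thesis unfolding S(3) rat_scale_Fract
    using S by (intro Fract_in_V) (auto intro: order_trans[OF degree_smult_le])
qed

text \<open>
  The constant is the residue up to normalization; it is given explicitly because it has to be nonzero later.
\<close>

lemma partial_fraction_step: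
  assumes S: "pole_set S" and s: "fst s \<in> {1..6}" "1 \<le> snd s" "s \<notin> S" and p: "degree p \<le> Suc (card S)"
  shows "\<exists>p'. degree p' \<le> card S \<and>
     Fract p (pole_poly (insert s S)) =
       rat_scale (poly p (joukowski (pole_point s)) / poly (pole_poly S) (joukowski (pole_point s))) (Fract 1 (pm_poly (pole_point s))) + Fract p' (pole_poly S)"
proof -
  let ?x = "joukowski (pole_point s)"
  define r where "r = poly p ?x / poly (pole_poly S) ?x"
  have "poly (p - smult r (pole_poly S)) ?x = 0" using poly_pole_poly_nz[OF S s(1,3)] by (simp add: r_def)
  then have "[:- ?x, 1:] dvd p - smult r (pole_poly S)" by (simp only: poly_eq_0_iff_dvd)
  then obtain t where "p - smult r (pole_poly S) = [:- ?x, 1:] * t" by (rule dvdE)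
  moreover define p' where "p' = smult (1 / (- 2 * pole_point s)) t"
  have "pm_poly (pole_point s) * p' = [:- ?x, 1:] * t"
  proof -
    have "1 / (- 2 * pole_point s) * (- 2 * pole_point s) = 1" using pole_point_nz[OF s(1)] by simp
    then show ?thesis unfolding p'_def pm_poly_eq[OF pole_point_nz[OF s(1)]]
      by (simp only: mult_smult_left mult_smult_right smult_smult smult_1_left)
  qed
  ultimately have e: "p - smult r (pole_poly S) = pm_poly (pole_point s) * p'" by simp
  have "Fract p (pole_poly (insert s S)) = rat_scale r (Fract 1 (pm_poly (pole_point s))) + Fract p' (pole_poly S)"
  proof -
    have "p = smult r (pole_poly S) + pm_poly (pole_point s) * p'" using e by (simp add: algebra_simps)
    then show ?thesis
      unfolding rat_scale_Fract pole_poly_insert[OF S s(3)] by (simp add: eq_fract algebra_simps)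
  qed
  moreover have "degree p' \<le> card S"
  proof (cases "p' = 0")
    case False
    have "degree (pm_poly (pole_point s) * p') = 1 + degree p'"
      using False degree_pm_poly[OF pole_point_nz[OF s(1)]] by (simp add: degree_mult_eq)
    moreover have "degree (p - smult r (pole_poly S)) \<le> Suc (card S)"
      using p degree_pole_poly[OF S] by (intro degree_diff_le) (auto intro: order_trans[OF degree_smult_le])
    ultimately show ?thesis using e by simp
  qed simp
  ultimately show ?thesis unfolding r_def by blast
qed

lemma rahman_elem_Fract:
  "rahman_elem q b k = Fract (\<Prod>j=1..6. \<Prod>i<nat (k j). pm_poly (b j * q ^ i)) (pole_poly (SIGMA j:{1..6}. {1..nat (- k j)}))"
proof -
  have *: "pm_poch q (b j) (k j) = Fract (\<Prod>i<nat (k j). pm_poly (b j * q ^ i)) (\<Prod>i=1..nat (- k j). pm_poly (b j * q powi (- int i)))" for j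
    by (cases "k j \<ge> 0") (simp_all add: pm_poch_def pm_factor_Fract Fract_prod One_fract_def)
  have "rahman_elem q b k = Fract (\<Prod>j=1..6. \<Prod>i<nat (k j). pm_poly (b j * q ^ i))
      (\<Prod>j=1..6. \<Prod>i=1..nat (- k j). pm_poly (b j * q powi (- int i)))"
    unfolding rahman_elem_def * by (simp only: prod_1_6 mult_fract)
  also have "(\<Prod>j=1..6. \<Prod>i=1..nat (- k j). pm_poly (b j * q powi (- int i))) = pole_poly (SIGMA j:{1..6}. {1..nat (- k j)})"
    unfolding pole_poly_def by (subst prod.Sigma) (auto simp: pole_point_def intro!: prod.cong)
  finally show ?thesis .
qed

text \<open>
  Because the exponents add up to 0, the numerator has at most as many factors as the denominator.
\<close>

lemma rahman_elem_data:
  assumes "(\<Sum>j=1..6. k j) = 0"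
  shows "pole_set (SIGMA j:{1..6}. {1..nat (- k j)})"
    "degree (\<Prod>j=1..6. \<Prod>i<nat (k j). pm_poly (b j * q ^ i)) \<le> card (SIGMA j:{1..6}. {1..nat (- k j)})"
proof -
  show "pole_set (SIGMA j:{1..6}. {1..nat (- k j)})" by (auto simp: pole_set_def)
  have "degree (\<Prod>j=1..6. \<Prod>i<nat (k j). pm_poly (b j * q ^ i)) = (\<Sum>j=1..6. \<Sum>i<nat (k j). degree (pm_poly (b j * q ^ i)))"
    by (simp add: degree_prod_eq_sum_degree)
  also have "\<dots> \<le> (\<Sum>j=1..6. \<Sum>i<nat (k j). 1)"
    by (intro sum_mono degree_pm_poly_le)
  also have "\<dots> = (\<Sum>j=1..6. nat (k j))" by simp
  also have "\<dots> = (\<Sum>j=1..6. nat (- k j))"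
  proof -
    have "(\<Sum>j=1..6. int (nat (k j)) - int (nat (- k j))) = (\<Sum>j=1..6. k j)"
      by (rule sum.cong) auto
    then have "int (\<Sum>j=1..6. nat (k j)) = int (\<Sum>j=1..6. nat (- k j))"
      using assms by (simp add: sum_subtractf)
    then show ?thesis by (simp only: of_nat_eq_iff)
  qed
  also have "\<dots> = card (SIGMA j:{1..6}. {1..nat (- k j)})" by (subst card_SigmaI) auto
  finally show "degree (\<Prod>j=1..6. \<Prod>i<nat (k j). pm_poly (b j * q ^ i)) \<le> card (SIGMA j:{1..6}. {1..nat (- k j)})" .
qed

lemma rahman_elem_in_V: "(\<Sum>j=1..6. k j) = 0 \<Longrightarrow> rahman_elem q b k \<in> V"
  unfolding rahman_elem_Fract using rahman_elem_data by (intro Fract_in_V) auto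

text \<open>
  Two functionals that agree on the products agree on all elementary fractions (\<open>base\<close>), by induction on the order
  \<open>n\<close> of the pole \<open>b\<^sub>j q\<^sup>-\<^sup>n\<close>, and hence on \<open>V\<close> by partial fractions (\<open>reduce\<close>).
\<close>

lemma rahman_functional_unique:
  assumes J: "is_rahman_functional q b J" and J': "is_rahman_functional q b J'" and f: "f \<in> V"
  shows "J f = J' f"
proof -
  have add: "J (f + g) = J f + J g" "J' (f + g) = J' f + J' g" if "f \<in> V" "g \<in> V" for f g
    using J J' that unfolding is_rahman_functional_def V_def by auto
  have scale: "J (rat_scale c f) = c * J f" "J' (rat_scale c f) = c * J' f" if "f \<in> V" for c f
    using J J' that unfolding is_rahman_functional_def V_def by auto
  have elem: "J (rahman_elem q b k) = J' (rahman_elem q b k)" if "(\<Sum>j=1..6. k j) = 0" for k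
    using J J' that unfolding is_rahman_functional_def by auto
  have one: "J 1 = J' 1" "1 \<in> V"
  proof -
    have "rahman_elem q b (\<lambda>_. 0) = 1" by (simp add: rahman_elem_def pm_poch_def)
    then show "J 1 = J' 1" "1 \<in> V" using elem[of "\<lambda>_. 0"] rahman_elem_in_V[of "\<lambda>_. 0"] by auto
  qed
  have sing: "Fract 1 (pm_poly (pole_point s)) \<in> V" if "fst s \<in> {1..6}" "1 \<le> snd s" for s
    using Fract_in_V[of "{s}" 1] that by (cases s) (auto simp: pole_set_def pole_poly_def)
  have reduce: "J (Fract p (pole_poly S)) = J' (Fract p (pole_poly S))"
    if "pole_set S" "\<And>s. s \<in> S \<Longrightarrow> J (Fract 1 (pm_poly (pole_point s))) = J' (Fract 1 (pm_poly (pole_point s)))" "degree p \<le> card S" for S p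
  proof -
    have "finite S" using that by (simp add: pole_set_def)
    then show ?thesis using that
    proof (induction S arbitrary: p rule: finite_induct)
      case empty
      then have "degree p = 0" by simp
      then obtain c where "p = [:c:]" using degree_eq_zeroE by blast
      then have "Fract p (pole_poly {}) = rat_scale c 1" by (simp add: pole_poly_def rat_scale_def to_fract_def)
      then show ?case using scale[OF one(2)] one(1) by simp
    next
      case (insert s S)
      have g: "fst s \<in> {1..6}" "1 \<le> snd s" "pole_set S" using insert.prems(1) by (auto simp: pole_set_insert)
      obtain p' c where p': "degree p' \<le> card S"
        "Fract p (pole_poly (insert s S)) = rat_scale c (Fract 1 (pm_poly (pole_point s))) + Fract p' (pole_poly S)"
        using partial_fraction_step[OF g(3,1,2) insert.hyps(2), of p] insert.prems(3) insert.hyps by auto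
      have "J (Fract p' (pole_poly S)) = J' (Fract p' (pole_poly S))"
        using insert.IH[OF g(3) _ p'(1)] insert.prems(2) by blast
      moreover have "Fract p' (pole_poly S) \<in> V" using Fract_in_V[OF g(3) p'(1)] .
      ultimately show ?case unfolding p'(2)
        using add V_scale sing[OF g(1,2)] scale[OF sing[OF g(1,2)]] insert.prems(2)[of s] by simp
    qed
  qed
  have base: "J (Fract 1 (pm_poly (pole_point (j, n)))) = J' (Fract 1 (pm_poly (pole_point (j, n))))" if j: "j \<in> {1..6}" and "1 \<le> n" for j n
    using \<open>1 \<le> n\<close>
  proof (induction n rule: less_induct)
    case (less n)
    \<comment> \<open>The product with exponents \<open>-n\<close> at \<open>j\<close> and \<open>n\<close> at some other index \<open>i\<close> has simple poles at the
      points \<open>b\<^sub>j q\<^sup>-\<^sup>1, \<dots>, b\<^sub>j q\<^sup>-\<^sup>n\<close>, and its numerator does not vanish at the last one.\<close>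
    define i :: nat where "i = (if j = 1 then 2 else 1)"
    have i: "i \<in> {1..6}" "i \<noteq> j" by (auto simp: i_def)
    define k :: "nat \<Rightarrow> int" where "k = (\<lambda>_. 0)(j := - int n, i := int n)"
    have k: "k j = - int n" "k i = int n" "\<And>m. m \<noteq> i \<Longrightarrow> m \<noteq> j \<Longrightarrow> k m = 0" using i by (auto simp: k_def)
    have sum: "(\<Sum>j=1..6. k j) = 0"
    proof -
      have "(\<Sum>j=1..6. k j) = (\<Sum>m\<in>{i, j}. k m)"
        by (rule sum.mono_neutral_right) (use i j k in auto)
      then show ?thesis using i k by simp
    qed
    define S where "S = {j} \<times> {1..n - 1}"
    have S: "pole_set S" using j by (auto simp: S_def pole_set_def)
    have nS: "(j, n) \<notin> S" using less.prems by (auto simp: S_def)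
    have eS: "(SIGMA m:{1..6}. {1..nat (- k m)}) = insert (j, n) S"
    proof -
      have "nat (- k m) = (if m = j then n else 0)" for m
        using k i by (cases "m = j"; cases "m = i") auto
      then have "(SIGMA m:{1..6}. {1..nat (- k m)}) = {j} \<times> {1..n}"
        using j by (auto split: if_splits)
      also have "{1..n} = insert n {1..n - 1}" using less.prems by auto
      finally show ?thesis unfolding S_def by blast
    qed
    define P where "P = (\<Prod>j=1..6. \<Prod>i<nat (k j). pm_poly (b j * q ^ i))"
    have P: "poly P (joukowski (pole_point (j, n))) \<noteq> 0"
    proof -
      have "poly (pm_poly (b m * q ^ t)) (joukowski (pole_point (j, n))) \<noteq> 0" if "m \<in> {1..6}" "t < nat (k m)" for m t
      proof -
        have m: "m = i" using that k by (cases "m = j"; cases "m = i") auto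
        have "joukowski (pole_point (j, n)) \<noteq> joukowski (b m * q ^ t)"
          unfolding pole_point_def using joukowski_ne[OF j that(1), of "- int n" "int t"] m i by simp
        then show ?thesis using poly_pm_poly_eq_0_iff[of "b m * q ^ t"] b_nz[OF that(1)] by simp
      qed
      then show ?thesis unfolding P_def poly_prod by (auto simp: prod_zero_iff)
    qed
    have PS: "degree P \<le> Suc (card S)"
      using rahman_elem_data(2)[OF sum] nS S unfolding P_def[symmetric] eS by (simp add: pole_set_def)
    have Pe: "rahman_elem q b k = Fract P (pole_poly (insert (j, n) S))"
      unfolding rahman_elem_Fract P_def eS ..
    let ?c = "poly P (joukowski (pole_point (j, n))) / poly (pole_poly S) (joukowski (pole_point (j, n)))"
    obtain p' where p': "degree p' \<le> card S"
      "rahman_elem q b k = rat_scale ?c (Fract 1 (pm_poly (pole_point (j, n)))) + Fract p' (pole_poly S)"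
      using partial_fraction_step[OF S _ _ nS PS] j less.prems unfolding Pe by auto
    have r: "J (Fract p' (pole_poly S)) = J' (Fract p' (pole_poly S))"
      by (rule reduce[OF S _ p'(1)]) (use less.IH less.prems in \<open>auto simp: S_def\<close>)
    have sV: "Fract 1 (pm_poly (pole_point (j, n))) \<in> V" using sing[of "(j, n)"] j less.prems by simp
    have c: "?c \<noteq> 0" using P poly_pole_poly_nz[OF S _ nS] j by simp
    have "J (rat_scale ?c (Fract 1 (pm_poly (pole_point (j, n))))) = J' (rat_scale ?c (Fract 1 (pm_poly (pole_point (j, n)))))"
      using elem[OF sum] add[OF V_scale[OF sV] Fract_in_V[OF S p'(1)]] r unfolding p'(2) by simp
    then show ?case unfolding scale[OF sV] using c by simp
  qed
  obtain S p where S: "pole_set S" "degree p \<le> card S" "f = Fract p (pole_poly S)"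
    using V_imp_Fract[OF f] by blast
  show ?thesis unfolding S(3)
    by (rule reduce[OF S(1) _ S(2)]) (use base S(1) in \<open>auto simp: pole_set_def\<close>)
qed

section \<open>The integral of the constant function\<close>

definition bset :: "complex set" where "bset = {b 1, b 2, b 3, b 4, b 5, b 6}"

lemma set_1_6: "{1..6} = {1, 2, 3, 4, 5, 6 :: nat}"
  by auto

lemma bset_image: "bset = b ` {1..6}"
  unfolding bset_def set_1_6 by simp

lemma bset_nz: "0 \<notin> bset"
  unfolding bset_image using b_nz by auto

lemma poc_bb_nz: "i \<in> {1..6} \<Longrightarrow> j \<in> {1..6} \<Longrightarrow> poc (b i * b j) \<noteq> 0"
proof
  assume ij: "i \<in> {1..6}" "j \<in> {1..6}" and "poc (b i * b j) = 0"
  then obtain n where "b i * b j * q ^ n = 1" by (auto simp: poc_eq_0_iff)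
  then have "b i * b j = q powi (- int n)" by (simp add: power_int_minus field_simps)
  then show False using b_mult_ne ij by blast
qed

text \<open>
  The integrand of the theorem for \<open>f = 1\<close>.
\<close>

definition base_integrand :: "(nat \<Rightarrow> complex) \<Rightarrow> complex \<Rightarrow> complex" where
  "base_integrand l z = ((z - inverse z) / z\<^sup>2) *
     (\<Prod>j=1..6. theta (l j * z) / (poc (b j * z) * poc (b j / z))) * (1 / (2 * of_real pi * \<i> * z))"

lemma rahman_C_eq:
  assumes l: "(\<Prod>j=1..6. l j) = q"
  shows "rahman_C q b l = (interp_coeff (l 1) (l 2) (l 3) (l 4) (l 5) (l 6) * antisym_quot (b 1) (b 2) (b 3) (b 4) (b 5) (b 6) (l 1) +
     interp_coeff (l 2) (l 1) (l 3) (l 4) (l 5) (l 6) * antisym_quot (b 1) (b 2) (b 3) (b 4) (b 5) (b 6) (l 2)) /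
     (poc q * pair_pocs (b 1) (b 2) (b 3) (b 4) (b 5) (b 6))"
proof -
  have bp: "b 1 * b 2 * b 3 * b 4 * b 5 * b 6 = q" using b_prod by (simp only: prod_1_6)
  have l0: "l 1 \<noteq> 0" "l 2 \<noteq> 0" using l q_nz unfolding prod_1_6 by auto
  have *: "rahman_C_term q b m = interp_coeff (m 1) (m 2) (m 3) (m 4) (m 5) (m 6) *
      antisym_quot (b 1) (b 2) (b 3) (b 4) (b 5) (b 6) (m 1) / (poc q * pair_pocs (b 1) (b 2) (b 3) (b 4) (b 5) (b 6))"
    if "m 1 \<noteq> 0" for m
    unfolding rahman_C_term_def antisym_quot_def antisym_part_eq_C_numerator[OF bp that] interp_coeff_def pair_pocs_def
      pairs_1_6 prod_1_6 prod_3_6 by (simp add: mult_ac)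
  show ?thesis unfolding rahman_C_def
    using *[of l] *[of "l(1 := l 2, 2 := l 1)"] l0 by (simp add: add_divide_distrib)
qed

text \<open>
  Only the antisymmetric part of the numerator counts, and \<open>integral6_eval\<close> evaluates its integral.
\<close>

theorem base_integral:
  assumes g: "separating bset g" and l: "(\<Prod>j=1..6. l j) = q"
    and gen: "theta ((l 1)\<^sup>2) \<noteq> 0" "theta ((l 2)\<^sup>2) \<noteq> 0" "theta (l 1 / l 2) \<noteq> 0"
  shows "contour_integral g (base_integrand l) = rahman_C q b l"
proof -
  let ?M = "integral6 g (b 1) (b 2) (b 3) (b 4) (b 5) (b 6)"
  let ?P = "pair_pocs (b 1) (b 2) (b 3) (b 4) (b 5) (b 6)"
  let ?p = "theta_product (l 1) (l 2) (l 3) (l 4) (l 5) (l 6)"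
  have bp: "b 1 * b 2 * b 3 * b 4 * b 5 * b 6 = q" using b_prod by (simp only: prod_1_6)
  have lp: "l 1 * l 2 * l 3 * l 4 * l 5 * l 6 = q" using l by (simp only: prod_1_6)
  have lnz: "0 \<notin> {l 1, l 2, l 3, l 4, l 5, l 6}" using lp q_nz by auto
  have bnz: "0 \<notin> {b 1, b 2, b 3, b 4, b 5, b 6}" using bset_nz by (simp add: bset_def)
  have g6: "separating {b 1, b 2, b 3, b 4, b 5, b 6} g" using g by (simp add: bset_def)
  have P: "?P \<noteq> 0" unfolding pair_pocs_def using poc_bb_nz by simp
  have th: "theta x \<noteq> 0" if "x \<noteq> 0" "\<And>n. x \<noteq> q powi n" for x using theta_eq_0_iff that by blast
  have bgen: "theta ((b 5)\<^sup>2) \<noteq> 0" "theta ((b 6)\<^sup>2) \<noteq> 0" "theta (b 5 * b 6) \<noteq> 0" "theta (b 5 / b 6) \<noteq> 0"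
  proof -
    have n: "b 5 \<noteq> 0" "b 6 \<noteq> 0" using b_nz by simp_all
    show "theta ((b 5)\<^sup>2) \<noteq> 0" "theta ((b 6)\<^sup>2) \<noteq> 0" "theta (b 5 * b 6) \<noteq> 0"
      unfolding power2_eq_square using n by (intro th b_mult_ne; simp)+
    show "theta (b 5 / b 6) \<noteq> 0"
      using n by (intro th b_quot) simp_all
  qed
  have "contour_integral g (base_integrand l) =
     contour_integral g (\<lambda>z. 1 / (2 * of_real pi * \<i>) * ((1 - 1 / z\<^sup>2) / z * ?p z / pocpm6 (b 1) (b 2) (b 3) (b 4) (b 5) (b 6) z / z))"
  proof (rule contour_integral_cong[OF refl])
    fix z assume "z \<in> path_image g"
    then have "z \<noteq> 0" using g by (auto simp: separating_def)
    then have e: "(z - inverse z) / z\<^sup>2 = (1 - 1 / z\<^sup>2) / z" by (simp add: field_simps power2_eq_square)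
    show "base_integrand l z = 1 / (2 * of_real pi * \<i>) *
        ((1 - 1 / z\<^sup>2) / z * ?p z / pocpm6 (b 1) (b 2) (b 3) (b 4) (b 5) (b 6) z / z)"
      unfolding base_integrand_def e prod_1_6 theta_product_def pocpm6_def pocpm_def by simp
  qed
  also have "\<dots> = 1 / (2 * of_real pi * \<i>) * ?M ?p"
    unfolding integral6_def
    by (rule contour_integral_lmul[OF integral6_integrable[OF g6 bnz theta_product_holo(1)[OF lnz]]])
  also have "?M ?p = 1 / 2 * ?M (antisym_part (l 1) (l 2) (l 3) (l 4) (l 5) (l 6))"
    by (rule integral6_antisym_part[OF g6 bnz lnz])
  finally have "contour_integral g (base_integrand l) =
     1 / (2 * of_real pi * \<i>) * (1 / 2 * ?M (antisym_part (l 1) (l 2) (l 3) (l 4) (l 5) (l 6)))" .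
  moreover have "?M (antisym_part (l 1) (l 2) (l 3) (l 4) (l 5) (l 6)) =
    2 * of_real pi * \<i> * 2 * (interp_coeff (l 1) (l 2) (l 3) (l 4) (l 5) (l 6) * antisym_quot (b 1) (b 2) (b 3) (b 4) (b 5) (b 6) (l 1) +
     interp_coeff (l 2) (l 1) (l 3) (l 4) (l 5) (l 6) * antisym_quot (b 1) (b 2) (b 3) (b 4) (b 5) (b 6) (l 2)) / (poc q * ?P)"
    using integral6_eval[OF g6 bp bgen P lp gen] P poc_q_nz by (simp add: eq_divide_eq)
  ultimately show ?thesis unfolding rahman_C_eq[OF l] by simp
qed

section \<open>Shifting the parameters by powers of \<open>q\<close>\<close>

text \<open>
  The prescribed value of Rahman's functional on the product with exponents \<open>k\<close>.
\<close>

definition shift_factor :: "(nat \<Rightarrow> int) \<Rightarrow> complex" where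
  "shift_factor k = (\<Prod>i=1..6. \<Prod>j\<in>{i<..6}. qpoch q (b i * b j) (k i + k j)) /
     (\<Prod>j=1..6. q powi (k j * (k j - 1) div 2) * b j powi k j)"

lemma rahman_shift:
  assumes "(\<Sum>j=1..6. k j) = 0"
  shows "rahman q (\<lambda>j. b j * q powi k j)"
proof
  show "(\<Prod>j=1..6. b j * q powi k j) = q"
    by (simp only: prod.distrib b_prod prod_powi_sum[OF q_nz] assms) simp
  fix i j :: nat and n
  assume ij: "1 \<le> i" "i < j" "j \<le> 6"
  show "b i * q powi k i / (b j * q powi k j) \<noteq> q powi n"
  proof
    assume "b i * q powi k i / (b j * q powi k j) = q powi n"
    moreover have "b i / b j = b i * q powi k i / (b j * q powi k j) * q powi k j / q powi k i" by simp
    ultimately have "b i / b j = q powi (n + k j - k i)"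
      by (simp only: q_powi_add q_powi_diff)
    then show False using b_quot ij by blast
  qed
next
  fix i j :: nat and n
  assume ij: "1 \<le> i" "i \<le> j" "j \<le> 6"
  show "b i * q powi k i * (b j * q powi k j) \<noteq> q powi n"
  proof
    assume "b i * q powi k i * (b j * q powi k j) = q powi n"
    moreover have "b i * b j = b i * q powi k i * (b j * q powi k j) / q powi k i / q powi k j" by simp
    ultimately have "b i * b j = q powi (n - k i - k j)"
      by (simp only: q_powi_diff)
    then show False using b_mult ij by blast
  qed
qed

lemma theta_prod_shift:
  assumes k: "(\<Sum>j=1..6. k j) = 0" and a: "a \<noteq> 0"
  shows "(\<Prod>j=1..6. theta (a * (b j * q powi k j))) =
      (\<Prod>j=1..6. theta (a * b j)) / (\<Prod>j=1..6. q powi (k j * (k j - 1) div 2) * b j powi k j)"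
    and "(\<Prod>j=1..6. theta (a / (b j * q powi k j))) =
      (\<Prod>j=1..6. theta (a / b j)) / (\<Prod>j=1..6. q powi (k j * (k j - 1) div 2) * b j powi k j)"
proof -
  let ?D = "\<Prod>j=1..6. q powi (k j * (k j - 1) div 2) * b j powi k j"
  have m1: "(\<Prod>j=1..6. (- 1 :: complex) powi k j) = 1" "(\<Prod>j=1..6. a powi k j) = 1"
      "(\<Prod>j=1..6. q powi k j) = 1"
    by (subst prod_powi_sum; use k a in simp)+
  have "(\<Prod>j=1..6. theta (a * (b j * q powi k j))) =
     (\<Prod>j=1..6. (-1) powi k j / (a powi k j * (q powi (k j * (k j - 1) div 2) * b j powi k j)) * theta (a * b j))"
  proof (rule prod.cong[OF refl])
    fix j :: nat assume "j \<in> {1..6}"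
    then have "a * b j \<noteq> 0" using b_nz a by auto
    from theta_powi[OF this, of "k j"]
    show "theta (a * (b j * q powi k j)) = (-1) powi k j / (a powi k j * (q powi (k j * (k j - 1) div 2) * b j powi k j)) * theta (a * b j)"
      by (simp add: power_int_mult_distrib mult_ac)
  qed
  also have "\<dots> = (\<Prod>j=1..6. (-1) powi k j) / ((\<Prod>j=1..6. a powi k j) * ?D) * (\<Prod>j=1..6. theta (a * b j))"
    by (simp only: prod.distrib prod_dividef)
  finally show "(\<Prod>j=1..6. theta (a * (b j * q powi k j))) = (\<Prod>j=1..6. theta (a * b j)) / ?D"
    unfolding m1 by simp
  have "(\<Prod>j=1..6. theta (a / (b j * q powi k j))) =
     (\<Prod>j=1..6. (-1) powi k j * a powi k j / (q powi k j * (q powi (k j * (k j - 1) div 2) * b j powi k j)) * theta (a / b j))"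
  proof (rule prod.cong[OF refl])
    fix j :: nat assume "j \<in> {1..6}"
    then have nz: "a / b j \<noteq> 0" "b j \<noteq> 0" using b_nz a by auto
    have "- k j * (- k j - 1) = k j * (k j - 1) + 2 * k j" by (simp add: algebra_simps)
    then have e: "- k j * (- k j - 1) div 2 = k j * (k j - 1) div 2 + k j" by simp
    have "theta (a / (b j * q powi k j)) = theta (a / b j * q powi (- k j))"
      by (simp add: power_int_minus divide_inverse mult.assoc)
    also have "\<dots> = (-1) powi (- k j) / (q powi (k j * (k j - 1) div 2 + k j) * (a / b j) powi (- k j)) * theta (a / b j)"
      unfolding theta_powi[OF nz(1)] e ..
    also have "(- 1 :: complex) powi (- k j) = (- 1) powi k j" by (simp add: power_int_minus_one_minus)
    finally show "theta (a / (b j * q powi k j)) =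
      (-1) powi k j * a powi k j / (q powi k j * (q powi (k j * (k j - 1) div 2) * b j powi k j)) * theta (a / b j)"
      using nz a by (simp add: power_int_minus power_int_divide_distrib q_powi_add field_simps)
  qed
  also have "\<dots> = (\<Prod>j=1..6. (-1) powi k j) * (\<Prod>j=1..6. a powi k j) / ((\<Prod>j=1..6. q powi k j) * ?D) * (\<Prod>j=1..6. theta (a / b j))"
    by (simp only: prod.distrib prod_dividef)
  finally show "(\<Prod>j=1..6. theta (a / (b j * q powi k j))) = (\<Prod>j=1..6. theta (a / b j)) / ?D"
    unfolding m1 by simp
qed

text \<open>
  The two products of theta functions in the braces of \<open>C\<close> have different arguments but acquire the same factor,
  because the exponents add up to 0.
\<close>

lemma rahman_C_shift:
  assumes k: "(\<Sum>j=1..6. k j) = 0" and l: "l 1 \<noteq> 0" "l 2 \<noteq> 0"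
  shows "rahman_C q (\<lambda>j. b j * q powi k j) l = rahman_C q b l * shift_factor k"
proof -
  interpret R: rahman q "\<lambda>j. b j * q powi k j" by (rule rahman_shift[OF k])
  let ?D = "\<Prod>j=1..6. q powi (k j * (k j - 1) div 2) * b j powi k j"
  let ?N = "\<Prod>i=1..6. \<Prod>j\<in>{i<..6}. qpoch q (b i * b j) (k i + k j)"
  let ?B = "\<Prod>i=1..6. \<Prod>j\<in>{i<..6}. poc (b i * b j)"
  let ?B' = "\<Prod>i=1..6. \<Prod>j\<in>{i<..6}. poc (b i * q powi k i * (b j * q powi k j))"
  have "?B = (\<Prod>i=1..6. \<Prod>j\<in>{i<..6}. qpoch q (b i * b j) (k i + k j) * poc (b i * q powi k i * (b j * q powi k j)))"
  proof (intro prod.cong refl)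
    fix i j :: nat assume ij: "i \<in> {1..6}" "j \<in> {i<..6}"
    have "poc (b i * b j) = qpoch q (b i * b j) (k i + k j) * poc (b i * b j * q powi (k i + k j))"
    proof (rule poc_qpoch)
      fix n :: nat
      show "b i * b j * q powi (- int n) \<noteq> 1"
      proof
        assume "b i * b j * q powi (- int n) = 1"
        then have "b i * b j = q powi int n" by (simp add: power_int_minus field_simps)
        then show False using b_mult_ne[of i j "int n"] ij by simp
      qed
    qed
    then show "poc (b i * b j) = qpoch q (b i * b j) (k i + k j) * poc (b i * q powi k i * (b j * q powi k j))"
      by (simp add: q_powi_add mult_ac)
  qed
  then have B: "?B = ?N * ?B'" by (simp only: prod.distrib)
  have Bnz: "?B \<noteq> 0" using poc_bb_nz by (simp add: pairs_1_6)
  then have N: "?N / ?B = 1 / ?B'" unfolding B by simp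
  have T: "rahman_C_term q (\<lambda>j. b j * q powi k j) m = rahman_C_term q b m * shift_factor k" if "m 1 \<noteq> 0" for m
  proof -
    have d: "x / D - y * (z / D) = (x - y * z) / D" for x y z D :: complex
      by (simp add: diff_divide_distrib)
    have "rahman_C_term q (\<lambda>j. b j * q powi k j) m =
      ((\<Prod>j=3..6. theta (m j * m 2)) * (((\<Prod>j=1..6. theta (m 1 * b j)) - q * (m 1) powi (-2) * (\<Prod>j=1..6. theta (m 1 / b j))) / ?D)) /
      (m 2 * (theta ((m 1)\<^sup>2) * theta (m 1 / m 2)) * poc q) * (1 / ?B')"
      unfolding rahman_C_term_def theta_prod_shift[OF k that] d by simp
    also have "\<dots> = rahman_C_term q b m * shift_factor k"
      unfolding N[symmetric] rahman_C_term_def shift_factor_def by simp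
    finally show ?thesis .
  qed
  show ?thesis unfolding rahman_C_def
    using T[of l] T[of "l(1 := l 2, 2 := l 1)"] l by (simp add: distrib_right)
qed

section \<open>Existence of the functional\<close>

lemma zero_not_in_image_if_prod_eq_q:
  assumes "(\<Prod>j=1..6. l j) = q"
  shows "0 \<notin> l ` {1..6::nat}"
proof
  assume "0 \<in> l ` {1..6::nat}"
  then have "\<exists>j\<in>{1..6}. l j = 0" by force
  then have "(\<Prod>j=1..6. l j) = 0" by (intro prod_zero) auto
  then show False using assms q_nz by metis
qed

text \<open>
  For \<open>f\<close> with poles only at \<open>z\<^sup>\<plusminus>\<^sup>1 = b\<^sub>j q\<^sup>-\<^sup>n\<close>, \<open>n \<le> N\<close>, the integrand has its poles among those of
  \<open>\<Prod>\<^sub>j 1 / (b\<^sub>j q\<^sup>-\<^sup>N z\<^sup>\<plusminus>)\<^sub>\<infinity>\<close>.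
\<close>

definition shifted_bset :: "nat \<Rightarrow> complex set" where "shifted_bset N = (\<lambda>j. b j * q powi (- int N)) ` {1..6}"

definition pole_grid :: "nat \<Rightarrow> (nat \<times> nat) set" where "pole_grid N = {1..6} \<times> {1..N}"

lemma shifted_bset_props: "finite (shifted_bset N)" "0 \<notin> shifted_bset N"
  using b_nz by (auto simp: shifted_bset_def)

lemma pole_set_grid: "pole_set (pole_grid N)"
  by (auto simp: pole_set_def pole_grid_def)

lemma V_on_grid:
  assumes "f \<in> V"
  shows "\<exists>N0. \<forall>N\<ge>N0. \<exists>p. f = Fract p (pole_poly (pole_grid N))"
proof -
  obtain S p where S: "pole_set S" "degree p \<le> card S" "f = Fract p (pole_poly S)"
    using V_imp_Fract[OF assms] by blast
  have "finite (snd ` S)" using S(1) by (simp add: pole_set_def)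
  then have "\<exists>m. \<forall>n\<in>snd ` S. n \<le> m" by (simp only: finite_nat_set_iff_bounded_le)
  then obtain N0 where N0: "\<And>n. n \<in> snd ` S \<Longrightarrow> n \<le> N0" by blast
  have "\<exists>p. f = Fract p (pole_poly (pole_grid N))" if N: "N \<ge> N0" for N
  proof -
    have "S \<subseteq> pole_grid N"
    proof
      fix s assume s: "s \<in> S"
      then have "snd s \<le> N0" using N0 by auto
      moreover have "fst s \<in> {1..6}" "1 \<le> snd s" using S(1) s by (auto simp: pole_set_def)
      ultimately show "s \<in> pole_grid N" using N by (simp add: pole_grid_def mem_Times_iff)
    qed
    then show ?thesis using Fract_enlarge[OF S(1) pole_set_grid _ S(2)] S(3) by blast
  qed
  then show ?thesis by blast
qed

text \<open>
  The factors \<open>1 - b q\<^sup>-\<^sup>n z\<close> are those by which \<open>(b q\<^sup>-\<^sup>N z)\<^sub>\<infinity>\<close> exceeds \<open>(b z)\<^sub>\<infinity>\<close>.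
\<close>

lemma poly_pole_poly_grid:
  assumes z: "z \<noteq> 0"
  shows "poly (pole_poly (pole_grid N)) (joukowski z) * (\<Prod>j=1..6. pocpm (b j) z) =
    (\<Prod>j=1..6. pocpm (b j * q powi (- int N)) z)"
proof -
  have 1: "pocpm (b j * q powi (- int N)) z =
    (\<Prod>n=1..N. poly (pm_poly (pole_point (j, n))) (joukowski z)) * pocpm (b j) z" for j
  proof -
    have e: "b j * q powi (- int N) * z = b j * z * q powi (- int N)"
      "b j * q powi (- int N) / z = b j / z * q powi (- int N)" by simp_all
    show ?thesis unfolding pocpm_def e poc_split_down poly_pm_poly_joukowski[OF z] pole_point_def
      by (simp add: prod.distrib mult_ac)
  qed
  have "poly (pole_poly (pole_grid N)) (joukowski z) = (\<Prod>j=1..6. \<Prod>n=1..N. poly (pm_poly (pole_point (j, n))) (joukowski z))"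
    unfolding pole_poly_def pole_grid_def poly_prod by (subst prod.cartesian_product) (simp add: case_prod_unfold)
  then show ?thesis by (simp only: 1 prod.distrib)
qed

text \<open>
  The integrand with the denominator \<open>pole_poly (pole_grid N)\<close> of \<open>f\<close> absorbed into the infinite products, and \<open>p\<close> the numerator of \<open>f\<close>.
\<close>

definition cleared_integrand :: "(nat \<Rightarrow> complex) \<Rightarrow> nat \<Rightarrow> complex poly \<Rightarrow> complex \<Rightarrow> complex" where
  "cleared_integrand l N p z = poly p (joukowski z) *
     (((z - inverse z) / z\<^sup>2) * (\<Prod>j=1..6. theta (l j * z)) / (\<Prod>j=1..6. pocpm (b j * q powi (- int N)) z) *
      (1 / (2 * of_real pi * \<i> * z)))"

lemma regular_at_shifted_bset: "z \<in> regular_at (shifted_bset N) \<longleftrightarrow> z \<noteq> 0 \<and> (\<Prod>j=1..6. pocpm (b j * q powi (- int N)) z) \<noteq> 0"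
  by (auto simp: regular_at_pocpm shifted_bset_def)

lemma integrand_eq_cleared:
  assumes f: "f = Fract p (pole_poly (pole_grid N))" and z: "z \<in> regular_at (shifted_bset N)"
  shows "rahman_integrand q b l f z = cleared_integrand l N p z"
proof -
  have z0: "z \<noteq> 0" and nz: "(\<Prod>j=1..6. pocpm (b j * q powi (- int N)) z) \<noteq> 0"
    using z by (auto simp: regular_at_shifted_bset)
  let ?d = "poly (pole_poly (pole_grid N)) (joukowski z)"
  have d: "?d \<noteq> 0" using nz unfolding poly_pole_poly_grid[OF z0, symmetric] by auto
  have "rat_eval f (joukowski z) = poly p (joukowski z) / ?d"
    unfolding f by (rule rat_eval_Fract(1)[OF d])
  moreover have "(\<Prod>j=1..6. theta (l j * z) / (poc (b j * z) * poc (b j / z))) =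
     (\<Prod>j=1..6. theta (l j * z)) / (\<Prod>j=1..6. pocpm (b j) z)"
    unfolding pocpm_def by (rule prod_dividef)
  ultimately show ?thesis
    unfolding rahman_integrand_def cleared_integrand_def poly_pole_poly_grid[OF z0, symmetric] by (simp add: mult_ac)
qed

lemma analytic_parts:
  assumes "0 \<notin> l ` {1..6}"
  shows "(\<lambda>z. poly p (joukowski z)) holomorphic_on - {0}"
    "(\<lambda>z. (z - inverse z) / z\<^sup>2 :: complex) holomorphic_on - {0}"
    "(\<lambda>z. \<Prod>j=1..6. theta (l j * z)) holomorphic_on - {0}"
    "(\<lambda>z. \<Prod>j=1..6. pocpm (b j * q powi (- int N)) z) holomorphic_on - {0}"
    "(\<lambda>z. 1 / (2 * of_real pi * \<i> * z)) holomorphic_on - {0}"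
proof -
  show "(\<lambda>z. poly p (joukowski z)) holomorphic_on - {0}"
    unfolding poly_altdef joukowski_def by (intro holomorphic_intros) auto
  show "(\<lambda>z. \<Prod>j=1..6. theta (l j * z)) holomorphic_on - {0}"
    using assms by (intro holomorphic_intros) (auto simp: image_iff)
qed (intro holomorphic_intros; auto)+

lemma cleared_integrand_holo:
  assumes "0 \<notin> l ` {1..6}"
  shows "cleared_integrand l N p holomorphic_on regular_at (shifted_bset N)"
  unfolding cleared_integrand_def
  by (intro holomorphic_on_mult holomorphic_on_divide analytic_parts[OF assms, THEN holomorphic_on_subset])
     (auto simp: regular_at_shifted_bset)

lemma cleared_integrand_mero:
  assumes "0 \<notin> l ` {1..6}" "z \<noteq> 0"
  shows "cleared_integrand l N p meromorphic_on {z}"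
proof -
  note a = analytic_parts[OF assms(1)]
  have m: "f meromorphic_on {z}" if "f holomorphic_on - {0}" for f
    using that assms(2) by (intro analytic_on_imp_meromorphic_on) (auto simp: analytic_at intro!: exI[of _ "- {0}"])
  show ?thesis unfolding cleared_integrand_def
    by (intro meromorphic_on_mult meromorphic_on_divide m a)
qed

lemma not_regular_cases:
  assumes "z \<noteq> 0" "z \<notin> regular_at (shifted_bset N)"
  shows "\<exists>j\<in>{1..6}. \<exists>n. z = b j * q powi n \<or> z = inverse (b j) * q powi n"
proof -
  obtain j where j: "j \<in> {1..6}" "poc (b j * q powi (- int N) * z) = 0 \<or> poc (b j * q powi (- int N) / z) = 0"
    using assms by (auto simp: regular_at_def shifted_bset_def)
  then show ?thesis
  proof (elim disjE)
    assume "poc (b j * q powi (- int N) * z) = 0"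
    then obtain n where "b j * q powi (- int N) * z * q ^ n = 1" by (auto simp: poc_eq_0_iff)
    then have "b j * (q powi (int n - int N) * z) = 1" by (simp add: power_int_diff power_int_minus field_simps)
    then have "z = inverse (b j) * q powi (- (int n - int N))"
      using b_nz[OF j(1)] by (simp only: power_int_minus) (simp add: field_simps)
    then show ?thesis using j(1) by blast
  next
    assume "poc (b j * q powi (- int N) / z) = 0"
    then obtain n where "b j * q powi (- int N) / z * q ^ n = 1" by (auto simp: poc_eq_0_iff)
    then have "z = b j * q powi (int n - int N)"
      using assms(1) by (simp add: power_int_diff power_int_minus field_simps)
    then show ?thesis using j(1) by blast
  qed
qed

lemma integrand_no_pole:
  assumes l: "0 \<notin> l ` {1..6}" and f: "f = Fract p (pole_poly (pole_grid N))" and z: "z \<in> regular_at (shifted_bset N)"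
  shows "rahman_integrand q b l f analytic_on {z}" "\<not> is_pole (rahman_integrand q b l f) z"
proof -
  have o: "open (regular_at (shifted_bset N))" by (rule open_regular_at[OF shifted_bset_props(1)])
  have "rahman_integrand q b l f holomorphic_on regular_at (shifted_bset N)"
    using cleared_integrand_holo[OF l] integrand_eq_cleared[OF f] by (simp cong: holomorphic_cong)
  then show "rahman_integrand q b l f analytic_on {z}" using o z by (auto simp: analytic_at)
  then show "\<not> is_pole (rahman_integrand q b l f) z"
    using analytic_at_imp_isCont is_pole_def not_tendsto_and_filterlim_at_infinity at_neq_bot isContD by blast
qed

lemma integrand_mero:
  assumes l: "0 \<notin> l ` {1..6}" and f: "f = Fract p (pole_poly (pole_grid N))" and z: "z \<noteq> 0"
  shows "rahman_integrand q b l f meromorphic_on {z}"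
proof -
  have "\<forall>\<^sub>F w in at z. rahman_integrand q b l f w = cleared_integrand l N p w"
    using eventually_regular_at[OF shifted_bset_props z, of N]
    by eventually_elim (rule integrand_eq_cleared[OF f])
  then have "rahman_integrand q b l f meromorphic_on {z} \<longleftrightarrow> cleared_integrand l N p meromorphic_on {z}"
    by (intro meromorphic_on_cong) auto
  then show ?thesis using cleared_integrand_mero[OF l z] by simp
qed

text \<open>
  After removing the removable singularities the integrand is holomorphic away from 0 and its poles, and there both curves
  have prescribed winding numbers.
\<close>

lemma rahman_contour_integral_unique:
  assumes l: "0 \<notin> l ` {1..6}" and f: "f \<in> V"
    and g: "is_rahman_contour q b (rahman_integrand q b l f) g" "is_rahman_contour q b (rahman_integrand q b l f) h"
  shows "contour_integral g (rahman_integrand q b l f) = contour_integral h (rahman_integrand q b l f)"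
proof -
  let ?F = "rahman_integrand q b l f"
  obtain N p where fp: "f = Fract p (pole_poly (pole_grid N))" using V_on_grid[OF f] by blast
  let ?R = "regular_at (shifted_bset N)"
  \<comment> \<open>The curves may pass through, or wind arbitrarily around, points at which the integrand is not
    defined but has no pole; this is why the holomorphic extension \<open>G\<close> to the set \<open>D\<close> is used.\<close>
  define D where "D = {z. z \<noteq> 0 \<and> \<not> is_pole ?F z}"
  define G where "G = remove_sings ?F"
  have RD: "?R \<subseteq> D" using integrand_no_pole(2)[OF l fp] by (auto simp: D_def regular_at_def)
  have ev: "\<forall>\<^sub>F w in at z. w \<in> D" if "z \<noteq> 0" for z
    using eventually_regular_at[OF shifted_bset_props that, of N] by eventually_elim (use RD in auto)
  have "open D"
    unfolding open_contains_ball
  proof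
    fix z assume z: "z \<in> D"
    then have "\<forall>\<^sub>F w in at z. w \<in> D" by (intro ev) (simp add: D_def)
    then obtain d where d: "d > 0" "\<And>w. w \<noteq> z \<Longrightarrow> dist w z < d \<Longrightarrow> w \<in> D"
      by (auto simp: eventually_at)
    then have "ball z d \<subseteq> D" using z by (force simp: dist_commute)
    then show "\<exists>e>0. ball z e \<subseteq> D" using d(1) by blast
  qed
  have cR: "countable (- ?R)" using shifted_bset_props countable_not_regular countable_finite by blast
  have "connected (UNIV - (- D))"
    using RD by (intro connected_open_diff_countable countable_subset[OF _ cR]) auto
  then have "connected D" by (simp add: Diff_eq)
  have "G analytic_on {z}" if z: "z \<in> D" for z
  proof -
    have z': "z \<noteq> 0" "\<not> is_pole ?F z" using z by (auto simp: D_def)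
    have m: "?F meromorphic_on {z}" by (rule integrand_mero[OF l fp z'(1)])
    have iso: "isolated_singularity_at ?F z" using m by (simp add: meromorphic_at_iff)
    have "not_essential ?F z" using m by (simp add: meromorphic_at_iff)
    then obtain c where "?F \<midarrow>z\<rightarrow> c" using z'(2) by (auto simp: not_essential_def)
    then show ?thesis unfolding G_def using remove_sings_analytic_at[OF iso] by blast
  qed
  then have "G analytic_on D" by (subst analytic_on_analytic_at) blast
  then have G: "G holomorphic_on D" by (rule analytic_imp_holomorphic)
  have wn: "w \<notin> path_image k \<and> winding_number k w = (if w = 0 \<or> (\<exists>j\<in>{1..6}. \<exists>n. w = b j * q powi n) then 1 else 0)"
    if k: "is_rahman_contour q b ?F k" and w: "w \<notin> D" for k w
  proof (cases "w = 0")
    case True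
    then show ?thesis using k by (simp add: is_rahman_contour_def)
  next
    case False
    then have pole: "is_pole ?F w" using w by (simp add: D_def)
    then have "w \<notin> ?R" using RD w by auto
    from not_regular_cases[OF False this] obtain j n where j: "j \<in> {1..6}"
      and jn: "w = b j * q powi n \<or> w = inverse (b j) * q powi n" by blast
    show ?thesis
    proof (cases "\<exists>j\<in>{1..6}. \<exists>n. w = b j * q powi n")
      case True
      then show ?thesis using k pole unfolding is_rahman_contour_def by auto
    next
      case False2: False
      then have "w = inverse (b j) * q powi n" using j jn by blast
      then show ?thesis using k pole j False False2 unfolding is_rahman_contour_def by auto
    qed
  qed
  have eq: "contour_integral k ?F = contour_integral k G" if k: "is_rahman_contour q b ?F k" for k
  proof (rule contour_integral_cong_countable[OF _ cR])
    show "valid_path k" using k by (simp add: is_rahman_contour_def)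
    show "?F z = G z" if "z \<notin> - ?R" for z
      unfolding G_def using integrand_no_pole(1)[OF l fp] that by simp
  qed
  have img: "path_image k \<subseteq> D" if "is_rahman_contour q b ?F k" for k
    using wn[OF that] by blast
  have "contour_integral g G = contour_integral h G"
    by (rule contour_integral_homologous[OF \<open>open D\<close> \<open>connected D\<close> G])
       (use g img wn[OF g(1)] wn[OF g(2)] in \<open>auto simp: is_rahman_contour_def\<close>)
  then show ?thesis using eq g by simp
qed

text \<open>
  All poles belong to the two families of points constrained by \<open>separating\<close>. They are also not confused with each other:
  a point \<open>b\<^sub>j q\<^sup>n\<close> is never of the form \<open>b\<^sub>i\<^sup>-\<^sup>1 q\<^sup>m\<close>.
\<close>

lemma separating_is_rahman_contour:
  assumes l: "0 \<notin> l ` {1..6}" and f: "f = Fract p (pole_poly (pole_grid N))" and g: "separating (shifted_bset N) g"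
  shows "is_rahman_contour q b (rahman_integrand q b l f) g"
proof -
  let ?F = "rahman_integrand q b l f"
  note gv = separatingD(1-4)[OF g]
  have *: "(\<exists>i\<in>{1..6}. \<exists>m. z = b i * q powi (- int N) * q ^ m) \<or> (\<exists>i\<in>{1..6}. \<exists>m. z = 1 / (b i * q powi (- int N) * q ^ m))"
    if pole: "is_pole ?F z" and z: "z \<noteq> 0" for z
  proof -
    have "z \<notin> regular_at (shifted_bset N)" using integrand_no_pole(2)[OF l f] pole by blast
    then obtain i where i: "i \<in> {1..6}" "poc (b i * q powi (- int N) * z) = 0 \<or> poc (b i * q powi (- int N) / z) = 0"
      using z by (auto simp: regular_at_def shifted_bset_def)
    have "b i * q powi (- int N) \<noteq> 0" using b_nz[OF i(1)] by simp
    then show ?thesis using i poc_zero_right[of "b i * q powi (- int N)" z] poc_zero_left[OF z, of "b i * q powi (- int N)"] by blast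
  qed
  have inP: "z \<notin> path_image g \<and> winding_number g z = 1"
    if "i \<in> {1..6}" "z = b i * q powi (- int N) * q ^ m" for i m z
    using g that unfolding separating_def shifted_bset_def by blast
  have inQ: "z \<notin> path_image g \<and> winding_number g z = 0"
    if "i \<in> {1..6}" "z = 1 / (b i * q powi (- int N) * q ^ m)" for i m z
    using g that unfolding separating_def shifted_bset_def by blast
  have "z \<notin> path_image g \<and> winding_number g z = 1"
    if j: "j \<in> {1..6}" and z: "z = b j * q powi n" and pole: "is_pole ?F z" for j n z
  proof -
    have z0: "z \<noteq> 0" using z b_nz[OF j] by simp
    from *[OF pole z0] show ?thesis
    proof
      assume "\<exists>i\<in>{1..6}. \<exists>m. z = 1 / (b i * q powi (- int N) * q ^ m)"
      then obtain i m where i: "i \<in> {1..6}" "z = 1 / (b i * q powi (- int N) * q ^ m)" by blast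
      then have "b j * q powi n * (b i * q powi (- int N) * q powi int m) = 1"
        using z b_nz[OF i(1)] by (simp add: field_simps)
      then have "b j * b i * q powi (n - int N + int m) = 1"
        by (simp add: power_int_add power_int_diff power_int_minus field_simps)
      then have "b j * b i = q powi (- (n - int N + int m))"
        by (simp only: power_int_minus) (simp add: field_simps)
      then show ?thesis using b_mult_ne[OF j i(1)] by blast
    qed (use inP in blast)
  qed
  moreover have "z \<notin> path_image g \<and> winding_number g z = 0"
    if j: "j \<in> {1..6}" and z: "z = inverse (b j) * q powi n" and pole: "is_pole ?F z" for j n z
  proof -
    have z0: "z \<noteq> 0" using z b_nz[OF j] by simp
    from *[OF pole z0] show ?thesis
    proof
      assume "\<exists>i\<in>{1..6}. \<exists>m. z = b i * q powi (- int N) * q ^ m"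
      then obtain i m where i: "i \<in> {1..6}" "z = b i * q powi (- int N) * q ^ m" by blast
      then have "inverse (b j) * q powi n = b i * q powi (- int N + int m)"
        using z by (simp only: q_powi_add power_int_of_nat mult.assoc)
      then have "b i * b j * q powi (- int N + int m) = q powi n"
        using b_nz[OF j] by (simp add: field_simps)
      then have "b i * b j = q powi (n - (- int N + int m))"
        by (simp only: q_powi_diff) (simp add: field_simps)
      then show ?thesis using b_mult_ne[OF i(1) j] by blast
    qed (use inQ in blast)
  qed
  ultimately show ?thesis unfolding is_rahman_contour_def using gv by blast
qed

lemma ex_separating_shifted_bset: "\<exists>g. separating (shifted_bset N) g"
proof (rule ex_separating[OF shifted_bset_props])
  fix x y n assume "x \<in> shifted_bset N" "y \<in> shifted_bset N"
  then obtain i j where ij: "i \<in> {1..6}" "j \<in> {1..6}" "x = b i * q powi (- int N)" "y = b j * q powi (- int N)"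
    by (auto simp: shifted_bset_def)
  show "x * y \<noteq> q powi n"
  proof
    assume "x * y = q powi n"
    moreover have "b i * b j = x * y / q powi (- int N) / q powi (- int N)" using ij by simp
    ultimately have "b i * b j = q powi (n - - int N - - int N)" by (simp only: q_powi_diff)
    then show False using b_mult_ne ij by blast
  qed
qed

text \<open>
  The contour is allowed to depend on \<open>f\<close>; by \<open>rahman_contour_integral_unique\<close> the choice does not matter for \<open>f \<in> V\<close>.
\<close>

definition rahman_integral :: "(nat \<Rightarrow> complex) \<Rightarrow> complex poly fract \<Rightarrow> complex" where
  "rahman_integral l f = contour_integral (SOME g. is_rahman_contour q b (rahman_integrand q b l f) g) (rahman_integrand q b l f)"

lemma rahman_integral_eq:
  assumes l: "0 \<notin> l ` {1..6}" and f: "f \<in> V" and g: "is_rahman_contour q b (rahman_integrand q b l f) g"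
  shows "contour_integral g (rahman_integrand q b l f) = rahman_integral l f"
  unfolding rahman_integral_def
  by (rule rahman_contour_integral_unique[OF l f g someI[of "is_rahman_contour q b (rahman_integrand q b l f)", OF g]])

lemma rahman_integral_cleared:
  assumes l: "0 \<notin> l ` {1..6}" and f: "f \<in> V" "f = Fract p (pole_poly (pole_grid N))" and g: "separating (shifted_bset N) g"
  shows "rahman_integral l f = contour_integral g (cleared_integrand l N p)"
proof -
  have "rahman_integral l f = contour_integral g (rahman_integrand q b l f)"
    using rahman_integral_eq[OF l f(1) separating_is_rahman_contour[OF l f(2) g]] by simp
  also have "\<dots> = contour_integral g (cleared_integrand l N p)"
    by (rule contour_integral_cong[OF refl])
       (use integrand_eq_cleared[OF f(2)] separating_regular[OF g shifted_bset_props(2)] in blast)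
  finally show ?thesis .
qed

lemma cleared_integrand_integrable:
  assumes "0 \<notin> l ` {1..6}" "separating (shifted_bset N) g"
  shows "cleared_integrand l N p contour_integrable_on g"
  using separating_integrable[OF assms(2) shifted_bset_props(2,1) cleared_integrand_holo[OF assms(1)]] .

text \<open>
  One separating contour serves both functions and their sum.
\<close>

lemma rahman_integral_add:
  assumes l: "0 \<notin> l ` {1..6}" and f: "f \<in> V" and h: "h \<in> V"
  shows "rahman_integral l (f + h) = rahman_integral l f + rahman_integral l h"
proof -
  obtain N1 where N1: "\<And>N. N \<ge> N1 \<Longrightarrow> \<exists>p. f = Fract p (pole_poly (pole_grid N))" using V_on_grid[OF f] by blast
  obtain N2 where N2: "\<And>N. N \<ge> N2 \<Longrightarrow> \<exists>p. h = Fract p (pole_poly (pole_grid N))" using V_on_grid[OF h] by blast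
  define N where "N = max N1 N2"
  obtain p where p: "f = Fract p (pole_poly (pole_grid N))" using N1[of N] by (auto simp: N_def)
  obtain p' where p': "h = Fract p' (pole_poly (pole_grid N))" using N2[of N] by (auto simp: N_def)
  obtain g where g: "separating (shifted_bset N) g" using ex_separating_shifted_bset by blast
  have s: "f + h = Fract (p + p') (pole_poly (pole_grid N))"
    unfolding p p' by (simp add: eq_fract algebra_simps)
  have "cleared_integrand l N (p + p') = (\<lambda>z. cleared_integrand l N p z + cleared_integrand l N p' z)"
    by (intro ext) (simp only: cleared_integrand_def poly_add distrib_right)
  then have "contour_integral g (cleared_integrand l N (p + p')) = contour_integral g (cleared_integrand l N p) + contour_integral g (cleared_integrand l N p')"
    using contour_integral_add[OF cleared_integrand_integrable[OF l g] cleared_integrand_integrable[OF l g]] by simp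
  then show ?thesis
    using rahman_integral_cleared[OF l f p g] rahman_integral_cleared[OF l h p' g]
      rahman_integral_cleared[OF l V_add[OF f h] s g] by simp
qed

lemma rahman_integral_scale:
  assumes l: "0 \<notin> l ` {1..6}" and f: "f \<in> V"
  shows "rahman_integral l (rat_scale c f) = c * rahman_integral l f"
proof -
  obtain N p where p: "f = Fract p (pole_poly (pole_grid N))" using V_on_grid[OF f] by blast
  obtain g where g: "separating (shifted_bset N) g" using ex_separating_shifted_bset by blast
  have s: "rat_scale c f = Fract (smult c p) (pole_poly (pole_grid N))"
    unfolding p by (rule rat_scale_Fract)
  have "cleared_integrand l N (smult c p) = (\<lambda>z. c * cleared_integrand l N p z)"
    by (simp add: fun_eq_iff cleared_integrand_def)
  then have "contour_integral g (cleared_integrand l N (smult c p)) = c * contour_integral g (cleared_integrand l N p)"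
    using contour_integral_lmul[OF cleared_integrand_integrable[OF l g]] by simp
  then show ?thesis
    using rahman_integral_cleared[OF l f p g] rahman_integral_cleared[OF l V_scale[OF f] s g] by simp
qed

text \<open>
  The product turns the denominators \<open>(b\<^sub>j z\<^sup>\<plusminus>)\<^sub>\<infinity>\<close> into those with parameters \<open>b\<^sub>j q\<^bsup>k\<^sub>j\<^esup>\<close>, which satisfy the same
  hypotheses; then apply \<open>base_integral\<close> to them.
\<close>

lemma rahman_integral_elem:
  assumes lp: "(\<Prod>j=1..6. l j) = q"
    and gen: "theta ((l 1)\<^sup>2) \<noteq> 0" "theta ((l 2)\<^sup>2) \<noteq> 0" "theta (l 1 / l 2) \<noteq> 0"
    and k: "(\<Sum>j=1..6. k j) = 0"
  shows "rahman_integral l (rahman_elem q b k) = rahman_C q b l * shift_factor k"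
proof -
  let ?E = "rahman_elem q b k"
  have l: "0 \<notin> l ` {1..6}" by (rule zero_not_in_image_if_prod_eq_q[OF lp])
  then have lnz: "l j \<noteq> 0" if "j \<in> {1..6}" for j using that by (metis imageI)
  interpret R: rahman q "\<lambda>j. b j * q powi k j" by (rule rahman_shift[OF k])
  have E: "?E \<in> V" by (rule rahman_elem_in_V[OF k])
  obtain N1 where N1: "\<And>N. N \<ge> N1 \<Longrightarrow> \<exists>p. ?E = Fract p (pole_poly (pole_grid N))" using V_on_grid[OF E] by blast
  \<comment> \<open>\<open>N\<close> has to be so large that every \<open>b\<^sub>j q\<^bsup>k\<^sub>j\<^esup>\<close> is some \<open>b\<^sub>j q\<^sup>-\<^sup>N\<close> times a power \<open>q\<^sup>n\<close> with \<open>n \<ge> 0\<close>.\<close>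
  define N where "N = N1 + (\<Sum>j=1..6. nat \<bar>k j\<bar>)"
  obtain p where p: "?E = Fract p (pole_poly (pole_grid N))" using N1[of N] by (auto simp: N_def)
  obtain g where g: "separating (shifted_bset N) g" using ex_separating_shifted_bset by blast
  have Nk: "int N + k j \<ge> 0" if "j \<in> {1..6}" for j
  proof -
    have "nat \<bar>k j\<bar> \<le> (\<Sum>j=1..6. nat \<bar>k j\<bar>)" by (rule member_le_sum) (use that in auto)
    then show ?thesis unfolding N_def by linarith
  qed
  have gb: "separating R.bset g"
  proof (rule separating_subset[OF g])
    fix x assume "x \<in> R.bset"
    then obtain j where j: "j \<in> {1..6}" "x = b j * q powi k j" unfolding R.bset_image by blast
    have "q powi k j = q powi (- int N) * q powi int (nat (int N + k j))"
      using Nk[OF j(1)] by (simp only: q_powi_add[symmetric]) simp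
    then have "x = b j * q powi (- int N) * q ^ nat (int N + k j)"
      unfolding j(2) by (simp only: power_int_of_nat mult.assoc)
    then show "\<exists>a\<in>shifted_bset N. \<exists>n. x = a * q ^ n" using j(1) unfolding shifted_bset_def by blast
  qed
  \<comment> \<open>Where a factor of a denominator \<open>(b\<^sub>j z\<^sup>\<plusminus>)\<^bsub>k\<^sub>j\<^esub>\<close> could vanish the values are arbitrary; these points are exempted.\<close>
  define T where "T = (\<Union>j\<in>{1..6}. \<Union>n. {1 / (b j * q powi (- int n)), b j * q powi (- int n)})"
  have cT: "countable T" unfolding T_def by simp
  have "rahman_integral l ?E = contour_integral g (rahman_integrand q b l ?E)"
    using rahman_integral_eq[OF l E separating_is_rahman_contour[OF l p g]] by simp
  also have "\<dots> = contour_integral g (R.base_integrand l)"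
  proof (rule contour_integral_cong_countable[OF _ cT])
    show "valid_path g" using g by (simp add: separating_def)
    fix z assume z: "z \<in> path_image g" "z \<notin> T"
    have zr: "z \<in> regular_at (shifted_bset N)" using separating_regular[OF g shifted_bset_props(2)] z by blast
    then have z0: "z \<noteq> 0" by (simp add: regular_at_def)
    have ne: "b j * q powi (- int n) * z \<noteq> 1" "b j * q powi (- int n) / z \<noteq> 1" if "j \<in> {1..6}" for j n
    proof -
      have "z \<noteq> 1 / (b j * q powi (- int n))" "z \<noteq> b j * q powi (- int n)"
        using z(2) that unfolding T_def by blast+
      then show "b j * q powi (- int n) * z \<noteq> 1" "b j * q powi (- int n) / z \<noteq> 1"
        using z0 b_nz[OF that] by (auto simp: field_simps)
    qed
    have ev: "rat_eval ?E (joukowski z) = (\<Prod>j=1..6. qpoch q (b j * z) (k j) * qpoch q (b j / z) (k j))"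
      by (rule rat_eval_rahman_elem[OF z0]) (use ne in auto)
    have f: "qpoch q (b j * z) (k j) * qpoch q (b j / z) (k j) * (theta (l j * z) / (poc (b j * z) * poc (b j / z))) =
        theta (l j * z) / (poc (b j * q powi k j * z) * poc (b j * q powi k j / z))" if j: "j \<in> {1..6}" for j
    proof -
      have nz: "poc (b j * z) \<noteq> 0" "poc (b j / z) \<noteq> 0"
      proof -
        have "poc (b j * q powi (- int N) * z) \<noteq> 0" "poc (b j * q powi (- int N) / z) \<noteq> 0"
          using zr j by (auto simp: regular_at_def shifted_bset_def)
        then show "poc (b j * z) \<noteq> 0" "poc (b j / z) \<noteq> 0"
          using poc_split_down[of "b j * z" N] poc_split_down[of "b j / z" N] by (auto simp: mult_ac)
      qed
      have "poc (b j * z) = qpoch q (b j * z) (k j) * poc (b j * z * q powi k j)"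
        by (rule poc_qpoch) (use ne(1)[OF j] in \<open>simp add: mult_ac\<close>)
      moreover have "poc (b j / z) = qpoch q (b j / z) (k j) * poc (b j / z * q powi k j)"
        by (rule poc_qpoch) (use ne(2)[OF j] in \<open>simp add: mult_ac\<close>)
      moreover have "b j * z * q powi k j = b j * q powi k j * z" "b j / z * q powi k j = b j * q powi k j / z"
        by simp_all
      ultimately show ?thesis using nz by (simp add: field_simps)
    qed
    have "rahman_integrand q b l ?E z = ((z - inverse z) / z\<^sup>2) *
       ((\<Prod>j=1..6. qpoch q (b j * z) (k j) * qpoch q (b j / z) (k j)) *
        (\<Prod>j=1..6. theta (l j * z) / (poc (b j * z) * poc (b j / z)))) * (1 / (2 * of_real pi * \<i> * z))"
      unfolding rahman_integrand_def ev by (simp only: mult_ac)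
    also have "\<dots> = R.base_integrand l z"
    proof -
      have "(\<Prod>j=1..6. qpoch q (b j * z) (k j) * qpoch q (b j / z) (k j) *
           (theta (l j * z) / (poc (b j * z) * poc (b j / z)))) =
         (\<Prod>j=1..6. theta (l j * z) / (poc (b j * q powi k j * z) * poc (b j * q powi k j / z)))"
        by (rule prod.cong[OF refl]) (rule f)
      then show ?thesis unfolding R.base_integrand_def prod.distrib[symmetric] by (simp only:)
    qed
    finally show "rahman_integrand q b l ?E z = R.base_integrand l z" .
  qed
  also have "\<dots> = rahman_C q (\<lambda>j. b j * q powi k j) l"
    by (rule R.base_integral[OF gb lp gen])
  also have "\<dots> = rahman_C q b l * shift_factor k"
    by (rule rahman_C_shift[OF k]) (use lnz in auto)
  finally show ?thesis .
qed

lemma rahman_integral_functional: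
  assumes lp: "(\<Prod>j=1..6. l j) = q"
    and gen: "theta ((l 1)\<^sup>2) \<noteq> 0" "theta ((l 2)\<^sup>2) \<noteq> 0" "theta (l 1 / l 2) \<noteq> 0"
    and C: "rahman_C q b l \<noteq> 0"
  shows "is_rahman_functional q b (\<lambda>f. rahman_integral l f / rahman_C q b l)"
proof -
  show ?thesis
    unfolding is_rahman_functional_def V_def[symmetric] shift_factor_def[symmetric]
    using rahman_integral_add rahman_integral_scale rahman_integral_elem[OF lp gen] C
      zero_not_in_image_if_prod_eq_q[OF lp]
    by (simp add: add_divide_distrib)
qed

end

section \<open>The integral formula\<close>

theorem proposition3p4:
  fixes q :: complex and b l :: "nat \<Rightarrow> complex"
    and f :: "complex poly fract" and \<gamma> :: "real \<Rightarrow> complex"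
  assumes q: "0 < norm q" "norm q < 1"
    and b_prod: "(\<Prod>j=1..6. b j) = q"
    and b_quot: "\<And>i j n. 1 \<le> i \<Longrightarrow> i < j \<Longrightarrow> j \<le> 6 \<Longrightarrow> b i / b j \<noteq> q powi n"
    and b_mult: "\<And>i j n. 1 \<le> i \<Longrightarrow> i \<le> j \<Longrightarrow> j \<le> 6 \<Longrightarrow> b i * b j \<noteq> q powi n"
    and l_prod: "(\<Prod>j=1..6. l j) = q"
    and generic: "qtheta q ((l 1)\<^sup>2) \<noteq> 0" "qtheta q ((l 2)\<^sup>2) \<noteq> 0"
      "qtheta q (l 1 / l 2) \<noteq> 0" "qtheta q (l 2 / l 1) \<noteq> 0" "rahman_C q b l \<noteq> 0"
    and f: "f \<in> rahman_space q b"
    and contour: "is_rahman_contour q b (rahman_integrand q b l f) \<gamma>"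
  shows "rahman_J q b f =
           1 / rahman_C q b l * contour_integral \<gamma> (rahman_integrand q b l f)"
proof -
  interpret rahman q b
    by unfold_locales (use q b_prod b_quot b_mult in auto)
  have l: "0 \<notin> l ` {1..6}" by (rule zero_not_in_image_if_prod_eq_q[OF l_prod])
  have fV: "f \<in> V" using f by (simp add: V_def)
  note I = rahman_integral_functional[OF l_prod generic(1,2,3,5)]
  have "is_rahman_functional q b (rahman_J q b)"
    unfolding rahman_J_def by (rule someI[of "is_rahman_functional q b", OF I])
  then have "rahman_J q b f = rahman_integral l f / rahman_C q b l"
    by (rule rahman_functional_unique[OF _ I fV])
  also have "rahman_integral l f = contour_integral \<gamma> (rahman_integrand q b l f)"
    by (rule rahman_integral_eq[OF l fV contour, symmetric])
  finally show ?thesis by simp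
qed

end
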